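(* For a $\square_q$-module $V$ the following are equivalent: \begin{itemize} \item[(i)] $V$ is isomorphic to the (mutually isomorphic) $\square_q$-modules $(\mathbb V/J)_{\rm I}$, $(\mathbb V/J)_{\rm IS}$, $(\mathbb V/J)_{\rm IT}$, $(\mathbb V/J)_{\rm IST}$, $(\mathbb V/J)_{\rm II}$, $(\mathbb V/J)_{\rm IIS}$, $(\mathbb V/J)_{\rm IIT}$, $(\mathbb V/J)_{\rm IIST}$, $U_{\rm III}$, $U_{\rm IIIS}$, $U_{\rm IIIT}$, $U_{\rm IIIST}$, $U_{\rm IV}$, $U_{\rm IVS}$, $U_{\rm IVT}$, $U_{\rm IVST}$; \item[(ii)] $V$ is generated by a nonzero vector $\xi$ such that $x_1\xi=0$ and $x_3\xi=0$. \end{itemize}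
   Context: Throughout, $\mathbb F$ is a field and $q\in\mathbb F$ is nonzero and not a root of unity. All vector spaces and algebras are over $\mathbb F$; algebras are associative with multiplicative identity. $[3]_q=(q^3-q^{-3})/(q-q^{-1})$ and $Q=1-q^2$. The algebra $\square_q$ is defined by generators $\{x_i\}_{i\in\mathbb Z_4}$ ($\mathbb Z_4=\mathbb Z/4\mathbb Z$) and relations, for $i\in\mathbb Z_4$: $\frac{q x_ix_{i+1}-q^{-1}x_{i+1}x_i}{q-q^{-1}}=1$ and $x_i^3x_{i+2}-[3]_q x_i^2x_{i+2}x_i+[3]_q x_ix_{i+2}x_i^2-x_{i+2}x_i^3=0$. A nonzero $\square_q$-module $V$ is generated by $\xi\in V$ if no proper $\square_q$-submodule of $V$ contains $\xi$. Let $\mathbb V$ be the free algebra on two generators $A,B$. A word of length $n$ is a product $v_1v_2\cdots v_n$ with each $v_i\in\{A,B\}$ (the word of length $0$ is $1$); the words form the standard basis of $\mathbb V$. Let $(\,,\,)$ be the bilinear form on $\mathbb V$ for which the words are orthonormal. ${\rm End}(\mathbb V)$ is the algebra of $\mathbb F$-linear maps $\mathbb V\to\mathbb V$ whose matrix with respect to the standard basis has finitely many nonzero entries in each row; each $X\in{\rm End}(\mathbb V)$ has a unique adjoint $X^*\in{\rm End}(\mathbb V)$ with $(Xu,v)=(u,X^*v)$ for all $u,v\in\mathbb V$. $K$ is the automorphism of the free algebra $\mathbb V$ with $A\mapsto q^2A$, $B\mapsto q^{-2}B$. Define $A_L(v)=Av$, $B_L(v)=Bv$, $A_R(v)=vA$,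 $B_R(v)=vB$ for $v\in\mathbb V$. Put $\langle A,A\rangle=\langle B,B\rangle=2$, $\langle A,B\rangle=\langle B,A\rangle=-2$. The $q$-shuffle product $\star$ is the associative bilinear product on $\mathbb V$ with $1\star v=v\star1=v$ and, recursively for nontrivial words $u=u_1\cdots u_r$, $v=v_1\cdots v_s$, $u\star v=u_1\bigl((u_2\cdots u_r)\star v\bigr)+v_1\bigl(u\star(v_2\cdots v_s)\bigr)q^{\langle u_1,v_1\rangle+\langle u_2,v_1\rangle+\cdots+\langle u_r,v_1\rangle}$. Define $A_\ell(v)=A\star v$, $B_\ell(v)=B\star v$, $A_r(v)=v\star A$, $B_r(v)=v\star B$ for $v\in\mathbb V$. $J$ is the 2-sided ideal of the free algebra $\mathbb V$ generated by $A^3B-[3]_qA^2BA+[3]_qABA^2-BA^3$ and $B^3A-[3]_qB^2AB+[3]_qBAB^2-AB^3$. It is invariant under $K^{\pm1},A_L,B_L,A_R,B_R,A^*_\ell,B^*_\ell,A^*_r,B^*_r$, so these maps act on $\mathbb V/J$. $U$ is the subalgebra of the $q$-shuffle algebra $(\mathbb V,\star)$ generated by $A,B$. It is invariant under $K^{\pm1},A_\ell,B_\ell,A_r,B_r,A^*_L,B^*_L,A^*_R,B^*_R$, so these maps act on $U$. The $\square_q$-modules are as follows ($x_0,x_1,x_2,x_3$ act respectively as the listed maps). On $\mathbb V/J$: I: $A_L,\ Q(A^*_\ell-B^*_rK),\ B_L,\ Q(B^*_\ell-A^*_rK^{-1})$. IS: $A_R,\ Q(A^*_r-B^*_\ell K),\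 B_R,\ Q(B^*_r-A^*_\ell K^{-1})$. IT: $B_L,\ Q(B^*_\ell-A^*_rK^{-1}),\ A_L,\ Q(A^*_\ell-B^*_rK)$. IST: $B_R,\ Q(B^*_r-A^*_\ell K^{-1}),\ A_R,\ Q(A^*_r-B^*_\ell K)$. II: $Q(A_L-KB_R),\ A^*_\ell,\ Q(B_L-K^{-1}A_R),\ B^*_\ell$. IIS: $Q(A_R-KB_L),\ A^*_r,\ Q(B_R-K^{-1}A_L),\ B^*_r$. IIT: $Q(B_L-K^{-1}A_R),\ B^*_\ell,\ Q(A_L-KB_R),\ A^*_\ell$. IIST: $Q(B_R-K^{-1}A_L),\ B^*_r,\ Q(A_R-KB_L),\ A^*_r$. On $U$: III: $A_\ell,\ Q(A^*_L-B^*_RK),\ B_\ell,\ Q(B^*_L-A^*_RK^{-1})$. IIIS: $A_r,\ Q(A^*_R-B^*_LK),\ B_r,\ Q(B^*_R-A^*_LK^{-1})$. IIIT: $B_\ell,\ Q(B^*_L-A^*_RK^{-1}),\ A_\ell,\ Q(A^*_L-B^*_RK)$. IIIST: $B_r,\ Q(B^*_R-A^*_LK^{-1}),\ A_r,\ Q(A^*_R-B^*_LK)$. IV: $Q(A_\ell-KB_r),\ A^*_L,\ Q(B_\ell-K^{-1}A_r),\ B^*_L$. IVS: $Q(A_r-KB_\ell),\ A^*_R,\ Q(B_r-K^{-1}A_\ell),\ B^*_R$. IVT: $Q(B_\ell-K^{-1}A_r),\ B^*_L,\ Q(A_\ell-KB_r),\ A^*_L$. IVST: $Q(B_r-K^{-1}A_\ell),\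 B^*_R,\ Q(A_r-KB_\ell),\ A^*_R$. The module with label I is denoted $(\mathbb V/J)_{\rm I}$, the one with label III is denoted $U_{\rm III}$, and so on. These sixteen modules are mutually isomorphic. *)

theory Defs
  imports
    "HOL-Algebra.QuotRing"
    "HOL-Algebra.Module"
    "HOL-Algebra.Algebraic_Closure_Type"
    "HOL-Library.Poly_Mapping"
    "HOL-Library.Numeral_Type"
begin

section \<open>Free algebras\<close>

text \<open>
  With concatenation as addition, words form a (noncommutative, additively written) monoid, and
  the convolution product of \<^theory>\<open>HOL-Library.Poly_Mapping\<close> makes the finitely supported
  functions from words to a field the free algebra on the set of letters; the standard basis
  consists of the functions \<open>Poly_Mapping.single w 1\<close>.
\<close>

instantiation list :: (type) monoid_add
begin
definition zero_list :: "'a list" where "zero_list = []"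
definition plus_list :: "'a list \<Rightarrow> 'a list \<Rightarrow> 'a list" where "plus_list u v = u @ v"
instance by standard (simp_all add: zero_list_def plus_list_def)
end

type_synonym ('x, 'f) free = "'x list \<Rightarrow>\<^sub>0 'f"

definition gen :: "'x \<Rightarrow> ('x, 'f::field) free" where
  "gen x = Poly_Mapping.single [x] 1"

definition const :: "'f \<Rightarrow> ('x, 'f::field) free" where
  "const c = Poly_Mapping.single [] c"

definition scale :: "'f \<Rightarrow> ('x, 'f::field) free \<Rightarrow> ('x, 'f) free" where
  "scale c p = const c * p"

text \<open>The extension of a map on letters to a homomorphism of free algebras.\<close>

definition free_hom :: "('x \<Rightarrow> ('y, 'f::field) free) \<Rightarrow> ('x, 'f) free \<Rightarrow> ('y, 'f) free" where
  "free_hom f p = (\<Sum>w\<in>Poly_Mapping.keys p. scale (Poly_Mapping.lookup p w) (prod_list (map f w)))"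

abbreviation free_ring :: "('x, 'f::field) free ring" where
  "free_ring \<equiv> ring_of_type_algebra"

definition map_quot ::
  "('x, 'f::field) free set \<Rightarrow> (('x, 'f) free \<Rightarrow> ('x, 'f) free) \<Rightarrow> ('x, 'f) free set \<Rightarrow> ('x, 'f) free set"
where
  "map_quot I F C = the_elem ((\<lambda>v. I +>\<^bsub>free_ring\<^esub> F v) ` C)"

definition quot_alg :: "('x, 'f::field) free set \<Rightarrow> ('f, ('x, 'f) free set) module" where
  "quot_alg I = ring.extend (free_ring Quot I) (module.fields (\<lambda>c. map_quot I (scale c)))"


section \<open>The algebra and its modules\<close>

definition q_three :: "'f::field \<Rightarrow> 'f" where
  "q_three q = (q ^ 3 - inverse q ^ 3) / (q - inverse q)"

definition serre :: "'f::field \<Rightarrow> ('x, 'f) free \<Rightarrow> ('x, 'f) free \<Rightarrow> ('x, 'f) free" where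
  "serre q x y = x ^ 3 * y - scale (q_three q) (x ^ 2 * y * x)
     + scale (q_three q) (x * y * x ^ 2) - y * x ^ 3"

text \<open>The index set is the type \<open>4\<close>, i.e. the ring of integers modulo 4.\<close>

definition box_relators :: "'f::field \<Rightarrow> (4, 'f) free set" where
  "box_relators q =
     range (\<lambda>i. scale (inverse (q - inverse q))
        (scale q (gen i * gen (i + 1)) - scale (inverse q) (gen (i + 1) * gen i)) - 1)
     \<union> range (\<lambda>i. serre q (gen i) (gen (i + 2)))"

definition box_ideal :: "'f::field \<Rightarrow> (4, 'f) free set" where
  "box_ideal q = Idl\<^bsub>free_ring\<^esub> (box_relators q)"

definition box_alg :: "'f::field \<Rightarrow> ('f, (4, 'f) free set) module" where
  "box_alg q = quot_alg (box_ideal q)"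

definition box_gen :: "'f::field \<Rightarrow> 4 \<Rightarrow> (4, 'f) free set" where
  "box_gen q i = box_ideal q +>\<^bsub>free_ring\<^esub> gen i"

text \<open>
  Modules are carried by records: the fields \<open>mult\<close> and \<open>one\<close>, which \<open>module\<close> inherits from
  \<open>ring\<close>, play no role.
\<close>

record (overloaded) ('f, 'v) box_mod = "('f, 'v) module" +
  act :: "(4, 'f) free set \<Rightarrow> 'v \<Rightarrow> 'v"

locale box_module = module "ring_of_type_algebra :: 'f ring" V
  for q :: "'f::field" and V :: "('f, 'v) box_mod" +
  assumes act_closed: "\<lbrakk>a \<in> carrier (box_alg q); v \<in> carrier V\<rbrakk> \<Longrightarrow> act V a v \<in> carrier V"
    and act_add_right: "\<lbrakk>a \<in> carrier (box_alg q); v \<in> carrier V; w \<in> carrier V\<rbrakk> \<Longrightarrow>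
      act V a (v \<oplus>\<^bsub>V\<^esub> w) = act V a v \<oplus>\<^bsub>V\<^esub> act V a w"
    and act_smult_right: "\<lbrakk>a \<in> carrier (box_alg q); v \<in> carrier V\<rbrakk> \<Longrightarrow>
      act V a (c \<odot>\<^bsub>V\<^esub> v) = c \<odot>\<^bsub>V\<^esub> act V a v"
    and act_add_left: "\<lbrakk>a \<in> carrier (box_alg q); b \<in> carrier (box_alg q); v \<in> carrier V\<rbrakk> \<Longrightarrow>
      act V (a \<oplus>\<^bsub>box_alg q\<^esub> b) v = act V a v \<oplus>\<^bsub>V\<^esub> act V b v"
    and act_smult_left: "\<lbrakk>a \<in> carrier (box_alg q); v \<in> carrier V\<rbrakk> \<Longrightarrow>
      act V (c \<odot>\<^bsub>box_alg q\<^esub> a) v = c \<odot>\<^bsub>V\<^esub> act V a v"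
    and act_mult: "\<lbrakk>a \<in> carrier (box_alg q); b \<in> carrier (box_alg q); v \<in> carrier V\<rbrakk> \<Longrightarrow>
      act V (a \<otimes>\<^bsub>box_alg q\<^esub> b) v = act V a (act V b v)"
    and act_one: "v \<in> carrier V \<Longrightarrow> act V \<one>\<^bsub>box_alg q\<^esub> v = v"

definition box_iso :: "'f::field \<Rightarrow> ('f, 'v) box_mod \<Rightarrow> ('f, 'w) box_mod \<Rightarrow> bool" where
  "box_iso q V W \<longleftrightarrow> (\<exists>\<phi>. bij_betw \<phi> (carrier V) (carrier W) \<and>
     (\<forall>v\<in>carrier V. \<forall>w\<in>carrier V. \<phi> (v \<oplus>\<^bsub>V\<^esub> w) = \<phi> v \<oplus>\<^bsub>W\<^esub> \<phi> w) \<and>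
     (\<forall>c. \<forall>v\<in>carrier V. \<phi> (c \<odot>\<^bsub>V\<^esub> v) = c \<odot>\<^bsub>W\<^esub> \<phi> v) \<and>
     (\<forall>a\<in>carrier (box_alg q). \<forall>v\<in>carrier V. \<phi> (act V a v) = act W a (\<phi> v)))"

definition box_submodule :: "'f::field \<Rightarrow> 'v set \<Rightarrow> ('f, 'v) box_mod \<Rightarrow> bool" where
  "box_submodule q W V \<longleftrightarrow> submodule W (ring_of_type_algebra :: 'f ring) V \<and>
     (\<forall>a\<in>carrier (box_alg q). \<forall>w\<in>W. act V a w \<in> W)"

definition generated_by :: "'f::field \<Rightarrow> ('f, 'v) box_mod \<Rightarrow> 'v \<Rightarrow> bool" where
  "generated_by q V \<xi> \<longleftrightarrow> carrier V \<noteq> {\<zero>\<^bsub>V\<^esub>} \<and> \<xi> \<in> carrier V \<and>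
     \<not> (\<exists>W. box_submodule q W V \<and> W \<noteq> carrier V \<and> \<xi> \<in> W)"

text \<open>
  A vector space \<open>W\<close> with four linear maps that satisfy the defining relations is turned into a
  module on which the generator with index \<open>i\<close> acts as \<open>T i\<close>: an element of the algebra acts
  by evaluating a representative in the free algebra at the four maps.
\<close>

definition eval_ops :: "('f::field, 'v) module \<Rightarrow> (4 \<Rightarrow> 'v \<Rightarrow> 'v) \<Rightarrow> (4, 'f) free \<Rightarrow> 'v \<Rightarrow> 'v" where
  "eval_ops W T p v =
     finsum W (\<lambda>w. Poly_Mapping.lookup p w \<odot>\<^bsub>W\<^esub> foldr T w v) (Poly_Mapping.keys p)"

definition box_mod_of :: "('f::field, 'v) module \<Rightarrow> (4 \<Rightarrow> 'v \<Rightarrow> 'v) \<Rightarrow> ('f, 'v) box_mod" where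
  "box_mod_of W T = module.extend W
     (box_mod.fields (\<lambda>a v. the_elem ((\<lambda>p. eval_ops W T p v) ` a)))"

definition box_ops :: "'a \<Rightarrow> 'a \<Rightarrow> 'a \<Rightarrow> 'a \<Rightarrow> 4 \<Rightarrow> 'a" where
  "box_ops t0 t1 t2 t3 i = (if i = 0 then t0 else if i = 1 then t1 else if i = 2 then t2 else t3)"


section \<open>The free algebra on two generators and its operators\<close>

datatype letter = LA | LB

type_synonym 'f free2 = "(letter, 'f) free"

definition form :: "'f::field free2 \<Rightarrow> 'f free2 \<Rightarrow> 'f" where
  "form u v = (\<Sum>w\<in>Poly_Mapping.keys u. Poly_Mapping.lookup u w * Poly_Mapping.lookup v w)"

definition End_row_finite :: "('f::field free2 \<Rightarrow> 'f free2) set" where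
  "End_row_finite = {F. Vector_Spaces.linear scale scale F \<and>
     (\<forall>w. finite {w'. Poly_Mapping.lookup (F (Poly_Mapping.single w' 1)) w \<noteq> 0})}"

definition adj :: "('f::field free2 \<Rightarrow> 'f free2) \<Rightarrow> 'f free2 \<Rightarrow> 'f free2" where
  "adj F = (THE G. G \<in> End_row_finite \<and> (\<forall>u v. form (F u) v = form u (G v)))"

definition Kaut :: "'f::field \<Rightarrow> 'f free2 \<Rightarrow> 'f free2" where
  "Kaut q = free_hom (\<lambda>a. case a of LA \<Rightarrow> scale (q ^ 2) (gen LA)
                                  | LB \<Rightarrow> scale (inverse q ^ 2) (gen LB))"

definition Kinv :: "'f::field \<Rightarrow> 'f free2 \<Rightarrow> 'f free2" where
  "Kinv q = the_inv (Kaut q)"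

fun pairing :: "letter \<Rightarrow> letter \<Rightarrow> int" where
  "pairing a b = (if a = b then 2 else - 2)"

fun shuffle_word :: "'f::field \<Rightarrow> letter list \<Rightarrow> letter list \<Rightarrow> 'f free2" where
  "shuffle_word q [] v = Poly_Mapping.single v 1"
| "shuffle_word q u [] = Poly_Mapping.single u 1"
| "shuffle_word q (a # u) (b # v) =
     gen a * shuffle_word q u (b # v)
     + scale (q powi (\<Sum>c\<leftarrow>a # u. pairing c b)) (gen b * shuffle_word q (a # u) v)"

definition shuffle :: "'f::field \<Rightarrow> 'f free2 \<Rightarrow> 'f free2 \<Rightarrow> 'f free2" where
  "shuffle q x y = (\<Sum>u\<in>Poly_Mapping.keys x. \<Sum>v\<in>Poly_Mapping.keys y.
     scale (Poly_Mapping.lookup x u * Poly_Mapping.lookup y v) (shuffle_word q u v))"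

definition A_L :: "'f::field free2 \<Rightarrow> 'f free2" where "A_L v = gen LA * v"
definition B_L :: "'f::field free2 \<Rightarrow> 'f free2" where "B_L v = gen LB * v"
definition A_R :: "'f::field free2 \<Rightarrow> 'f free2" where "A_R v = v * gen LA"
definition B_R :: "'f::field free2 \<Rightarrow> 'f free2" where "B_R v = v * gen LB"
definition A_l :: "'f::field \<Rightarrow> 'f free2 \<Rightarrow> 'f free2" where "A_l q v = shuffle q (gen LA) v"
definition B_l :: "'f::field \<Rightarrow> 'f free2 \<Rightarrow> 'f free2" where "B_l q v = shuffle q (gen LB) v"
definition A_r :: "'f::field \<Rightarrow> 'f free2 \<Rightarrow> 'f free2" where "A_r q v = shuffle q v (gen LA)"
definition B_r :: "'f::field \<Rightarrow> 'f free2 \<Rightarrow> 'f free2" where "B_r q v = shuffle q v (gen LB)"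

definition Qdiff ::
  "'f::field \<Rightarrow> ('f free2 \<Rightarrow> 'f free2) \<Rightarrow> ('f free2 \<Rightarrow> 'f free2) \<Rightarrow> 'f free2 \<Rightarrow> 'f free2"
where
  "Qdiff q F G v = scale (1 - q ^ 2) (F v - G v)"


section \<open>The sixteen modules\<close>

definition J :: "'f::field \<Rightarrow> 'f free2 set" where
  "J q = Idl\<^bsub>free_ring\<^esub> {serre q (gen LA) (gen LB), serre q (gen LB) (gen LA)}"

inductive_set U :: "'f::field \<Rightarrow> 'f free2 set" for q :: 'f where
  U_one: "1 \<in> U q"
| U_gen: "gen a \<in> U q"
| U_add: "\<lbrakk>x \<in> U q; y \<in> U q\<rbrakk> \<Longrightarrow> x + y \<in> U q"
| U_scale: "x \<in> U q \<Longrightarrow> scale c x \<in> U q"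
| U_shuffle: "\<lbrakk>x \<in> U q; y \<in> U q\<rbrakk> \<Longrightarrow> shuffle q x y \<in> U q"

definition U_alg :: "'f::field \<Rightarrow> ('f, 'f free2) module" where
  "U_alg q = \<lparr>carrier = U q, monoid.mult = shuffle q, one = 1, ring.zero = 0, add = (+), module.smult = scale\<rparr>"

text \<open>The arguments are operators on the whole free algebra; they leave \<open>J\<close>, resp. \<open>U\<close>, invariant.\<close>

definition VJ_mod ::
  "'f::field \<Rightarrow> (4 \<Rightarrow> 'f free2 \<Rightarrow> 'f free2) \<Rightarrow> ('f, 'f free2 set) box_mod" where
  "VJ_mod q T = box_mod_of (quot_alg (J q)) (\<lambda>i. map_quot (J q) (T i))"

definition U_mod ::
  "'f::field \<Rightarrow> (4 \<Rightarrow> 'f free2 \<Rightarrow> 'f free2) \<Rightarrow> ('f, 'f free2) box_mod" where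
  "U_mod q T = box_mod_of (U_alg q) T"

definition VJ_I :: "'f::field \<Rightarrow> ('f, 'f free2 set) box_mod" where
  "VJ_I q = VJ_mod q (box_ops A_L
     (Qdiff q (adj (A_l q)) (adj (B_r q) \<circ> Kaut q))
     B_L
     (Qdiff q (adj (B_l q)) (adj (A_r q) \<circ> Kinv q)))"

definition VJ_IS :: "'f::field \<Rightarrow> ('f, 'f free2 set) box_mod" where
  "VJ_IS q = VJ_mod q (box_ops A_R
     (Qdiff q (adj (A_r q)) (adj (B_l q) \<circ> Kaut q))
     B_R
     (Qdiff q (adj (B_r q)) (adj (A_l q) \<circ> Kinv q)))"

definition VJ_IT :: "'f::field \<Rightarrow> ('f, 'f free2 set) box_mod" where
  "VJ_IT q = VJ_mod q (box_ops B_L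
     (Qdiff q (adj (B_l q)) (adj (A_r q) \<circ> Kinv q))
     A_L
     (Qdiff q (adj (A_l q)) (adj (B_r q) \<circ> Kaut q)))"

definition VJ_IST :: "'f::field \<Rightarrow> ('f, 'f free2 set) box_mod" where
  "VJ_IST q = VJ_mod q (box_ops B_R
     (Qdiff q (adj (B_r q)) (adj (A_l q) \<circ> Kinv q))
     A_R
     (Qdiff q (adj (A_r q)) (adj (B_l q) \<circ> Kaut q)))"

definition VJ_II :: "'f::field \<Rightarrow> ('f, 'f free2 set) box_mod" where
  "VJ_II q = VJ_mod q (box_ops (Qdiff q A_L (Kaut q \<circ> B_R))
     (adj (A_l q))
     (Qdiff q B_L (Kinv q \<circ> A_R))
     (adj (B_l q)))"

definition VJ_IIS :: "'f::field \<Rightarrow> ('f, 'f free2 set) box_mod" where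
  "VJ_IIS q = VJ_mod q (box_ops (Qdiff q A_R (Kaut q \<circ> B_L))
     (adj (A_r q))
     (Qdiff q B_R (Kinv q \<circ> A_L))
     (adj (B_r q)))"

definition VJ_IIT :: "'f::field \<Rightarrow> ('f, 'f free2 set) box_mod" where
  "VJ_IIT q = VJ_mod q (box_ops (Qdiff q B_L (Kinv q \<circ> A_R))
     (adj (B_l q))
     (Qdiff q A_L (Kaut q \<circ> B_R))
     (adj (A_l q)))"

definition VJ_IIST :: "'f::field \<Rightarrow> ('f, 'f free2 set) box_mod" where
  "VJ_IIST q = VJ_mod q (box_ops (Qdiff q B_R (Kinv q \<circ> A_L))
     (adj (B_r q))
     (Qdiff q A_R (Kaut q \<circ> B_L))
     (adj (A_r q)))"

definition U_III :: "'f::field \<Rightarrow> ('f, 'f free2) box_mod" where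
  "U_III q = U_mod q (box_ops (A_l q)
     (Qdiff q (adj A_L) (adj B_R \<circ> Kaut q))
     (B_l q)
     (Qdiff q (adj B_L) (adj A_R \<circ> Kinv q)))"

definition U_IIIS :: "'f::field \<Rightarrow> ('f, 'f free2) box_mod" where
  "U_IIIS q = U_mod q (box_ops (A_r q)
     (Qdiff q (adj A_R) (adj B_L \<circ> Kaut q))
     (B_r q)
     (Qdiff q (adj B_R) (adj A_L \<circ> Kinv q)))"

definition U_IIIT :: "'f::field \<Rightarrow> ('f, 'f free2) box_mod" where
  "U_IIIT q = U_mod q (box_ops (B_l q)
     (Qdiff q (adj B_L) (adj A_R \<circ> Kinv q))
     (A_l q)
     (Qdiff q (adj A_L) (adj B_R \<circ> Kaut q)))"

definition U_IIIST :: "'f::field \<Rightarrow> ('f, 'f free2) box_mod" where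
  "U_IIIST q = U_mod q (box_ops (B_r q)
     (Qdiff q (adj B_R) (adj A_L \<circ> Kinv q))
     (A_r q)
     (Qdiff q (adj A_R) (adj B_L \<circ> Kaut q)))"

definition U_IV :: "'f::field \<Rightarrow> ('f, 'f free2) box_mod" where
  "U_IV q = U_mod q (box_ops (Qdiff q (A_l q) (Kaut q \<circ> B_r q))
     (adj A_L)
     (Qdiff q (B_l q) (Kinv q \<circ> A_r q))
     (adj B_L))"

definition U_IVS :: "'f::field \<Rightarrow> ('f, 'f free2) box_mod" where
  "U_IVS q = U_mod q (box_ops (Qdiff q (A_r q) (Kaut q \<circ> B_l q))
     (adj A_R)
     (Qdiff q (B_r q) (Kinv q \<circ> A_l q))
     (adj B_R))"

definition U_IVT :: "'f::field \<Rightarrow> ('f, 'f free2) box_mod" where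
  "U_IVT q = U_mod q (box_ops (Qdiff q (B_l q) (Kinv q \<circ> A_r q))
     (adj B_L)
     (Qdiff q (A_l q) (Kaut q \<circ> B_r q))
     (adj A_L))"

definition U_IVST :: "'f::field \<Rightarrow> ('f, 'f free2) box_mod" where
  "U_IVST q = U_mod q (box_ops (Qdiff q (B_r q) (Kinv q \<circ> A_l q))
     (adj B_R)
     (Qdiff q (A_r q) (Kaut q \<circ> B_l q))
     (adj A_R))"

end

(*
  The homomorphism psi from the free algebra to the q-shuffle algebra turns the multiplications
  A_L, A_R and the skew derivations A_l^*, A_r^* into A_l, A_r, A_L^*, A_R^*; its image is U.
  Everything rests on its kernel being J. Let x be a homogeneous element of minimal length in the kernel but not
  in J. All skew derivatives of x lie in J. If the weight of x is nonzero, then, as in the theory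
  of integrable modules, the q-Serre relations (ad A is locally nilpotent) contradict x being a
  lowest weight vector of positive weight for A or for B. If x has weight 0 and length n, its
  primitivity gives S(x) = -x for the antipode S of the shuffle structure; but S is, on words of
  weight 0, the reversal times (-1)^n q^(-n), and applying it twice gives q^(-2n) = 1.

  Module I is irreducible: a vector u of U killed by x_1 and x_3 satisfies u(a w) = q^e u(w a')
  for the coefficients of words, where a' is the other letter. After 2 |w| such rotations a word
  returns to itself, and the total exponent is -4 |w|, so u is a constant. Hence a cyclic module
  whose generator is killed by x_1 and x_3 is a nonzero quotient of module I, that is, isomorphic to
  it. The same rotation argument shows that module II is generated by 1, and the other fourteen
  modules come from I and II by psi, reversal of words and the exchange of the letters.
*)

theory Submission
  imports Defs
begin

section \<open>Linear maps of free algebras\<close>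

text \<open>That the kernel of \<open>psi\<close> is \<open>J\<close> means that \<open>J\<close> is
  the radical of the symmetric form sending x, y to \<open>form (psi q x) y\<close>, because
  \<open>psi\<close> is self-adjoint. Self-adjointness also shows that, in a degree where the kernel
  is known, every functional vanishing on \<open>J\<close> is represented by an element of the image
  of \<open>psi\<close>. The induction on the length thus supplies dual vectors for all proper parts
  of a word, and the antipode identity, which holds for every word, can be tested against them.
  Neither of the two arguments for primitive elements covers all weights. If the twist of a letter a
  multiplies x by q^k, a relation a x = c x a modulo \<open>J\<close> only forces q^(2 k) = 1, which
  says nothing at k = 0. The antipode has the coefficient (-1)^n q^(h^2 - n), where h is the excess
  of A over B, and this is +-1 as soon as h^2 = n. All computations take place in the free algebra
  modulo \<open>J\<close>; cosets and the carriers of the sixteen modules enter only at the end,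
  through \<open>presents\<close>.\<close>

lemma plus_list_append [simp]: "u + v = u @ v" for u v :: "'a list"
  by (simp add: plus_list_def)

lemma zero_list_Nil [simp]: "(0 :: 'a list) = []"
  by (simp add: zero_list_def)

abbreviation word :: "'x list \<Rightarrow> ('x, 'f::field) free" where
  "word w \<equiv> Poly_Mapping.single w 1"

lemma lookup_const_mult: "Poly_Mapping.lookup (const c * p) w = c * Poly_Mapping.lookup p w"
proof -
  have "Poly_Mapping.map ((*) c) p = const c * p"
    using mult_map_scale_conv_mult[of c p] by (simp add: const_def)
  then have "Poly_Mapping.lookup (const c * p) w = Poly_Mapping.lookup (Poly_Mapping.map ((*) c) p) w"
    by simp
  also have "\<dots> = c * Poly_Mapping.lookup p w"
    by (simp add: Poly_Mapping.map.rep_eq when_def)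
  finally show ?thesis .
qed

lemma lookup_scale [simp]: "Poly_Mapping.lookup (scale c p) w = c * Poly_Mapping.lookup p w"
  by (simp add: scale_def lookup_const_mult)

interpretation free: vector_space "scale :: 'f::field \<Rightarrow> ('x, 'f) free \<Rightarrow> ('x, 'f) free"
  by standard (auto intro!: poly_mapping_eqI simp: lookup_add algebra_simps)

interpretation free: vector_space_pair
  "scale :: 'f::field \<Rightarrow> ('x, 'f) free \<Rightarrow> ('x, 'f) free"
  "scale :: 'f::field \<Rightarrow> ('y, 'f) free \<Rightarrow> ('y, 'f) free" ..

abbreviation lin :: "(('x, 'f::field) free \<Rightarrow> ('y, 'f) free) \<Rightarrow> bool" where
  "lin \<equiv> Vector_Spaces.linear scale scale"

lemma linI:
  assumes "\<And>x y. F (x + y) = F x + F y" "\<And>c x. F (scale c x) = scale c (F x)"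
  shows "lin F"
  by (intro Vector_Spaces.linear.intro module_hom.intro free.vector_space_axioms
      module_hom_axioms.intro free.module_axioms assms)

lemma lin_add: "lin F \<Longrightarrow> F (x + y) = F x + F y"
  and lin_scale: "lin F \<Longrightarrow> F (scale c x) = scale c (F x)"
  and lin_zero: "lin F \<Longrightarrow> F 0 = 0"
  and lin_diff: "lin F \<Longrightarrow> F (x - y) = F x - F y"
  and lin_uminus: "lin F \<Longrightarrow> F (- x) = - F x"
  by (simp_all add: free.linear_add free.linear_scale free.linear_0 free.linear_diff free.linear_neg)

lemma lin_sum: "lin F \<Longrightarrow> F (sum g A) = (\<Sum>a\<in>A. F (g a))"
  by (simp add: free.linear_sum)

lemma word_mult: "word u * word v = word (u @ v)"
  by (simp add: mult_single)

lemma word_Nil: "word [] = 1"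
  using single_one[where 'a = "'a list"] by simp

lemma gen_eq_word: "gen a = word [a]"
  by (simp add: gen_def)

lemma gen_word: "gen a * word w = word (a # w)"
  by (simp add: gen_eq_word word_mult)

lemma word_gen: "word w * gen a = word (w @ [a])"
  by (simp add: gen_eq_word word_mult)

lemma free_expand: "(\<Sum>w\<in>Poly_Mapping.keys p. scale (Poly_Mapping.lookup p w) (word w)) = p"
  by (rule poly_mapping_eqI)
    (auto simp: lookup_sum lookup_single when_def in_keys_iff sum.delta if_distrib cong: if_cong)

lemma lin_expand: "lin F \<Longrightarrow> F p = (\<Sum>w\<in>Poly_Mapping.keys p. scale (Poly_Mapping.lookup p w) (F (word w)))"
  by (subst free_expand[of p, symmetric]) (simp add: lin_sum lin_scale)

lemma lin_eqI:
  assumes "lin F" "lin G" "\<And>w. F (word w) = G (word w)"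
  shows "F p = G p"
  using lin_expand[OF assms(1), of p] lin_expand[OF assms(2), of p] assms(3) by simp

lemma mult_scale_left [simp]: "scale c x * y = scale c (x * y)"
  by (simp add: scale_def mult.assoc)

lemma const_commute: "const c * x = x * const c" for x :: "('a, 'b::field) free"
proof -
  have "const c * scale d x = scale d (const c * x)" for d and x :: "('a, 'b) free"
    by (rule poly_mapping_eqI) (simp add: lookup_const_mult)
  then have "lin (\<lambda>x :: ('a, 'b) free. const c * x)" "lin (\<lambda>x :: ('a, 'b) free. x * const c)"
    by (auto intro!: linI simp: distrib_left distrib_right)
  then show ?thesis
    by (rule lin_eqI) (simp add: const_def mult_single)
qed

lemma mult_scale_right [simp]: "x * scale c y = scale c (x * y)"
proof -
  have "x * (const c * y) = (x * const c) * y" by (simp add: mult.assoc)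
  also have "\<dots> = (const c * x) * y" by (simp only: const_commute)
  finally show ?thesis by (simp add: scale_def mult.assoc)
qed

text \<open>Operators given by their values on words are built with this extension, so linearity is
  automatic and identities are checked on words only.\<close>

definition ext :: "('x list \<Rightarrow> ('y, 'f) free) \<Rightarrow> ('x, 'f::field) free \<Rightarrow> ('y, 'f) free" where
  "ext F p = (\<Sum>w\<in>Poly_Mapping.keys p. scale (Poly_Mapping.lookup p w) (F w))"

lemma ext_superset:
  assumes "finite S" "Poly_Mapping.keys p \<subseteq> S"
  shows "ext F p = (\<Sum>w\<in>S. scale (Poly_Mapping.lookup p w) (F w))"
  unfolding ext_def using assms
  by (intro sum.mono_neutral_left) (auto simp: in_keys_iff)

lemma lin_ext [simp]: "lin (ext F)" for F :: "'a list \<Rightarrow> ('c, 'b::field) free"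
proof (rule linI)
  fix x y :: "('a, 'b) free" and c :: 'b
  let ?S = "Poly_Mapping.keys x \<union> Poly_Mapping.keys y"
  have "Poly_Mapping.keys (x + y) \<subseteq> ?S" by (rule keys_add)
  then show "ext F (x + y) = ext F x + ext F y"
    by (simp add: ext_superset[of ?S] lookup_add free.scale_left_distrib sum.distrib)
  have "Poly_Mapping.keys (scale c x) \<subseteq> Poly_Mapping.keys x" by (auto simp: in_keys_iff)
  then show "ext F (scale c x) = scale c (ext F x)"
    by (simp add: ext_superset[of "Poly_Mapping.keys x"] free.scale_sum_right)
qed

lemma ext_word [simp]: "ext F (word w) = F w"
  by (simp add: ext_def)

lemma lin_id [simp]: "lin (\<lambda>x. x)" by (rule linI) auto

lemma lin_comp: "lin F \<Longrightarrow> lin G \<Longrightarrow> lin (\<lambda>x. F (G x))"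
  by (rule linI) (auto simp: lin_add lin_scale)

lemma lin_mult_left: "lin F \<Longrightarrow> lin (\<lambda>x. a * F x)"
  by (rule linI) (auto simp: lin_add lin_scale distrib_left)

lemma lin_mult_right: "lin F \<Longrightarrow> lin (\<lambda>x. F x * a)"
  by (rule linI) (auto simp: lin_add lin_scale distrib_right)

lemma lin_plus: "lin F \<Longrightarrow> lin G \<Longrightarrow> lin (\<lambda>x. F x + G x)"
  by (rule linI) (auto simp: lin_add lin_scale free.scale_right_distrib)

lemma lin_minus: "lin F \<Longrightarrow> lin G \<Longrightarrow> lin (\<lambda>x. F x - G x)"
  by (rule linI) (auto simp: lin_add lin_scale free.scale_right_diff_distrib)

lemma lin_scaled: "lin F \<Longrightarrow> lin (\<lambda>x. scale c (F x))"
  by (rule linI) (auto simp: lin_add lin_scale free.scale_right_distrib mult.commute)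

lemma free_induct [case_names zero add word]:
  assumes "P 0" "\<And>x y. P x \<Longrightarrow> P y \<Longrightarrow> P (x + y)" "\<And>c w. P (scale c (word w))"
  shows "P (p :: ('x, 'f::field) free)"
proof -
  have "P (\<Sum>w\<in>S. scale (Poly_Mapping.lookup p w) (word w))" if "finite S" for S
    using that by induction (auto intro: assms)
  from this[of "Poly_Mapping.keys p"] show ?thesis by (simp add: free_expand)
qed

lemma free_hom_eq_ext: "free_hom f = ext (\<lambda>w. prod_list (map f w))"
  by (rule ext) (simp add: free_hom_def ext_def)

lemma ext_mult:
  assumes "F [] = 1" "\<And>u v. F (u @ v) = F u * F v"
  shows "ext F (x * y) = ext F x * ext F y"
proof -
  have "ext F (word u * y) = ext F (word u) * ext F y" for u
    by (rule lin_eqI[OF lin_comp[OF lin_ext lin_mult_left[OF lin_id]] lin_mult_left[OF lin_ext]])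
      (simp add: word_mult assms)
  then show ?thesis
    by (rule lin_eqI[OF lin_comp[OF lin_ext lin_mult_right[OF lin_id]] lin_mult_right[OF lin_ext]])
qed

section \<open>Operators on words in two letters\<close>

text \<open>The pairing of a whole word with one letter: the exponent in the shuffle recursion and,
  for A resp. B, the exponent of the eigenvalue of K resp. its inverse.\<close>

definition wt :: "letter \<Rightarrow> letter list \<Rightarrow> int" where
  "wt a w = (\<Sum>c\<leftarrow>w. pairing c a)"

lemma wt_simps [simp]:
  "wt a [] = 0" "wt a (b # w) = pairing b a + wt a w" "wt a (u @ w) = wt a u + wt a w"
  "wt a (rev w) = wt a w"
  by (simp_all add: wt_def rev_map[symmetric])

fun other :: "letter \<Rightarrow> letter" where
  "other LA = LB" | "other LB = LA"

lemma other_simps [simp]: "other (other a) = a" "other a \<noteq> a" "a \<noteq> other a"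
  "other a = other b \<longleftrightarrow> a = b"
  by (cases a; cases b; simp)+

lemma letter_cases: "b = a \<or> b = other a"
  by (cases a; cases b) auto

lemma wt_other: "wt (other a) w = - wt a w"
  by (induction w) (use letter_cases[of _ a] in auto)

lemma wt_map_other [simp]: "wt a (map other w) = - wt a w"
proof (induction w)
  case (Cons b w)
  then show ?case by (cases a; cases b) simp_all
qed simp

text \<open>
  The recursively defined operators turn out to be the adjoints \<open>A\<^sup>*\<^bsub>\<ell>\<^esub>, B\<^sup>*\<^bsub>\<ell>\<^esub>\<close> (\<open>lder\<close>) and
  \<open>A\<^sup>*\<^bsub>L\<^esub>, B\<^sup>*\<^bsub>L\<^esub>\<close> (\<open>strip\<close>); \<open>Ktwist q a\<close> is \<open>K\<close> for the letter \<open>A\<close> and the inverse of \<open>K\<close> for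
  the letter \<open>B\<close>.
\<close>

fun lder_word :: "'f::field \<Rightarrow> letter \<Rightarrow> letter list \<Rightarrow> 'f free2" where
  "lder_word q a [] = 0"
| "lder_word q a (b # w) = (if a = b then word w else 0) + scale (q powi pairing a b) (gen b * lder_word q a w)"

definition lder :: "'f::field \<Rightarrow> letter \<Rightarrow> 'f free2 \<Rightarrow> 'f free2" where
  "lder q a = ext (lder_word q a)"

definition strip :: "letter \<Rightarrow> 'f::field free2 \<Rightarrow> 'f free2" where
  "strip a = ext (\<lambda>w. case w of [] \<Rightarrow> 0 | b # u \<Rightarrow> if a = b then word u else 0)"

definition reversal :: "'f::field free2 \<Rightarrow> 'f free2" where
  "reversal = ext (\<lambda>w. word (rev w))"

definition letter_swap :: "'f::field free2 \<Rightarrow> 'f free2" where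
  "letter_swap = ext (\<lambda>w. word (map other w))"

definition Ktwist :: "'f::field \<Rightarrow> letter \<Rightarrow> 'f free2 \<Rightarrow> 'f free2" where
  "Ktwist q a = ext (\<lambda>w. scale (q powi wt a w) (word w))"

definition psi :: "'f::field \<Rightarrow> 'f free2 \<Rightarrow> 'f free2" where
  "psi q = ext (\<lambda>w. foldr (\<lambda>a. shuffle q (gen a)) w 1)"

lemma lin_ops: "lin (lder q a)" "lin (strip a)" "lin reversal" "lin letter_swap" "lin (Ktwist q a)" "lin (psi q)"
  by (simp_all add: lder_def strip_def reversal_def letter_swap_def Ktwist_def psi_def)

lemmas op_simps [simp] =
  lin_ops[THEN lin_add] lin_ops[THEN lin_scale] lin_ops[THEN lin_zero] lin_ops[THEN lin_diff]
  lin_ops[THEN lin_uminus]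

declare free.scale_right_distrib [simp] free.scale_right_diff_distrib [simp]

lemma op_word [simp]:
  "lder q a (word w) = lder_word q a w"
  "strip a (word []) = 0"
  "strip a (word (b # w)) = (if a = b then word w else 0)"
  "reversal (word w) = word (rev w)"
  "letter_swap (word w) = word (map other w)"
  "Ktwist q a (word w) = scale (q powi wt a w) (word w)"
  "psi q (word w) = foldr (\<lambda>a. shuffle q (gen a)) w 1"
  by (simp_all add: lder_def strip_def reversal_def letter_swap_def Ktwist_def psi_def)

lemma op_one [simp]: "lder q a 1 = 0" "strip a 1 = 0" "reversal 1 = 1" "letter_swap 1 = 1" "Ktwist q a 1 = 1" "psi q 1 = 1"
  by (simp_all flip: word_Nil)

lemma op_gen [simp]: "reversal (gen a) = gen a" "letter_swap (gen a) = gen (other a)"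
  "lder q a (gen b) = (if a = b then 1 else 0)"
  by (simp_all add: gen_eq_word word_Nil)

lemma strip_gen [simp]: "strip a (gen b * v) = (if a = b then v else 0)"
  by (induction v rule: free_induct) (simp_all add: gen_word distrib_left)

lemma lder_gen: "lder q a (gen b * v) = (if a = b then v else 0) + scale (q powi pairing a b) (gen b * lder q a v)"
  by (induction v rule: free_induct) (simp_all add: gen_word distrib_left mult.commute del: pairing.simps)

lemma reversal_mult [simp]: "reversal (x * y) = reversal y * reversal x"
proof -
  have "reversal (word u * y) = reversal y * reversal (word u)" for u
    by (induction y rule: free_induct) (simp_all add: word_mult distrib_left distrib_right)
  then show ?thesis
    by (induction x rule: free_induct) (simp_all add: distrib_left distrib_right)
qed

lemma letter_swap_mult [simp]: "letter_swap (x * y) = letter_swap x * letter_swap y"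
  unfolding letter_swap_def by (rule ext_mult) (simp_all add: word_Nil word_mult)

lemma reversal_reversal [simp]: "reversal (reversal x) = x"
  by (induction x rule: free_induct) simp_all

lemma letter_swap_letter_swap [simp]: "letter_swap (letter_swap x) = x"
  by (induction x rule: free_induct) (simp_all add: comp_def)

lemma letter_swap_reversal: "letter_swap (reversal x) = reversal (letter_swap x)"
  by (induction x rule: free_induct) (simp_all add: rev_map)

lemma reversal_Ktwist [simp]: "reversal (Ktwist q a x) = Ktwist q a (reversal x)"
  by (induction x rule: free_induct) (simp_all add: mult.commute)

lemma letter_swap_Ktwist [simp]: "letter_swap (Ktwist q a x) = Ktwist q (other a) (letter_swap x)"
  by (induction x rule: free_induct) (simp_all add: mult.commute wt_other)

lemma lder_word_map_other: "lder_word q a (map other w) = letter_swap (lder_word q (other a) w)"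
  by (induction w) auto

lemma letter_swap_lder [simp]: "letter_swap (lder q a x) = lder q (other a) (letter_swap x)"
  by (induction x rule: free_induct) (simp_all add: lder_word_map_other)

section \<open>The constant term, and elements determined by their strips\<close>

definition eps :: "'f::field free2 \<Rightarrow> 'f" where
  "eps x = Poly_Mapping.lookup x []"

lemma eps_simps [simp]: "eps (x + y) = eps x + eps y" "eps (scale c x) = c * eps x" "eps 0 = 0"
  "eps (x - y) = eps x - eps y" "eps 1 = 1" "eps (word w) = (if w = [] then 1 else 0)"
  by (simp_all add: eps_def lookup_add lookup_minus lookup_single when_def flip: word_Nil)

lemma eps_gen_mult [simp]: "eps (gen a * x) = 0"
  by (induction x rule: free_induct) (simp_all add: gen_word distrib_left)

lemma word_decomp: "x = scale (eps x) 1 + gen LA * strip LA x + gen LB * strip LB x"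
proof (induction x rule: free_induct)
  case (add x y)
  have "x + y = (scale (eps x) 1 + gen LA * strip LA x + gen LB * strip LB x)
      + (scale (eps y) 1 + gen LA * strip LA y + gen LB * strip LB y)"
    using add by (rule arg_cong2)
  also have "\<dots> = scale (eps (x + y)) 1 + gen LA * strip LA (x + y) + gen LB * strip LB (x + y)"
    by (simp add: distrib_left free.scale_left_distrib add_ac)
  finally show ?case .
next
  case (word c w)
  show ?case
  proof (cases w)
    case Nil then show ?thesis by (simp add: word_Nil)
  next
    case (Cons a u)
    then show ?thesis by (cases a) (simp_all add: gen_word)
  qed
qed simp

text \<open>Every word is empty or starts with A or B. This reduces identities in the shuffle
  algebra to shorter words.\<close>

lemma strip_eqI:
  assumes "eps x = eps y" "\<And>a. strip a x = strip a y"
  shows "x = y"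
  by (subst word_decomp[of x], subst word_decomp[of y]) (simp add: assms)

section \<open>The q-shuffle product: bilinearity, skew Leibniz rule, associativity\<close>

lemma shuffle_eq_ext: "shuffle q x y = ext (\<lambda>u. ext (\<lambda>v. shuffle_word q u v) y) x"
  by (simp add: shuffle_def ext_def free.scale_sum_right)

lemma shuffle_lin: "lin (shuffle q x)" "lin (\<lambda>x. shuffle q x y)"
proof -
  show "lin (\<lambda>x. shuffle q x y)" by (simp add: shuffle_eq_ext)
  have "lin (\<lambda>y. ext (\<lambda>u. ext (shuffle_word q u) y) x)"
  proof (induction x rule: free_induct)
    case zero
    then show ?case by (simp add: ext_def linI)
  next
    case (add x y)
    then show ?case by (simp add: lin_add[OF lin_ext] lin_plus)
  next
    case (word c w)
    then show ?case by (simp add: lin_scale[OF lin_ext] lin_scaled)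
  qed
  then show "lin (shuffle q x)" by (simp add: shuffle_eq_ext[abs_def])
qed

lemmas shuffle_simps [simp] =
  shuffle_lin(1)[THEN lin_add] shuffle_lin(1)[THEN lin_scale] shuffle_lin(1)[THEN lin_zero]
  shuffle_lin(1)[THEN lin_diff] shuffle_lin(2)[THEN lin_add] shuffle_lin(2)[THEN lin_scale]
  shuffle_lin(2)[THEN lin_zero] shuffle_lin(2)[THEN lin_diff]

lemma shuffle_word_word: "shuffle q (word u) (word v) = shuffle_word q u v"
  by (simp add: shuffle_eq_ext)

lemma shuffle_word_Nil_right: "shuffle_word q u [] = word u"
  by (cases u) simp_all

lemma shuffle_one [simp]: "shuffle q 1 x = x" "shuffle q x 1 = x"
  by (induction x rule: free_induct)
    (simp_all add: shuffle_word_word shuffle_word_Nil_right flip: word_Nil)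

lemma Ktwist_gen: "Ktwist q a (gen b * v) = scale (q powi pairing a b) (gen b * Ktwist q a v)" if "q \<noteq> 0"
proof -
  have "pairing b a = pairing a b" by simp
  with that show ?thesis
  by (induction v rule: free_induct)
    (simp_all add: gen_word distrib_left power_int_add algebra_simps del: pairing.simps)
qed

lemma psi_gen [simp]: "psi q (gen a * v) = shuffle q (gen a) (psi q v)"
  by (induction v rule: free_induct) (simp_all add: gen_word distrib_left)

text \<open>The defining recursion sorted by the first letter of the result is a skew Leibniz rule,
  and in this form it also covers empty factors.\<close>

lemma strip_shuffle_word:
  "strip a (shuffle_word q u v) =
     shuffle q (strip a (word u)) (word v) + shuffle q (Ktwist q a (word u)) (strip a (word v))"
proof (cases u)
  case Nil
  then show ?thesis by (simp add: word_Nil)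
next
  case u: (Cons b u')
  show ?thesis
  proof (cases v)
    case Nil
    then show ?thesis using u by (simp add: word_Nil)
  next
    case (Cons c v')
    then show ?thesis using u by (auto simp: shuffle_word_word wt_def)
  qed
qed

lemma strip_shuffle [simp]:
  "strip a (shuffle q x y) = shuffle q (strip a x) y + shuffle q (Ktwist q a x) (strip a y)"
proof -
  have "strip a (shuffle q (word u) y) = shuffle q (strip a (word u)) y + shuffle q (Ktwist q a (word u)) (strip a y)" for u
    by (induction y rule: free_induct)
      (simp_all only: shuffle_word_word strip_shuffle_word shuffle_simps op_simps
        free.scale_right_distrib add_ac add_0_left)
  then show ?thesis
    by (induction x rule: free_induct) (simp_all del: op_word)
qed

lemma eps_shuffle [simp]: "eps (shuffle q x y) = eps x * eps y"
proof -
  have "eps (shuffle_word q u v) = (if u = [] \<and> v = [] then 1 else 0)" for u v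
    by (induction q u v rule: shuffle_word.induct) simp_all
  then have "eps (shuffle q (word u) y) = eps (word u) * eps y" for u
    by (induction y rule: free_induct) (simp_all add: shuffle_word_word algebra_simps)
  then show ?thesis
    by (induction x rule: free_induct) (simp_all add: algebra_simps)
qed

lemma Ktwist_shuffle [simp]: "Ktwist q a (shuffle q x y) = shuffle q (Ktwist q a x) (Ktwist q a y)" if q: "q \<noteq> 0"
proof -
  have *: "Ktwist q a (shuffle_word q u v) = scale (q powi (wt a u + wt a v)) (shuffle_word q u v)" for u v
    using q
  proof (induction q u v rule: shuffle_word.induct)
    case (3 q b u c v)
    have "pairing b a = pairing a b" "pairing c a = pairing a c" by auto
    with 3 show ?case
      by (simp add: Ktwist_gen power_int_add algebra_simps del: pairing.simps)
  qed (simp_all add: power_int_add)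
  have "Ktwist q a (shuffle q (word u) y) = shuffle q (Ktwist q a (word u)) (Ktwist q a y)" for u
    by (induction y rule: free_induct) (simp_all add: shuffle_word_word * power_int_add q mult_ac)
  then show ?thesis
    by (induction x rule: free_induct) (simp_all del: op_word)
qed

text \<open>By the skew Leibniz rule the strips of both sides are sums of triple products with one
  letter less; the middle twist passes through because \<open>Ktwist\<close> is multiplicative for
  the shuffle product.\<close>

lemma shuffle_assoc_word:
  fixes q :: "'f::field"
  assumes "q \<noteq> 0" and "length u + length v + length w = n"
  shows "shuffle q (shuffle q (word u) (word v)) (word w) = shuffle q (word u) (shuffle q (word v) (word w))"
  using assms(2)
proof (induction n arbitrary: u v w rule: less_induct)
  case (less n)
  have len: "strip a (word x :: 'f free2) = 0 \<or> (\<exists>y. strip a (word x :: 'f free2) = word y \<and> length y < length x)"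
    for x :: "letter list" and a
    by (cases x) auto
  show ?case
  proof (rule strip_eqI)
    fix a
    have 1: "shuffle q (shuffle q (strip a (word u)) (word v)) (word w)
        = shuffle q (strip a (word u)) (shuffle q (word v) (word w))"
      using len[of a u] less.IH[OF _ refl] less.prems by auto
    have 2: "shuffle q (shuffle q (word u) (strip a (word v))) (word w)
        = shuffle q (word u) (shuffle q (strip a (word v)) (word w))"
      using len[of a v] less.IH[OF _ refl] less.prems by auto
    have 3: "shuffle q (shuffle q (word u) (word v)) (strip a (word w))
        = shuffle q (word u) (shuffle q (word v) (strip a (word w)))"
      using len[of a w] less.IH[OF _ refl] less.prems by auto
    show "strip a (shuffle q (shuffle q (word u) (word v)) (word w))
        = strip a (shuffle q (word u) (shuffle q (word v) (word w)))"
      using 1 2 3 by (simp add: assms(1) del: op_word(2,3))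
  qed simp
qed

lemma shuffle_assoc:
  assumes "q \<noteq> 0"
  shows "shuffle q (shuffle q x y) z = shuffle q x (shuffle q y z)"
proof -
  have 1: "shuffle q (shuffle q (word u) (word v)) z = shuffle q (word u) (shuffle q (word v) z)" for u v
    by (induction z rule: free_induct) (simp_all add: shuffle_assoc_word[OF assms refl])
  have 2: "shuffle q (shuffle q (word u) y) z = shuffle q (word u) (shuffle q y z)" for u
    by (induction y rule: free_induct) (simp_all add: 1)
  show ?thesis
    by (induction x rule: free_induct) (simp_all add: 2)
qed

text \<open>On words \<open>psi\<close> is an iterated left shuffle multiplication, so
  multiplicativity is associativity of the shuffle product.\<close>

lemma psi_mult:
  assumes "q \<noteq> 0"
  shows "psi q (x * y) = shuffle q (psi q x) (psi q y)"
proof -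
  have "psi q (word u * y) = shuffle q (psi q (word u)) (psi q y)" for u
  proof (induction u)
    case Nil
    then show ?case by (simp add: word_Nil)
  next
    case (Cons a u)
    have "psi q (word (a # u) * y) = psi q (gen a * (word u * y))"
      by (simp add: gen_word mult.assoc[symmetric])
    also have "\<dots> = shuffle q (shuffle q (gen a) (psi q (word u))) (psi q y)"
      by (simp only: psi_gen Cons shuffle_assoc[OF assms])
    finally show ?case by simp
  qed
  then show ?thesis
    by (induction x rule: free_induct) (simp_all add: distrib_right del: op_word)
qed

lemma psi_gen_single [simp]: "psi q (gen a) = gen a"
  by (simp add: gen_eq_word)

lemma gen_strip: "strip a (gen b) = (if a = b then 1 else 0)"
  by (simp add: gen_eq_word word_Nil)

lemma Ktwist_gen1: "Ktwist q a (gen b) = scale (q powi pairing a b) (gen b)"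
proof -
  have "pairing b a = pairing a b" by simp
  then show ?thesis by (simp add: gen_eq_word del: pairing.simps)
qed

text \<open>Both operators pass a leading letter by the same twisted rule, one for concatenation and
  one for the shuffle product.\<close>

lemma strip_psi: "strip a (psi q x) = psi q (lder q a x)"
proof -
  have "strip a (psi q (word w)) = psi q (lder_word q a w)" for w
    by (induction w) (simp_all add: gen_strip Ktwist_gen1 del: pairing.simps)
  then show ?thesis
    by (induction x rule: free_induct) simp_all
qed

lemma eps_psi [simp]: "eps (psi q x) = eps x" for q :: "'f::field"
proof -
  have "eps (gen a :: 'f free2) = 0" for a by (simp add: gen_eq_word)
  then have "eps (psi q (word w)) = eps (word w)" for w
    by (cases w) simp_all
  then show ?thesis
    by (induction x rule: free_induct) (simp_all del: op_word)
qed

lemma Ktwist_psi: "Ktwist q a (psi q x) = psi q (Ktwist q a x)" if q: "q \<noteq> 0"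
proof -
  have "Ktwist q a (psi q (word w)) = psi q (Ktwist q a (word w))" for w
  proof (induction w)
    case (Cons b w)
    have "pairing b a = pairing a b" by simp
    with Cons show ?case by (simp add: q Ktwist_gen1 power_int_add del: pairing.simps)
  qed simp
  then show ?thesis
    by (induction x rule: free_induct) (simp_all del: op_word)
qed

section \<open>Mirror images: one-letter products from the right, and reversal\<close>

lemma shr_gen: "shuffle q (gen b * v) (gen a) = gen b * shuffle q v (gen a) + gen a * Ktwist q a (gen b * v)"
proof -
  have "shuffle q (gen b * word w) (gen a) = gen b * shuffle q (word w) (gen a) + gen a * Ktwist q a (gen b * word w)" for w
    by (simp add: gen_eq_word word_mult shuffle_word_word shuffle_word_Nil_right wt_def)
  then show ?thesis
    by (induction v rule: free_induct) (simp_all add: distrib_left)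
qed

lemma shl_gen: "shuffle q (gen a) (gen b * v) = gen a * (gen b * v) + scale (q powi pairing a b) (gen b * shuffle q (gen a) v)"
proof -
  have "shuffle q (gen a) (gen b * word w) = gen a * (gen b * word w) + scale (q powi pairing a b) (gen b * shuffle q (gen a) (word w))" for w
    by (simp add: gen_eq_word word_mult shuffle_word_word shuffle_word_Nil_right)
  then show ?thesis
    by (induction v rule: free_induct) (simp_all add: distrib_left mult.commute)
qed

lemma Ktwist_mult [simp]: "Ktwist q a (x * y) = Ktwist q a x * Ktwist q a y" if "q \<noteq> 0"
  unfolding Ktwist_def
  by (rule ext_mult) (simp_all add: word_Nil word_mult[symmetric] power_int_add that mult_ac)

text \<open>The recursion of the product peels first letters; peeling the last letter instead is
  what allows left and right one-letter products to be compared under reversal.\<close>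

lemma shr_gen_right:
  assumes q: "q \<noteq> 0"
  shows "shuffle q (v * gen b) (gen a) = v * gen b * gen a + scale (q powi pairing a b) (shuffle q v (gen a) * gen b)"
proof -
  have "shuffle q (word w * gen b) (gen a) = word w * gen b * gen a
      + scale (q powi pairing a b) (shuffle q (word w) (gen a) * gen b)" for w
  proof (induction w)
    case Nil
    show ?case using shr_gen[of q b 1 a] by (simp add: word_Nil Ktwist_gen1 del: pairing.simps)
  next
    case (Cons c w)
    have "shuffle q (gen c * (word w * gen b)) (gen a) =
      gen c * (word w * gen b * gen a + scale (q powi pairing a b) (shuffle q (word w) (gen a) * gen b))
      + gen a * Ktwist q a (gen c * (word w * gen b))"
      by (subst shr_gen) (simp only: Cons)
    also have "\<dots> = gen c * word w * gen b * gen a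
        + scale (q powi pairing a b) (shuffle q (gen c * word w) (gen a) * gen b)"
      by (subst shr_gen)
        (simp only: Ktwist_mult[OF q] Ktwist_gen1 distrib_left distrib_right mult.assoc mult_scale_left mult_scale_right
          free.scale_right_distrib free.scale_scale mult.commute add_ac)
    finally show ?case by (simp add: gen_word mult.assoc[symmetric])
  qed
  then show ?thesis
    by (induction v rule: free_induct) (simp_all add: distrib_right mult.commute)
qed

lemma reversal_shl:
  assumes "q \<noteq> 0"
  shows "reversal (shuffle q (gen a) v) = shuffle q (reversal v) (gen a)"
proof -
  have "reversal (shuffle q (gen a) (word w)) = shuffle q (reversal (word w)) (gen a)" for w
  proof (induction w)
    case Nil
    show ?case by (simp add: word_Nil)
  next
    case (Cons b w)
    have "reversal (shuffle q (gen a) (gen b * word w)) = shuffle q (reversal (gen b * word w)) (gen a)"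
      by (simp only: shl_gen op_simps reversal_mult op_gen Cons shr_gen_right[OF assms] mult.assoc)
    then show ?case by (simp only: gen_word)
  qed
  then show ?thesis
    by (induction v rule: free_induct) (simp_all del: op_word)
qed

lemma reversal_psi: "reversal (psi q x) = psi q (reversal x)" if q: "q \<noteq> 0"
proof -
  have "reversal (psi q (word w)) = psi q (reversal (word w))" for w
  proof (induction w)
    case Nil
    show ?case by (simp add: word_Nil)
  next
    case (Cons a w)
    have "reversal (psi q (gen a * word w)) = psi q (reversal (gen a * word w))"
      by (simp only: psi_gen reversal_shl[OF q] Cons reversal_mult psi_mult[OF q] op_gen psi_gen_single)
    then show ?case by (simp only: gen_word)
  qed
  then show ?thesis
    by (induction x rule: free_induct) (simp_all del: op_word)
qed

section \<open>Ideals\<close>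

lemma ring_type_algebra: "ring (ring_of_type_algebra :: 'a::ring_1 ring)"
proof -
  have "\<exists>y. x + y = 0" for x :: 'a
    using add.right_inverse by blast
  then show ?thesis
    unfolding ring_of_type_algebra_def using add.right_inverse
    by unfold_locales (auto simp: algebra_simps Units_def)
qed

lemma type_algebra_simps [simp]:
  "carrier ring_of_type_algebra = UNIV" "monoid.mult ring_of_type_algebra = (*)"
  "one ring_of_type_algebra = 1" "ring.zero ring_of_type_algebra = 0" "add ring_of_type_algebra = (+)"
  by (simp_all add: ring_of_type_algebra_def fun_eq_iff)

lemma ideal_type_algebra_iff:
  "ideal I (ring_of_type_algebra :: 'a::ring_1 ring) \<longleftrightarrow>
     0 \<in> I \<and> (\<forall>x\<in>I. \<forall>y\<in>I. x + y \<in> I) \<and> (\<forall>x\<in>I. \<forall>r. r * x \<in> I \<and> x * r \<in> I)"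
proof
  assume "ideal I (ring_of_type_algebra :: 'a ring)"
  then interpret ideal I "ring_of_type_algebra :: 'a ring" .
  show "0 \<in> I \<and> (\<forall>x\<in>I. \<forall>y\<in>I. x + y \<in> I) \<and> (\<forall>x\<in>I. \<forall>r. r * x \<in> I \<and> x * r \<in> I)"
    using additive_subgroup.zero_closed[OF additive_subgroup_axioms]
      additive_subgroup.a_closed[OF additive_subgroup_axioms] I_l_closed I_r_closed by simp
next
  assume I: "0 \<in> I \<and> (\<forall>x\<in>I. \<forall>y\<in>I. x + y \<in> I) \<and> (\<forall>x\<in>I. \<forall>r. r * x \<in> I \<and> x * r \<in> I)"
  interpret ring "ring_of_type_algebra :: 'a ring" by (rule ring_type_algebra)
  have minus: "- x \<in> I" if "x \<in> I" for x
    using I that by (metis mult_minus1)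
  have inv: "\<ominus>\<^bsub>ring_of_type_algebra\<^esub> x = - x" for x :: 'a
    using minus_equality[of "- x" x] by simp
  show "ideal I (ring_of_type_algebra :: 'a ring)"
  proof (rule idealI[OF ring_type_algebra])
    show "subgroup I (add_monoid (ring_of_type_algebra :: 'a ring))"
      by (rule add.subgroupI) (use I minus inv in \<open>auto simp: a_inv_def[symmetric]\<close>)
  qed (use I in auto)
qed

lemma Idl_ideal: "ideal (Idl\<^bsub>ring_of_type_algebra\<^esub> S) (ring_of_type_algebra :: 'a::ring_1 ring)"
  by (rule ring.genideal_ideal[OF ring_type_algebra]) simp

lemma Idl_self: "S \<subseteq> Idl\<^bsub>ring_of_type_algebra :: 'a::ring_1 ring\<^esub> S"
  by (rule ring.genideal_self[OF ring_type_algebra]) simp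

lemma Idl_minimal:
  "ideal I (ring_of_type_algebra :: 'a::ring_1 ring) \<Longrightarrow> S \<subseteq> I \<Longrightarrow> Idl\<^bsub>ring_of_type_algebra\<^esub> S \<subseteq> I"
  by (rule ring.genideal_minimal[OF ring_type_algebra])

lemma coset_eq: "I +>\<^bsub>ring_of_type_algebra\<^esub> x = {y + x |y. y \<in> I}" for x :: "'a::ring_1"
  by (auto simp: a_r_coset_def r_coset_def)

lemma free_ideal:
  fixes I :: "('x, 'f::field) free set"
  assumes "ideal I free_ring"
  shows "0 \<in> I" "x \<in> I \<Longrightarrow> y \<in> I \<Longrightarrow> x + y \<in> I" "x \<in> I \<Longrightarrow> r * x \<in> I" "x \<in> I \<Longrightarrow> x * r \<in> I"
    "x \<in> I \<Longrightarrow> scale c x \<in> I" "x \<in> I \<Longrightarrow> - x \<in> I" "x \<in> I \<Longrightarrow> y \<in> I \<Longrightarrow> x - y \<in> I"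
proof -
  note I = assms[unfolded ideal_type_algebra_iff]
  from I show *: "0 \<in> I" "x \<in> I \<Longrightarrow> y \<in> I \<Longrightarrow> x + y \<in> I" "x \<in> I \<Longrightarrow> r * x \<in> I" "x \<in> I \<Longrightarrow> x * r \<in> I"
    "x \<in> I \<Longrightarrow> scale c x \<in> I" for x y r c by (auto simp: scale_def)
  show m: "x \<in> I \<Longrightarrow> - x \<in> I" for x using *(3)[of x "- 1"] by simp
  show "x \<in> I \<Longrightarrow> y \<in> I \<Longrightarrow> x - y \<in> I" using *(2)[of x "- y"] m[of y] by simp
qed

lemma ideal_sum: "ideal I free_ring \<Longrightarrow> (\<And>a. a \<in> A \<Longrightarrow> g a \<in> I) \<Longrightarrow> sum g A \<in> I"
  for I :: "('x, 'f::field) free set"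
  by (induction A rule: infinite_finite_induct) (auto intro: free_ideal)

lemma ideal_subspace: "ideal I free_ring \<Longrightarrow> free.subspace I" for I :: "('x, 'f::field) free set"
  by (rule free.subspaceI) (auto intro: free_ideal)

lemma ideal_J: "ideal (J q) free_ring"
  unfolding J_def by (rule Idl_ideal)

lemmas J_rules = free_ideal[OF ideal_J]

lemma serre_J: "serre q (gen b) (gen (other b)) \<in> J q"
  using Idl_self[of "{serre q (gen LA) (gen LB), serre q (gen LB) (gen LA)}"] unfolding J_def
  by (cases b) auto

lemma J_induct [consumes 1, case_names zero add left right serre]:
  assumes "x \<in> J q" "P 0" "\<And>x y. P x \<Longrightarrow> P y \<Longrightarrow> P (x + y)"
    "\<And>x r. P x \<Longrightarrow> P (r * x)" "\<And>x r. P x \<Longrightarrow> P (x * r)"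
    "\<And>b. P (serre q (gen b) (gen (other b)))"
  shows "P x"
proof -
  have "ideal {x. P x} free_ring"
    using assms(2-5) by (simp add: ideal_type_algebra_iff)
  moreover have "P (serre q (gen LA) (gen LB))" "P (serre q (gen LB) (gen LA))"
    using assms(6)[of LA] assms(6)[of LB] by simp_all
  ultimately have "J q \<subseteq> {x. P x}"
    unfolding J_def by (intro Idl_minimal) auto
  with assms(1) show ?thesis by auto
qed

section \<open>Skew derivations\<close>

text \<open>Conjugation with reversal, instead of a second recursion, lets every law be inherited
  from \<open>lder\<close>; it turns out to be the adjoint of right shuffle multiplication by the
  letter.\<close>

definition rder :: "'f::field \<Rightarrow> letter \<Rightarrow> 'f free2 \<Rightarrow> 'f free2" where
  "rder q a x = reversal (lder q a (reversal x))"

definition stripr :: "letter \<Rightarrow> 'f::field free2 \<Rightarrow> 'f free2" where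
  "stripr a x = reversal (strip a (reversal x))"

lemma lin_rder: "lin (rder q a)" "lin (stripr a)"
  by (auto intro!: linI simp: rder_def stripr_def)

lemmas rder_simps [simp] =
  lin_rder[THEN lin_add] lin_rder[THEN lin_scale] lin_rder[THEN lin_zero] lin_rder[THEN lin_diff]

lemma rder_one [simp]: "rder q a 1 = 0"
  by (simp add: rder_def)

lemma reversal_lder: "reversal (lder q a x) = rder q a (reversal x)" "reversal (rder q a x) = lder q a (reversal x)"
  by (simp_all add: rder_def)

lemma letter_swap_rder [simp]: "letter_swap (rder q a x) = rder q (other a) (letter_swap x)"
  by (simp add: rder_def letter_swap_reversal)

lemma pairing_commute: "pairing a b = pairing b a"
  by simp

locale qparam =
  fixes q :: "'f::field"
  assumes q_nonzero [simp]: "q \<noteq> 0" and q_nonroot: "\<And>n::nat. n > 0 \<Longrightarrow> q ^ n \<noteq> 1"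
begin

lemma lder_mult: "lder q a (x * y) = lder q a x * y + Ktwist q a x * lder q a y"
proof -
  have "lder q a (word w * y) = lder q a (word w) * y + Ktwist q a (word w) * lder q a y" for w
  proof (induction w)
    case Nil
    then show ?case by (simp add: word_Nil)
  next
    case (Cons b w)
    have "lder q a (gen b * (word w * y)) = lder q a (gen b * word w) * y + Ktwist q a (gen b * word w) * lder q a y"
      by (simp add: lder_gen Ktwist_gen1 Cons distrib_right distrib_left mult.assoc del: op_word pairing.simps)
    then show ?case by (simp only: gen_word mult.assoc[symmetric])
  qed
  then show ?thesis
    by (induction x rule: free_induct) (simp_all add: distrib_right algebra_simps del: op_word)
qed

text \<open>In the mirrored Leibniz rule the twist falls on the right-hand factor.\<close>

lemma rder_gen: "rder q a (gen c * v) = gen c * rder q a v + (if a = c then Ktwist q a v else 0)"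
  by (simp add: rder_def lder_mult)

lemma lder_Ktwist: "lder q a (Ktwist q b x) = scale (q powi pairing a b) (Ktwist q b (lder q a x))"
proof -
  have "lder q a (Ktwist q b (word w)) = scale (q powi pairing a b) (Ktwist q b (lder q a (word w)))" for w
  proof (induction w)
    case Nil
    then show ?case by simp
  next
    case (Cons c w)
    have "lder q a (Ktwist q b (gen c * word w)) = scale (q powi pairing a b) (Ktwist q b (lder q a (gen c * word w)))"
      by (simp add: lder_gen Ktwist_gen1 Cons mult.left_commute mult.commute pairing_commute del: op_word pairing.simps)
    then show ?case by (simp only: gen_word)
  qed
  then show ?thesis
    by (induction x rule: free_induct) (simp_all add: mult.commute del: op_word)
qed

lemma rder_Ktwist: "rder q a (Ktwist q b x) = scale (q powi pairing a b) (Ktwist q b (rder q a x))"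
  by (simp add: rder_def lder_Ktwist del: pairing.simps)

text \<open>Conceptually, adjoints of left and of right shuffle multiplications commute by
  associativity; the proof checks it letter by letter.\<close>

lemma lder_rder: "lder q a (rder q b x) = rder q b (lder q a x)"
proof -
  have "lder q a (rder q b (word w)) = rder q b (lder q a (word w))" for w
  proof (induction w)
    case Nil
    then show ?case by (simp add: word_Nil)
  next
    case (Cons c w)
    have "lder q a (rder q b (gen c * word w)) = rder q b (lder q a (gen c * word w))"
      by (simp add: lder_gen rder_gen Cons lder_Ktwist mult.left_commute del: op_word pairing.simps)
    then show ?case by (simp only: gen_word)
  qed
  then show ?thesis
    by (induction x rule: free_induct) (simp_all del: op_word)
qed

lemma Ktwist_other [simp]: "Ktwist q a (Ktwist q (other a) x) = x" "Ktwist q (other a) (Ktwist q a x) = x"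
  by (induction x rule: free_induct) (simp_all add: wt_other power_int_minus mult.assoc)

lemma Kaut_eq: "Kaut q = Ktwist q LA"
proof -
  have "prod_list (map (case_letter (scale (q\<^sup>2) (gen LA)) (scale ((inverse q)\<^sup>2) (gen LB))) w)
      = scale (q powi wt LA w) (word w)" for w
  proof (induction w)
    case Nil
    then show ?case by (simp add: word_Nil)
  next
    case (Cons c w)
    then show ?case
      by (cases c) (simp_all add: gen_word power_int_add power_int_minus power_inverse power_int_diff divide_inverse mult.commute)
  qed
  then show ?thesis by (simp add: Kaut_def free_hom_eq_ext Ktwist_def)
qed

lemma Kinv_eq: "Kinv q = Ktwist q LB"
proof
  fix x
  have "inj (Ktwist q LA)"
    by (rule inj_on_inverseI[where g = "Ktwist q LB"]) (use Ktwist_other(2)[of LA] in simp)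
  then have "the_inv (Ktwist q LA) (Ktwist q LA (Ktwist q LB x)) = Ktwist q LB x"
    by (rule the_inv_f_f)
  then show "Kinv q x = Ktwist q LB x"
    using Ktwist_other(1)[of LA] by (simp add: Kinv_def Kaut_eq)
qed

end

section \<open>Adjoints\<close>

lemma form_superset: "finite S \<Longrightarrow> Poly_Mapping.keys u \<subseteq> S \<Longrightarrow>
    form u v = (\<Sum>w\<in>S. Poly_Mapping.lookup u w * Poly_Mapping.lookup v w)"
  unfolding form_def by (intro sum.mono_neutral_left) (auto simp: in_keys_iff)

lemma form_simps [simp]:
  "form (x + y) v = form x v + form y v" "form (scale c x) v = c * form x v" "form 0 v = 0"
  "form v (x + y) = form v x + form v y" "form v (scale c x) = c * form v x" "form v 0 = 0"
  "form v (x - y) = form v x - form v y"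
proof -
  let ?S = "Poly_Mapping.keys x \<union> Poly_Mapping.keys y"
  have "Poly_Mapping.keys (x + y) \<subseteq> ?S" by (rule keys_add)
  then show "form (x + y) v = form x v + form y v"
    by (simp add: form_superset[of ?S] lookup_add distrib_right sum.distrib)
  have "Poly_Mapping.keys (scale c x) \<subseteq> Poly_Mapping.keys x" by (auto simp: in_keys_iff)
  then show "form (scale c x) v = c * form x v"
    by (simp add: form_superset[of "Poly_Mapping.keys x"] sum_distrib_left mult.assoc)
  show "form v (x + y) = form v x + form v y" "form v (scale c x) = c * form v x" 
    "form v (x - y) = form v x - form v y"
    by (simp_all add: form_def lookup_add lookup_minus algebra_simps sum.distrib sum_distrib_left sum_subtractf)
qed (simp_all add: form_def)

lemma form_word: "form (word w) v = Poly_Mapping.lookup v w"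
  by (simp add: form_def)

lemma form_word_word: "form (word u) (word v) = (if u = v then 1 else 0)"
  by (auto simp: form_word lookup_single when_def)

lemma form_commute: "form x y = form y x"
proof -
  have "form (word w) y = form y (word w)" for w
    by (induction y rule: free_induct) (simp_all add: form_word_word)
  then show ?thesis
    by (induction x rule: free_induct) simp_all
qed

lemma form_eqI: "(\<And>u. form u x = form u y) \<Longrightarrow> x = y"
  by (rule poly_mapping_eqI) (metis form_word)

text \<open>Row finiteness of \<open>G\<close> comes for free: its row at a word is the column of
  \<open>F\<close> there, the finite support of a single vector.\<close>

lemma adj_eqI:
  assumes "lin G" "\<And>u v. form (F u) v = form u (G v)"
  shows "adj F = G"
  unfolding adj_def
proof (rule the_equality)
  have "{w'. Poly_Mapping.lookup (G (word w')) w \<noteq> 0} = Poly_Mapping.keys (F (word w))" for w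
    by (simp add: form_word[symmetric] assms(2)[symmetric] form_commute[of _ "word _"] in_keys_iff set_eq_iff)
  then show "G \<in> End_row_finite \<and> (\<forall>u v. form (F u) v = form u (G v))"
    using assms by (simp add: End_row_finite_def)
next
  fix G' assume "G' \<in> End_row_finite \<and> (\<forall>u v. form (F u) v = form u (G' v))"
  then show "G' = G"
    using assms(2) by (intro ext form_eqI) auto
qed

lemma form_gen: "form (gen a * u) v = form u (strip a v)"
proof -
  have "form (gen a * word u) (word v) = form (word u) (strip a (word v :: 'a free2))" for u v
    by (cases v) (simp_all add: gen_word form_word_word)
  then have "form (gen a * word u) v = form (word u) (strip a v)" for u
    by (induction v rule: free_induct) (simp_all del: op_word)
  then show ?thesis
    by (induction u rule: free_induct) (simp_all add: distrib_left)
qed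

lemma form_reversal: "form (reversal u) v = form u (reversal v)"
proof -
  have "form (reversal (word u)) (word v :: 'a free2) = form (word u) (reversal (word v))" for u v
    by (auto simp add: form_word_word)
  then have "form (reversal (word u)) v = form (word u) (reversal v)" for u
    by (induction v rule: free_induct) (simp_all del: op_word)
  then show ?thesis
    by (induction u rule: free_induct) (simp_all)
qed

lemma form_gen_right: "form (u * gen a) v = form u (stripr a v)"
proof -
  have "form (u * gen a) v = form (reversal (gen a * reversal u)) v" by simp
  then show ?thesis by (simp only: form_reversal form_gen stripr_def)
qed

lemma strip_shl: "strip d (shuffle q (gen b) u) = (if d = b then u else 0) + scale (q powi pairing d b) (shuffle q (gen b) (strip d u))"
  by (simp add: gen_strip Ktwist_gen1 del: pairing.simps)

lemma form_shl: "form (shuffle q (gen a) u) v = form u (lder q a v)"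
proof -
  have "form (shuffle q (gen a) u) (word v) = form u (lder q a (word v))" for v
  proof (induction v arbitrary: u)
    case Nil
    have "form x (word []) = eps x" for x :: "'a free2"
      by (simp add: form_commute[of x] form_word eps_def)
    moreover have "eps (gen a :: 'a free2) = 0" by (simp add: gen_eq_word)
    ultimately show ?case by simp
  next
    case (Cons d v)
    have "pairing a d = pairing d a" by simp
    then have "form (shuffle q (gen a) u) (gen d * word v) = form u (lder q a (gen d * word v))"
      using Cons[of "strip d u"]
      by (simp add: form_commute[of _ "gen d * _"] form_gen strip_shl lder_gen del: pairing.simps op_word strip_shuffle)
        (auto simp: form_commute simp del: pairing.simps op_word strip_shuffle)
    then show ?case by (simp only: gen_word)
  qed
  then show ?thesis
    by (induction v rule: free_induct) (simp_all del: op_word)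
qed

context qparam begin

lemma form_shr: "form (shuffle q u (gen a)) v = form u (rder q a v)"
proof -
  have "shuffle q u (gen a) = reversal (shuffle q (gen a) (reversal u))" by (simp add: reversal_shl)
  then show ?thesis by (simp only: form_reversal form_shl rder_def)
qed

lemma adj_simps:
  "adj (A_l q) = lder q LA" "adj (B_l q) = lder q LB" "adj (A_r q) = rder q LA" "adj (B_r q) = rder q LB"
  "adj (A_L :: 'f free2 \<Rightarrow> _) = strip LA" "adj (B_L :: 'f free2 \<Rightarrow> _) = strip LB"
  "adj (A_R :: 'f free2 \<Rightarrow> _) = stripr LA" "adj (B_R :: 'f free2 \<Rightarrow> _) = stripr LB"
  by (rule adj_eqI; simp add: lin_ops lin_rder A_l_def B_l_def A_r_def B_r_def A_L_def B_L_def A_R_def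
    B_R_def form_shl form_shr form_gen form_gen_right)+

end

section \<open>The q-Serre relations\<close>

text \<open>The q-Serre expression in two operators rather than two elements, since it is also
  needed for skew derivations and for right multiplications.\<close>

definition sop :: "'f::field \<Rightarrow> (('x, 'f) free \<Rightarrow> ('x, 'f) free) \<Rightarrow> (('x, 'f) free \<Rightarrow> ('x, 'f) free) \<Rightarrow>
    ('x, 'f) free \<Rightarrow> ('x, 'f) free" where
  "sop q F G v = F (F (F (G v))) - scale (q_three q) (F (F (G (F v))))
     + scale (q_three q) (F (G (F (F v)))) - G (F (F (F v)))"

lemma sop_lin:
  assumes "lin F" "lin G"
  shows "lin (sop q F G)"
  by (rule linI) (simp_all add: sop_def lin_add[OF assms(1)] lin_add[OF assms(2)]
      lin_scale[OF assms(1)] lin_scale[OF assms(2)] mult.commute)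

lemma serre_mult: "serre q x y * v = sop q ((*) x) ((*) y) v"
  by (simp add: serre_def sop_def power2_eq_square power3_eq_cube algebra_simps)

lemma serre_expand: "serre q x y = x * (x * (x * y)) - scale (q_three q) (x * (x * (y * x)))
    + scale (q_three q) (x * (y * (x * x))) - y * (x * (x * x))"
  by (simp add: serre_def power2_eq_square power3_eq_cube mult.assoc)

context qparam begin

lemma q_minus_inverse: "q - inverse q \<noteq> 0"
proof
  assume "q - inverse q = 0"
  then have "q * q = 1" by (metis eq_iff_diff_eq_0 q_nonzero right_inverse)
  then show False using q_nonroot[of 2] by (simp add: power2_eq_square)
qed

lemma q_three_eq: "q_three q = q\<^sup>2 + 1 + inverse (q\<^sup>2)"
proof -
  have "(q - inverse q) * (q\<^sup>2 + 1 + inverse (q\<^sup>2)) = q ^ 3 - inverse q ^ 3"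
    by (simp add: field_simps power2_eq_square power3_eq_cube)
  then show ?thesis
    using q_minus_inverse by (simp add: q_three_def divide_eq_eq mult.commute)
qed

lemma powi_pairing: "q powi pairing a a = q\<^sup>2" "q powi pairing a (other a) = inverse (q\<^sup>2)"
  "q powi pairing (other a) a = inverse (q\<^sup>2)"
  by (simp_all add: power_int_minus)

text \<open>With [3]_q = q^2 + 1 + q^(-2) the terms cancel in the free algebra itself, not only
  modulo the ideal.\<close>

lemma lder_serre: "lder q a (serre q (gen b) (gen (other b))) = 0"
proof -
  \<comment> \<open>The factor 1 turns the element into nested left multiplications, which
    \<open>lder_gen\<close> can process.\<close>
  have "lder q a (serre q (gen b) (gen (other b)) * 1) = 0"
    unfolding serre_mult sop_def
    apply (rule poly_mapping_eqI)
    using letter_cases[of a b]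
    apply (auto simp: lder_gen powi_pairing lookup_add lookup_minus q_three_eq distrib_left simp del: pairing.simps)
     apply (simp_all add: field_simps)
    done
  then show ?thesis by simp
qed

lemma sop_lder: "sop q (lder q b) (lder q (other b)) v = 0"
proof -
  have *: "sop q (lder q b) (lder q (other b)) (word w) = 0" for w
  proof (induction w)
    case Nil
    then show ?case by (simp add: sop_def)
  next
    case (Cons c w)
    \<comment> \<open>This is the leading term for the shorter word; the induction hypothesis
      eliminates it, and all other terms cancel by comparing coefficients.\<close>
    define Z where "Z = lder q b (lder q b (lder q b (lder q (other b) (word w))))"
    have Z: "Z = scale (q_three q) (lder q b (lder q b (lder q (other b) (lder q b (word w)))))
      - scale (q_three q) (lder q b (lder q (other b) (lder q b (lder q b (word w)))))
      + lder q (other b) (lder q b (lder q b (lder q b (word w))))"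
      using Cons by (simp add: sop_def Z_def algebra_simps)
    have "sop q (lder q b) (lder q (other b)) (gen c * word w) = 0"
      unfolding sop_def
      apply (rule poly_mapping_eqI)
      using letter_cases[of c b]
      apply (auto simp: lder_gen powi_pairing lookup_add lookup_minus q_three_eq Z distrib_left right_diff_distrib
         simp flip: Z_def simp del: pairing.simps op_word)
       apply (simp_all add: field_simps)
      done
    then show ?case by (simp only: gen_word)
  qed
  show ?thesis
    by (rule lin_eqI[OF sop_lin[OF lin_ops(1) lin_ops(1)], where G = "\<lambda>_. 0"]) (simp_all only: *, simp add: linI)
qed

lemma sop_rder: "sop q (rder q b) (rder q (other b)) v = 0"
proof -
  have "sop q (rder q b) (rder q (other b)) v = reversal (sop q (lder q b) (lder q (other b)) (reversal v))"
    by (simp add: sop_def rder_def)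
  then show ?thesis by (simp add: sop_lder)
qed

text \<open>
  The commutation rules say that the primed operators \<open>q\<close>-commute with the others as the two
  summands of the coproduct of a generator do; the \<open>q\<close>-Serre element is primitive.
\<close>

lemma sop_primitive:
  assumes lin: "lin F" "lin G" "lin F'" "lin G'"
    and s: "s \<noteq> 0" "q_three q = s + 1 + inverse s"
    and comm: "\<And>v. F' (F v) = scale s (F (F' v))" "\<And>v. F' (G v) = scale (inverse s) (G (F' v))"
      "\<And>v. G' (G v) = scale s (G (G' v))" "\<And>v. G' (F v) = scale (inverse s) (F (G' v))"
  shows "sop q (\<lambda>v. F v - F' v) (\<lambda>v. G v - G' v) v = sop q F G v + sop q F' G' v"
  unfolding sop_def s(2)
  apply (rule poly_mapping_eqI)
  using s(1)
  apply (simp add: lin[THEN lin_diff] lin[THEN lin_scale] comm lookup_add lookup_minus)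
  apply (simp add: field_simps)
  done

end

section \<open>The module structures I and II\<close>

text \<open>One formula for two generators: \<open>LA\<close> gives x_1 and \<open>LB\<close> gives
  x_3 of module I, since the twist of B inverts that of A. In the same way \<open>mII\<close> covers
  x_0 and x_2 of module II.\<close>

definition dI :: "'f::field \<Rightarrow> letter \<Rightarrow> 'f free2 \<Rightarrow> 'f free2" where
  "dI q a v = scale (1 - q\<^sup>2) (lder q a v - rder q (other a) (Ktwist q a v))"

definition mII :: "'f::field \<Rightarrow> letter \<Rightarrow> 'f free2 \<Rightarrow> 'f free2" where
  "mII q a v = scale (1 - q\<^sup>2) (gen a * v - Ktwist q a (v * gen (other a)))"

lemma lin_dI: "lin (dI q a)" and lin_mII: "lin (mII q a)"
  by (rule linI; simp add: dI_def mII_def mult.commute distrib_left distrib_right)+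

lemma sop_scaled:
  assumes "lin F" "lin G"
  shows "sop q (\<lambda>v. scale c (F v)) (\<lambda>v. scale c (G v)) v = scale (c ^ 4) (sop q F G v)"
  by (simp add: sop_def lin_scale[OF assms(1)] lin_scale[OF assms(2)] power4_eq_xxxx mult_ac)

context qparam begin

text \<open>This lemma and the next are x_(i+1) x_i = (1 - q^2) + q^2 x_i x_(i+1) for even and for
  odd i in module I; the two after them are the same for module II.\<close>

lemma dI_gen: "dI q a (gen a * v) = scale (1 - q\<^sup>2) v + scale (q\<^sup>2) (gen a * dI q a v)"
  by (simp add: dI_def lder_gen rder_gen Ktwist_gen1 powi_pairing right_diff_distrib mult.commute del: pairing.simps)

lemma gen_dI: "gen (other a) * dI q a v = scale (1 - q\<^sup>2) v + scale (q\<^sup>2) (dI q a (gen (other a) * v))"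
  by (simp add: dI_def lder_gen rder_gen Ktwist_gen1 powi_pairing right_diff_distrib distrib_left mult.commute
    del: pairing.simps)

lemma lder_mII: "lder q a (mII q a v) = scale (1 - q\<^sup>2) v + scale (q\<^sup>2) (mII q a (lder q a v))"
  by (simp add: mII_def lder_gen lder_mult lder_Ktwist Ktwist_gen1 powi_pairing mult.commute del: pairing.simps)

lemma mII_lder: "mII q (other a) (lder q a v) = scale (1 - q\<^sup>2) v + scale (q\<^sup>2) (lder q a (mII q (other a) v))"
  by (simp add: mII_def lder_gen lder_mult lder_Ktwist Ktwist_gen1 powi_pairing mult.commute distrib_right del: pairing.simps)
   (rule poly_mapping_eqI, simp add: lookup_add lookup_minus field_simps)

lemma sop_dI: "sop q (dI q a) (dI q (other a)) v = 0"
proof -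
  let ?F = "\<lambda>v. rder q (other a) (Ktwist q a v)" and ?G = "\<lambda>v. rder q a (Ktwist q (other a) v)"
  have "sop q (\<lambda>v. lder q a v - ?F v) (\<lambda>v. lder q (other a) v - ?G v) v =
      sop q (lder q a) (lder q (other a)) v + sop q ?F ?G v"
    \<comment> \<open>Derivations lower the weight, so the commutation factor is q^(-2); for the
      multiplications of module II it is q^2.\<close>
    by (rule sop_primitive[where s = "inverse (q\<^sup>2)"])
      (auto intro: linI simp: lder_rder lder_Ktwist powi_pairing q_three_eq simp del: pairing.simps)
  \<comment> \<open>Three twists by \<open>a\<close> and one by \<open>other a\<close> leave two by
    \<open>a\<close>; the powers of q collected on the way cancel in each summand.\<close>
  also have "sop q ?F ?G v = sop q (rder q (other a)) (rder q a) (Ktwist q a (Ktwist q a v))"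
    by (rule poly_mapping_eqI)
      (simp add: sop_def rder_Ktwist powi_pairing lookup_add lookup_minus field_simps del: pairing.simps)
  also have "\<dots> = 0" using sop_rder[of "other a"] by simp
  finally show ?thesis
    unfolding dI_def[abs_def] other_simps
    by (subst sop_scaled) (auto intro!: linI simp: sop_lder)
qed

lemma sop_mII: "sop q (mII q a) (mII q (other a)) v \<in> J q"
proof -
  let ?F = "\<lambda>v. Ktwist q a (v * gen (other a))" and ?G = "\<lambda>v. Ktwist q (other a) (v * gen a)"
  have "sop q (\<lambda>v. gen a * v - ?F v) (\<lambda>v. gen (other a) * v - ?G v) v =
      sop q ((*) (gen a)) ((*) (gen (other a))) v + sop q ?F ?G v"
    by (rule sop_primitive[where s = "q\<^sup>2"])
      (auto intro!: linI simp: Ktwist_gen1 powi_pairing q_three_eq distrib_left distrib_right mult.assoc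
        simp del: pairing.simps)
  \<comment> \<open>Right multiplications compose in the opposite order, and reversal negates the
    q-Serre element.\<close>
  also have "sop q ?F ?G v = - scale (inverse (q\<^sup>2) ^ 4) (Ktwist q a (Ktwist q a v) * serre q (gen (other a)) (gen a))"
    by (rule poly_mapping_eqI)
      (simp add: sop_def serre_expand Ktwist_gen1 powi_pairing mult.assoc
        right_diff_distrib distrib_left lookup_add lookup_minus field_simps del: pairing.simps)
  also have "sop q ((*) (gen a)) ((*) (gen (other a))) v + \<dots> \<in> J q"
    unfolding serre_mult[symmetric]
    by (intro J_rules(2) J_rules(6) J_rules(5) J_rules(4)[OF serre_J]
        J_rules(3)[OF serre_J[of q "other a", unfolded other_simps]])
  finally show ?thesis
    unfolding mII_def[abs_def] other_simps
    by (subst sop_scaled) (auto intro!: linI J_rules simp: distrib_left distrib_right)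
qed

section \<open>Invariance of \<open>J\<close> under the operators\<close>

lemma J_Ktwist: "x \<in> J q \<Longrightarrow> Ktwist q a x \<in> J q"
proof (induction x rule: J_induct)
  case (serre b)
  have *: "serre q (scale s x) (scale t y) = scale (s ^ 3 * t) (serre q x y)" for s t and x y :: "'f free2"
    by (simp add: serre_expand power3_eq_cube mult_ac)
  have "Ktwist q a (serre q (gen b) (gen (other b))) = serre q (Ktwist q a (gen b)) (Ktwist q a (gen (other b)))"
    by (simp add: serre_expand)
  then show ?case
    by (simp only: Ktwist_gen1 * J_rules serre_J)
qed (simp_all add: J_rules)

lemma J_reversal: "x \<in> J q \<Longrightarrow> reversal x \<in> J q"
proof (induction x rule: J_induct)
  case (serre b)
  have "reversal (serre q (gen b) (gen (other b))) = - serre q (gen b) (gen (other b))"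
    by (simp add: serre_expand mult.assoc)
  then show ?case by (simp add: J_rules serre_J)
qed (simp_all add: J_rules)

lemma J_letter_swap: "x \<in> J q \<Longrightarrow> letter_swap x \<in> J q"
proof (induction x rule: J_induct)
  case (serre b)
  have "letter_swap (serre q (gen b) (gen (other b))) = serre q (gen (other b)) (gen (other (other b)))"
    by (simp add: serre_expand)
  then show ?case by (simp only: serre_J)
qed (simp_all add: J_rules)

lemma J_lder: "x \<in> J q \<Longrightarrow> lder q a x \<in> J q"
proof -
  assume "x \<in> J q"
  \<comment> \<open>Strengthened by membership of \<open>x\<close> itself, because the Leibniz rule
    leaves one factor undifferentiated.\<close>
  then have "x \<in> J q \<and> lder q a x \<in> J q"
  proof (induction x rule: J_induct)
    case (left x r)
    then show ?case by (simp add: lder_mult J_rules)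
  next
    case (right x r)
    then show ?case by (simp add: lder_mult J_rules J_Ktwist)
  qed (simp_all add: J_rules serre_J lder_serre)
  then show ?thesis ..
qed

lemma J_rder: "x \<in> J q \<Longrightarrow> rder q a x \<in> J q"
  by (simp add: rder_def J_reversal J_lder)

text \<open>The image of a q-Serre element has constant term 0, and its strips are images of skew
  derivatives, which vanish.\<close>

lemma psi_J: "x \<in> J q \<Longrightarrow> psi q x = 0"
proof (induction x rule: J_induct)
  case (serre b)
  show ?case
    by (rule strip_eqI) (simp_all add: strip_psi lder_serre, simp add: serre_expand)
qed (simp_all add: psi_mult)

lemma one_notin_J: "1 \<notin> J q"
  using psi_J[of 1] by auto

end

section \<open>Primitive elements of nonzero weight\<close>

text \<open>In the adjoint action of the letter, c is q to the weight of \<open>x\<close>; a free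
  scalar spares the bookkeeping of weights.\<close>

definition qcomm :: "letter \<Rightarrow> 'f::field \<Rightarrow> 'f free2 \<Rightarrow> 'f free2" where
  "qcomm a c x = gen a * x - scale c (x * gen a)"

definition qcomms :: "letter \<Rightarrow> 'f::field list \<Rightarrow> 'f free2 \<Rightarrow> 'f free2" where
  "qcomms a cs x = foldr (qcomm a) cs x"

lemma qcomms_simps [simp]: "qcomms a [] x = x" "qcomms a (c # cs) x = qcomm a c (qcomms a cs x)"
  "qcomms a (cs @ ds) x = qcomms a cs (qcomms a ds x)"
  by (simp_all add: qcomms_def)

lemma qcomm_commute: "qcomm a c (qcomm a d x) = qcomm a d (qcomm a c x)"
  by (simp add: qcomm_def algebra_simps)

lemma qcomm_qcomms: "qcomm a c (qcomms a cs x) = qcomms a cs (qcomm a c x)"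
  by (induction cs) (simp_all, simp add: qcomm_commute)

lemma qcomms_commute: "qcomms a cs (qcomms a ds x) = qcomms a ds (qcomms a cs x)"
  by (induction cs) (simp_all add: qcomm_qcomms)

lemma qcomm_lin: "qcomm a c (x + y) = qcomm a c x + qcomm a c y" "qcomm a c (scale d x) = scale d (qcomm a c x)"
  by (simp_all add: qcomm_def algebra_simps)

lemma qcomms_lin: "qcomms a cs (x + y) = qcomms a cs x + qcomms a cs y" "qcomms a cs (scale d x) = scale d (qcomms a cs x)"
  by (induction cs) (simp_all add: qcomm_lin)

lemma qcomms_J: "x \<in> J q \<Longrightarrow> qcomms a cs x \<in> J q"
  by (induction cs) (simp_all add: qcomm_def J_rules)

lemma qcomm_mult: "qcomm a (c * d) (y * z) = qcomm a c y * z + scale c (y * qcomm a d z)"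
  by (simp add: qcomm_def algebra_simps)

text \<open>A scalar c d splits over the two factors by \<open>qcomm_mult\<close>, so each of the
  two resulting terms needs one commutator less.\<close>

lemma qcomms_mult_J:
  assumes "qcomms a cs y \<in> J q" "qcomms a ds z \<in> J q"
  shows "\<exists>es. qcomms a es (y * z) \<in> J q"
  using assms
proof (induction "length cs + length ds" arbitrary: cs ds y z rule: less_induct)
  case less
  show ?case
  proof (cases "cs = [] \<or> ds = []")
    case True
    then have "qcomms a [] (y * z) \<in> J q" using less.prems by (auto simp: J_rules)
    then show ?thesis ..
  next
    case False
    then obtain c cs' d ds' where cs: "cs = c # cs'" and ds: "ds = d # ds'"
      by (meson neq_Nil_conv)
    have "qcomms a cs' (qcomm a c y) \<in> J q" "qcomms a ds' (qcomm a d z) \<in> J q"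
      using less.prems by (simp_all add: cs ds qcomm_qcomms)
    then obtain es1 es2 where es: "qcomms a es1 (qcomm a c y * z) \<in> J q" "qcomms a es2 (y * qcomm a d z) \<in> J q"
      using less.hyps[of cs' ds "qcomm a c y" z] less.hyps[of cs ds' y "qcomm a d z"] less.prems
      by (auto simp: cs ds)
    have "qcomms a es1 (qcomms a es2 (qcomm a c y * z)) \<in> J q"
      using es(1) by (subst qcomms_commute) (rule qcomms_J)
    moreover have "qcomms a es1 (qcomms a es2 (y * qcomm a d z)) \<in> J q"
      using es(2) by (rule qcomms_J)
    ultimately have "qcomms a (es1 @ es2 @ [c * d]) (y * z) \<in> J q"
      by (simp add: qcomm_mult qcomms_lin J_rules)
    then show ?thesis ..
  qed
qed

text \<open>Only the top coefficient is recorded: being 1, it makes the resulting relation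
  nontrivial.\<close>

lemma qcomms_expand:
  "\<exists>f. f (length cs) = 1 \<and>
     qcomms a cs x = (\<Sum>i\<le>length cs. scale (f i) (gen a ^ i * x * gen a ^ (length cs - i)))"
proof (induction cs)
  case Nil
  show ?case by (rule exI[of _ "\<lambda>_. 1"]) simp
next
  case (Cons c cs)
  define M where "M = length cs"
  define T where "T i j = gen a ^ i * x * gen a ^ j" for i j
  from Cons obtain f where f: "f M = 1" "qcomms a cs x = (\<Sum>i\<le>M. scale (f i) (T i (M - i)))"
    by (auto simp: M_def T_def)
  define g where "g i = (case i of 0 \<Rightarrow> 0 | Suc j \<Rightarrow> f j) - (if i \<le> M then c * f i else 0)" for i
  have 1: "gen a * T i j = T (Suc i) j" for i j by (simp add: T_def mult.assoc)
  have 2: "T i j * gen a = T i (Suc j)" for i j by (simp add: T_def mult.assoc power_commutes)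
  have "qcomms a (c # cs) x = (\<Sum>i\<le>M. scale (f i) (T (Suc i) (M - i))) - (\<Sum>i\<le>M. scale (c * f i) (T i (Suc (M - i))))"
    by (simp add: f qcomm_def sum_distrib_left sum_distrib_right 1 2 free.scale_sum_right)
  also have "(\<Sum>i\<le>M. scale (f i) (T (Suc i) (M - i)))
      = (\<Sum>i\<le>Suc M. scale (case i of 0 \<Rightarrow> 0 | Suc j \<Rightarrow> f j) (T i (Suc M - i)))"
    by (subst sum.atMost_Suc_shift) simp
  also have "(\<Sum>i\<le>M. scale (c * f i) (T i (Suc (M - i))))
      = (\<Sum>i\<le>Suc M. scale (if i \<le> M then c * f i else 0) (T i (Suc M - i)))"
    by (auto intro!: sum.cong simp: Suc_diff_le)
  finally have "qcomms a (c # cs) x = (\<Sum>i\<le>Suc M. scale (g i) (T i (Suc M - i)))"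
    by (simp only: g_def free.scale_left_diff_distrib sum_subtractf)
  moreover have "g (Suc M) = 1" using f by (simp add: g_def)
  ultimately show ?case by (auto simp: M_def T_def intro!: exI[of _ g])
qed

context qparam begin

text \<open>Local nilpotency of the adjoint action. By the product rule letters suffice: a letter
  commutes with itself, and for the other letter three commutators give the q-Serre element.\<close>

lemma exists_qcomms_J: "\<exists>cs. qcomms a cs x \<in> J q"
proof (induction x rule: free_induct)
  case zero
  have "qcomms a [] 0 \<in> J q" by (simp add: J_rules)
  then show ?case ..
next
  case (add x y)
  then obtain cs ds where "qcomms a cs x \<in> J q" "qcomms a ds y \<in> J q" by auto
  then have "qcomms a (ds @ cs) x \<in> J q" "qcomms a (ds @ cs) y \<in> J q"
    by (simp add: qcomms_J) (simp add: qcomms_commute[of a ds cs] qcomms_J \<open>qcomms a ds y \<in> J q\<close>)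
  then have "qcomms a (ds @ cs) (x + y) \<in> J q"
    unfolding qcomms_lin by (rule J_rules)
  then show ?case ..
next
  case (word c w)
  have "\<exists>cs. qcomms a cs (word w) \<in> J q"
  proof (induction w)
    case Nil
    have "qcomms a [1] (word []) \<in> J q" by (simp add: qcomm_def word_Nil J_rules)
    then show ?case ..
  next
    case (Cons b w)
    then obtain ds where ds: "qcomms a ds (word w) \<in> J q" by auto
    have "\<exists>cs. qcomms a cs (gen b) \<in> J q"
    proof (cases "b = a")
      case True
      then have "qcomms a [1] (gen b) \<in> J q" by (simp add: qcomm_def J_rules)
      then show ?thesis ..
    next
      case False
      then have b: "b = other a" using letter_cases by blast
      \<comment> \<open>Left and right multiplication commute, and (t - q^2)(t - 1)(t - q^(-2)) =
        t^3 - [3]_q t^2 + [3]_q t - 1.\<close>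
      have "qcomms a [q\<^sup>2, 1, inverse (q\<^sup>2)] (gen b) = serre q (gen a) (gen (other a))"
        by (rule poly_mapping_eqI)
          (simp add: b qcomm_def serre_expand right_diff_distrib left_diff_distrib mult.assoc
            q_three_eq lookup_add lookup_minus field_simps)
      then show ?thesis using serre_J by metis
    qed
    then obtain cs where "qcomms a cs (gen b) \<in> J q" by blast
    from qcomms_mult_J[OF this ds] show ?case by (simp only: gen_word)
  qed
  then show ?case by (auto simp: qcomms_lin intro: J_rules)
qed

definition qnum :: "nat \<Rightarrow> 'f" where
  "qnum n = (\<Sum>i<n. (q\<^sup>2) ^ i)"

lemma qnum_nonzero: "n > 0 \<Longrightarrow> qnum n \<noteq> 0"
proof
  assume "n > 0" "qnum n = 0"
  have "(1 - q\<^sup>2) * qnum n = 1 - (q\<^sup>2) ^ n"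
    unfolding qnum_def by (rule one_diff_power_eq[symmetric])
  then have "(q\<^sup>2) ^ n = 1" using \<open>qnum n = 0\<close> by simp
  then show False using q_nonroot[of "2 * n"] \<open>n > 0\<close> by (simp add: power_mult)
qed

lemma Ktwist_gen_power: "Ktwist q a (gen a ^ i) = scale ((q\<^sup>2) ^ i) (gen a ^ i)"
  by (induction i) (simp_all add: Ktwist_gen1 powi_pairing mult.commute del: pairing.simps)

lemma lder_gen_power: "lder q a (gen a ^ i) = scale (qnum i) (gen a ^ (i - 1))"
proof (induction i)
  case (Suc i)
  show ?case
  proof (cases i)
    case 0
    then show ?thesis by (simp add: qnum_def)
  next
    case (Suc j)
    have "qnum (Suc i) = 1 + q\<^sup>2 * qnum i"
      by (simp add: qnum_def sum.lessThan_Suc_shift sum_distrib_left del: sum.lessThan_Suc)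
    then show ?thesis
      using Suc.IH Suc by (simp add: lder_gen powi_pairing free.scale_left_distrib del: pairing.simps)
  qed
qed (simp add: qnum_def)

text \<open>The Leibniz rule, with the term that differentiates \<open>x\<close> discarded modulo
  \<open>J\<close>. The truncated exponents at i = 0 or j = 0 do no harm because
  \<open>qnum 0\<close> is 0.\<close>

lemma lder_sandwich:
  assumes "lder q a x \<in> J q" "Ktwist q a x = scale (q ^ k) x"
  shows "lder q a (gen a ^ i * x * gen a ^ j) -
    (scale (qnum i) (gen a ^ (i - 1) * x * gen a ^ j) + scale (q ^ (2 * i + k) * qnum j) (gen a ^ i * x * gen a ^ (j - 1))) \<in> J q"
proof -
  have "lder q a (gen a ^ i * x * gen a ^ j) -
    (scale (qnum i) (gen a ^ (i - 1) * x * gen a ^ j) + scale (q ^ (2 * i + k) * qnum j) (gen a ^ i * x * gen a ^ (j - 1)))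
    = scale ((q\<^sup>2) ^ i) (gen a ^ i * lder q a x * gen a ^ j)"
    by (simp add: lder_mult lder_gen_power Ktwist_gen_power assms(2) power_add algebra_simps flip: power_mult)
  then show ?thesis using assms(1) by (simp add: J_rules)
qed

lemma rder_sandwich:
  assumes "rder q a x \<in> J q" "Ktwist q a x = scale (q ^ k) x"
  shows "rder q a (gen a ^ i * x * gen a ^ j) -
    (scale (qnum j) (gen a ^ i * x * gen a ^ (j - 1)) + scale (q ^ (2 * j + k) * qnum i) (gen a ^ (i - 1) * x * gen a ^ j)) \<in> J q"
proof -
  have rvp: "reversal (gen a ^ i) = (gen a :: 'f free2) ^ i" for i
    by (induction i) (simp_all add: power_commutes)
  have "lder q a (reversal x) \<in> J q" "Ktwist q a (reversal x) = scale (q ^ k) (reversal x)"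
    using assms J_reversal[of "rder q a x"] by (simp_all add: reversal_lder flip: reversal_Ktwist)
  from J_reversal[OF lder_sandwich[OF this, of j i]] show ?thesis
    by (simp add: rder_def rvp mult.assoc)
qed

text \<open>
  Some product of operators \<open>x \<mapsto> a x - c x a\<close> sends \<open>x\<close> into the ideal, by the \<open>q\<close>-Serre relations.
  In a relation between the \<open>a\<^sup>i x a\<^sup>j\<close>, \<open>i + j = M\<close>, with \<open>M\<close> minimal, the left and
  the right skew derivation yield two systems of equations for the coefficients, which are
  incompatible when the weight \<open>k\<close> is positive.
\<close>

lemma primitive_positive_weight:
  assumes del: "lder q a x \<in> J q" "rder q a x \<in> J q" and Ktwist: "Ktwist q a x = scale (q ^ k) x" and "k > 0"
  shows "x \<in> J q"
proof (rule ccontr)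
  assume x: "x \<notin> J q"
  define T where "T i j = gen a ^ i * x * gen a ^ j" for i j
  define P where "P M f \<longleftrightarrow> (\<exists>i\<le>M. f i \<noteq> 0) \<and> (\<Sum>i\<le>M. scale (f i) (T i (M - i))) \<in> J q" for M f
  obtain cs where "qcomms a cs x \<in> J q" using exists_qcomms_J by blast
  moreover obtain f where "f (length cs) = 1"
      "qcomms a cs x = (\<Sum>i\<le>length cs. scale (f i) (T i (length cs - i)))"
    using qcomms_expand[of cs a x] by (auto simp: T_def)
  ultimately have "P (length cs) f"
    unfolding P_def by (intro conjI exI[of _ "length cs"]) simp_all
  then have ex: "\<exists>M f. P M f" by blast
  define M where "M = (LEAST M. \<exists>f. P M f)"
  have M: "\<exists>f. P M f" unfolding M_def by (rule LeastI_ex) (rule ex)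
  have min: "\<not> P M' f" if "M' < M" for M' f
    using not_less_Least[of M' "\<lambda>M. \<exists>f. P M f"] that by (auto simp: M_def)
  from M obtain f where f: "P M f" by blast
  have "M \<noteq> 0"
  proof
    assume "M = 0"
    with f have "f 0 \<noteq> 0" "scale (f 0) x \<in> J q" by (auto simp: P_def T_def)
    then have "scale (inverse (f 0)) (scale (f 0) x) \<in> J q" by (intro J_rules(5)[of "scale (f 0) x"])
    with \<open>f 0 \<noteq> 0\<close> x show False by simp
  qed
  then obtain m where m: "M = Suc m" by (cases M) auto
  let ?S = "\<Sum>i\<le>Suc m. scale (f i) (T i (Suc m - i))"
  have S: "?S \<in> J q" using f by (simp only: P_def m)
  \<comment> \<open>A derivative of a relation of degree m + 1 is one of degree m: both halves are
    reindexed to the same monomials, and the boundary terms carry \<open>qnum 0\<close>.\<close>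
  have shift: "(\<Sum>i\<le>Suc m. scale (f i) (scale (u i * qnum i) (T (i - 1) (Suc m - i)) + scale (v i * qnum (Suc m - i)) (T i (Suc m - i - 1))))
      = (\<Sum>i\<le>m. scale (f (Suc i) * u (Suc i) * qnum (Suc i) + f i * v i * qnum (Suc m - i)) (T i (m - i)))" for u v
  proof -
    have "(\<Sum>i\<le>Suc m. scale (f i * (u i * qnum i)) (T (i - 1) (Suc m - i))) = (\<Sum>i\<le>m. scale (f (Suc i) * u (Suc i) * qnum (Suc i)) (T i (m - i)))"
      by (subst sum.atMost_Suc_shift) (simp add: qnum_def mult.assoc)
    moreover have "(\<Sum>i\<le>Suc m. scale (f i * (v i * qnum (Suc m - i))) (T i (Suc m - i - 1))) = (\<Sum>i\<le>m. scale (f i * v i * qnum (Suc m - i)) (T i (m - i)))"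
      by (simp add: qnum_def mult.assoc del: sum.lessThan_Suc)
    ultimately show ?thesis
      by (simp only: free.scale_right_distrib free.scale_scale sum.distrib free.scale_left_distrib)
  qed
  \<comment> \<open>Minimality of \<open>M\<close>: a shorter relation has only zero
    coefficients.\<close>
  have zero: "g i = 0" if "(\<Sum>i\<le>m. scale (g i) (T i (m - i))) \<in> J q" "i \<le> m" for g i
    using min[of m g] that by (auto simp: P_def m)
  have "lder q a ?S - (\<Sum>i\<le>Suc m. scale (f i) (scale (1 * qnum i) (T (i - 1) (Suc m - i))
      + scale (q ^ (2 * i + k) * qnum (Suc m - i)) (T i (Suc m - i - 1)))) \<in> J q"
    unfolding lin_sum[OF lin_ops(1)] sum_subtractf[symmetric] op_simps free.scale_right_diff_distrib[symmetric] mult_1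
    unfolding T_def by (rule ideal_sum[OF ideal_J], rule J_rules(5), rule lder_sandwich; rule del Ktwist)
  from J_rules(7)[OF J_lder[OF S, of a] this] have
    "(\<Sum>i\<le>m. scale (f (Suc i) * 1 * qnum (Suc i) + f i * q ^ (2 * i + k) * qnum (Suc m - i)) (T i (m - i))) \<in> J q"
    unfolding shift[of "\<lambda>_. 1" "\<lambda>i. q ^ (2 * i + k)"] by simp
  from zero[OF this] have e1: "f (Suc i) * qnum (Suc i) + f i * q ^ (2 * i + k) * qnum (Suc m - i) = 0" if "i \<le> m" for i
    using that by simp
  have "rder q a ?S - (\<Sum>i\<le>Suc m. scale (f i) (scale (q ^ (2 * (Suc m - i) + k) * qnum i) (T (i - 1) (Suc m - i))
      + scale (1 * qnum (Suc m - i)) (T i (Suc m - i - 1)))) \<in> J q"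
    unfolding lin_sum[OF lin_rder(1)] sum_subtractf[symmetric] rder_simps free.scale_right_diff_distrib[symmetric] mult_1
    unfolding T_def add.commute[of "scale (q ^ _ * _) _"]
    by (rule ideal_sum[OF ideal_J], rule J_rules(5), rule rder_sandwich; rule del Ktwist)
  from J_rules(7)[OF J_rder[OF S, of a] this] have
    "(\<Sum>i\<le>m. scale (f (Suc i) * q ^ (2 * (Suc m - Suc i) + k) * qnum (Suc i) + f i * 1 * qnum (Suc m - i)) (T i (m - i))) \<in> J q"
    unfolding shift[of "\<lambda>i. q ^ (2 * (Suc m - i) + k)" "\<lambda>_. 1"] by simp
  from zero[OF this] have e2: "f (Suc i) * q ^ (2 * (m - i) + k) * qnum (Suc i) + f i * qnum (Suc m - i) = 0" if "i \<le> m" for i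
    using that by simp
  \<comment> \<open>Eliminating \<open>f i\<close> from \<open>e1\<close> and \<open>e2\<close>
    leaves \<open>f (Suc i)\<close> times a q-number times 1 - q^(2 m + 2 k).\<close>
  have fS: "f (Suc i) = 0" if i: "i \<le> m" for i
  proof -
    have "A = Q * (A * Q')" if "A + F * Q * B = 0" "A * Q' + F * B = 0" for A B F Q Q' :: 'f
    proof -
      have "A = - (Q * (F * B))" using that(1) by (simp add: eq_neg_iff_add_eq_0 mult_ac)
      also have "F * B = - (A * Q')" using that(2) by (simp add: eq_neg_iff_add_eq_0 add.commute)
      finally show ?thesis by simp
    qed
    from this[of "f (Suc i) * qnum (Suc i)" "f i" "q ^ (2 * i + k)" "qnum (Suc m - i)" "q ^ (2 * (m - i) + k)"]
    have "f (Suc i) * qnum (Suc i) = q ^ (2 * i + k) * (f (Suc i) * q ^ (2 * (m - i) + k) * qnum (Suc i))"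
      using e1[OF i] e2[OF i] by (simp add: mult_ac)
    also have "\<dots> = q ^ ((2 * i + k) + (2 * (m - i) + k)) * (f (Suc i) * qnum (Suc i))"
      by (simp only: power_add mult_ac)
    finally have "f (Suc i) * qnum (Suc i) * (1 - q ^ (2 * i + k + (2 * (m - i) + k))) = 0"
      by (simp add: algebra_simps)
    moreover have "q ^ (2 * i + k + (2 * (m - i) + k)) \<noteq> 1"
      using \<open>k > 0\<close> by (intro q_nonroot) simp
    ultimately show ?thesis using qnum_nonzero[of "Suc i"] by simp
  qed
  have "f 0 = 0"
    using e2[of 0] fS[of 0] qnum_nonzero[of "Suc m"] by simp
  with fS have "f i = 0" if "i \<le> M" for i
    using that m by (cases i) auto
  with f show False by (auto simp: P_def)
qed

end

section \<open>Homogeneous components\<close>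

definition hgt :: "letter list \<Rightarrow> int" where
  "hgt w = (\<Sum>c\<leftarrow>w. if c = LA then 1 else - 1)"

lemma hgt_simps [simp]: "hgt [] = 0" "hgt (a # w) = (if a = LA then 1 else - 1) + hgt w"
  "hgt (u @ w) = hgt u + hgt w" "hgt (rev w) = hgt w"
  by (simp_all add: hgt_def rev_map[symmetric])

lemma wt_hgt: "wt a w = (if a = LA then 2 else - 2) * hgt w"
proof (induction w)
  case (Cons b w)
  then show ?case by (cases a; cases b) simp_all
qed simp

definition homog :: "nat \<Rightarrow> int \<Rightarrow> 'f::field free2 \<Rightarrow> bool" where
  "homog n h x \<longleftrightarrow> (\<forall>w. Poly_Mapping.lookup x w \<noteq> 0 \<longrightarrow> length w = n \<and> hgt w = h)"

lemma homog_simps [simp]: "homog n h 0" "homog n h (word w) \<longleftrightarrow> length w = n \<and> hgt w = h"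
  by (auto simp: homog_def lookup_single when_def)

lemma homog_iff: "homog n h x \<longleftrightarrow> (\<forall>w. \<not> (length w = n \<and> hgt w = h) \<longrightarrow> Poly_Mapping.lookup x w = 0)"
  by (auto simp: homog_def)

lemma homog_add: "homog n h x \<Longrightarrow> homog n h y \<Longrightarrow> homog n h (x + y)"
  and homog_scale: "homog n h x \<Longrightarrow> homog n h (scale c x)"
  and homog_sum: "(\<And>a. a \<in> A \<Longrightarrow> homog n h (g a)) \<Longrightarrow> homog n h (sum g A)"
  by (simp_all add: homog_iff lookup_add lookup_sum sum.neutral)

lemma homog_gen: "homog n h x \<Longrightarrow> homog (Suc n) ((if a = LA then 1 else - 1) + h) (gen a * x)"
  using keys_mult[of "gen a" x] by (auto simp: homog_def gen_def simp flip: in_keys_iff)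

lemma homog_shuffle_word: "homog (length u + length v) (hgt u + hgt v) (shuffle_word q u v)"
proof (induction q u v rule: shuffle_word.induct)
  case (3 q a u b v)
  have "homog (length (a # u) + length (b # v)) (hgt (a # u) + hgt (b # v)) (gen a * shuffle_word q u (b # v))"
    using homog_gen[OF 3(1), of a] by (simp add: add_ac)
  moreover have "homog (length (a # u) + length (b # v)) (hgt (a # u) + hgt (b # v)) (gen b * shuffle_word q (a # u) v)"
    using homog_gen[OF 3(2), of b] by (simp add: add_ac)
  ultimately show ?case by (auto intro!: homog_add homog_scale simp del: hgt_simps)
qed simp_all

lemma homog_shuffle: "homog m g x \<Longrightarrow> homog n h y \<Longrightarrow> homog (m + n) (g + h) (shuffle q x y)"
  unfolding shuffle_def
proof (intro homog_sum homog_scale)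
  fix u v
  assume "homog m g x" "homog n h y" "u \<in> Poly_Mapping.keys x" "v \<in> Poly_Mapping.keys y"
  then show "homog (m + n) (g + h) (shuffle_word q u v)"
    using homog_shuffle_word[of u v q] by (auto simp: homog_def in_keys_iff)
qed

lemma homog_psi_word: "homog (length w) (hgt w) (psi q (word w))"
proof (induction w)
  case (Cons a w)
  have "homog 1 (if a = LA then 1 else - 1) (gen a)" by (simp add: gen_eq_word)
  from homog_shuffle[OF this Cons, of q] show ?case by simp
qed (simp flip: word_Nil)

lemma homog_reversal: "homog n h x \<Longrightarrow> homog n h (reversal x)"
proof -
  assume "homog n h x"
  then have "homog n h (\<Sum>w\<in>Poly_Mapping.keys x. scale (Poly_Mapping.lookup x w) (word (rev w)))"
    by (intro homog_sum homog_scale) (auto simp: homog_def[of n h x] in_keys_iff)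
  then show ?thesis by (simp add: reversal_def ext_def)
qed

lemma Ktwist_homog: "homog n h x \<Longrightarrow> Ktwist q a x = scale (q powi ((if a = LA then 2 else - 2) * h)) x"
proof -
  assume "homog n h x"
  then have "Ktwist q a x = (\<Sum>w\<in>Poly_Mapping.keys x. scale (Poly_Mapping.lookup x w)
      (scale (q powi ((if a = LA then 2 else - 2) * h)) (word w)))"
    unfolding Ktwist_def ext_def by (intro sum.cong) (auto simp: homog_def in_keys_iff wt_hgt)
  also have "\<dots> = scale (q powi ((if a = LA then 2 else - 2) * h))
      (\<Sum>w\<in>Poly_Mapping.keys x. scale (Poly_Mapping.lookup x w) (word w))"
    by (simp only: free.scale_sum_right free.scale_scale mult.commute)
  also have "\<dots> = scale (q powi ((if a = LA then 2 else - 2) * h)) x"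
    by (simp only: free_expand)
  finally show ?thesis .
qed

definition hcomp :: "nat \<Rightarrow> int \<Rightarrow> 'f::field free2 \<Rightarrow> 'f free2" where
  "hcomp n h = ext (\<lambda>w. if length w = n \<and> hgt w = h then word w else 0)"

lemma lookup_hcomp: "Poly_Mapping.lookup (hcomp n h x) w =
    (if length w = n \<and> hgt w = h then Poly_Mapping.lookup x w else 0)"
proof (induction x rule: free_induct)
  case (add x y)
  then show ?case by (simp add: hcomp_def lin_add[OF lin_ext] lookup_add)
qed (auto simp: hcomp_def lin_zero[OF lin_ext] lin_scale[OF lin_ext] lookup_single when_def)

lemma homog_hcomp: "homog n h (hcomp n h x)"
  by (simp add: homog_def lookup_hcomp)

lemma hcomp_homog: "homog m g x \<Longrightarrow> hcomp n h x = (if m = n \<and> g = h then x else 0)"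
  by (rule poly_mapping_eqI) (auto simp: lookup_hcomp homog_def)

lemma lin_hcomp: "lin (hcomp n h)"
  by (simp add: hcomp_def)

text \<open>Since \<open>psi\<close> preserves length and height, its kernel is spanned by
  homogeneous elements.\<close>

lemma hcomp_psi: "hcomp n h (psi q x) = psi q (hcomp n h x)"
proof (rule lin_eqI[OF lin_comp[OF lin_hcomp lin_ops(6)] lin_comp[OF lin_ops(6) lin_hcomp]])
  fix w
  have "hcomp n h (word w :: 'a free2) = (if length w = n \<and> hgt w = h then word w else 0)"
    by (simp add: hcomp_def)
  then show "hcomp n h (psi q (word w)) = psi q (hcomp n h (word w))"
    by (simp add: hcomp_homog[OF homog_psi_word] del: op_word)
qed

lemma hcomp_expand: "x = (\<Sum>d\<in>(\<lambda>w. (length w, hgt w)) ` Poly_Mapping.keys x. hcomp (fst d) (snd d) x)"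
proof (rule poly_mapping_eqI)
  fix w
  let ?D = "(\<lambda>w. (length w, hgt w)) ` Poly_Mapping.keys x"
  have "Poly_Mapping.lookup (\<Sum>d\<in>?D. hcomp (fst d) (snd d) x) w =
      (\<Sum>d\<in>?D. if d = (length w, hgt w) then Poly_Mapping.lookup x w else 0)"
    unfolding lookup_sum by (rule sum.cong) (auto simp: lookup_hcomp)
  also have "\<dots> = (if (length w, hgt w) \<in> ?D then Poly_Mapping.lookup x w else 0)"
    by (rule sum.delta) simp
  also have "\<dots> = Poly_Mapping.lookup x w"
    by (auto simp: in_keys_iff image_iff)
  finally show "Poly_Mapping.lookup x w = Poly_Mapping.lookup (\<Sum>d\<in>?D. hcomp (fst d) (snd d) x) w" by simp
qed

text \<open>The bound is strict, so that \<open>short 0\<close> singles out 0 and starts the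
  induction.\<close>

definition short :: "nat \<Rightarrow> 'f::field free2 \<Rightarrow> bool" where
  "short n x \<longleftrightarrow> (\<forall>w. Poly_Mapping.lookup x w \<noteq> 0 \<longrightarrow> length w < n)"

lemma short_iff: "short n x \<longleftrightarrow> (\<forall>w. n \<le> length w \<longrightarrow> Poly_Mapping.lookup x w = 0)"
  by (auto simp: short_def not_less[symmetric])

lemma short_add: "short n x \<Longrightarrow> short n y \<Longrightarrow> short n (x + y)"
  and short_diff: "short n x \<Longrightarrow> short n y \<Longrightarrow> short n (x - y)"
  and short_scale: "short n x \<Longrightarrow> short n (scale c x)"
  and short_sum: "(\<And>a. a \<in> A \<Longrightarrow> short n (g a)) \<Longrightarrow> short n (sum g A)"
  by (simp_all add: short_iff lookup_add lookup_minus lookup_sum sum.neutral)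

lemma short_exists: "\<exists>n. short n x"
proof -
  have "length w < Suc (Max (length ` Poly_Mapping.keys x))" if "Poly_Mapping.lookup x w \<noteq> 0" for w
    using that by (auto simp: less_Suc_eq_le in_keys_iff intro!: Max_ge)
  then show ?thesis by (auto simp: short_def)
qed

lemma short_lder_word: "short (length w) (lder_word q a w)"
proof (induction w)
  case (Cons b w)
  have "short (Suc (length w)) (gen b * lder_word q a w)"
    using keys_mult[of "gen b" "lder_word q a w"] Cons
    by (auto simp: short_def gen_def simp flip: in_keys_iff)
  then show ?case
    by (auto intro!: short_add short_scale) (auto simp: short_def lookup_single when_def)
qed (simp add: short_def)

lemma short_lder: "short (Suc n) x \<Longrightarrow> short n (lder q a x)"
  unfolding lder_def ext_def
  by (intro short_sum short_scale) (use short_lder_word in \<open>fastforce simp: short_def in_keys_iff\<close>)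

lemma short_reversal: "short n x \<Longrightarrow> short n (reversal x)"
  unfolding reversal_def ext_def
  by (intro short_sum short_scale) (auto simp: short_def in_keys_iff lookup_single when_def)

lemma short_rder: "short (Suc n) x \<Longrightarrow> short n (rder q a x)"
  unfolding rder_def by (intro short_reversal short_lder)

section \<open>The antipode of the shuffle algebra\<close>

text \<open>
  The exponent is the sum of \<open>\<langle>u\<^sub>i, u\<^sub>j\<rangle>\<close> over \<open>i < j\<close>; it depends only on the degree of the word.
\<close>

definition antipode_coeff :: "'f::field \<Rightarrow> letter list \<Rightarrow> 'f" where
  "antipode_coeff q u = (- 1) ^ length u * q powi ((hgt u)\<^sup>2 - int (length u))"

lemma antipode_coeff_Nil [simp]: "antipode_coeff q [] = 1"
  by (simp add: antipode_coeff_def)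

text \<open>With letters as signs s_i the pairings are 2 s_i s_j, and the square of the sum of all
  s_i is n plus twice the sum of s_i s_j over i < j. A new last letter adds its pairing with all
  earlier letters.\<close>

lemma antipode_coeff_snoc: "q \<noteq> 0 \<Longrightarrow> antipode_coeff q (u @ [a]) = - antipode_coeff q u * q powi wt a u"
proof -
  assume "q \<noteq> 0"
  have "(hgt (u @ [a]))\<^sup>2 - int (length (u @ [a])) = ((hgt u)\<^sup>2 - int (length u)) + wt a u"
    by (cases a) (simp_all add: wt_hgt power2_eq_square algebra_simps)
  then show ?thesis
    using \<open>q \<noteq> 0\<close> unfolding antipode_coeff_def by (simp only:) (simp add: power_int_add)
qed

definition antipode :: "'f::field \<Rightarrow> 'f free2 \<Rightarrow> 'f free2" where
  "antipode q = ext (\<lambda>u. scale (antipode_coeff q u) (word (rev u)))"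

lemma lin_antipode: "lin (antipode q)"
  by (simp add: antipode_def)

lemma antipode_word [simp]: "antipode q (word u) = scale (antipode_coeff q u) (word (rev u))"
  by (simp add: antipode_def)

lemma antipode_homog: "homog n h x \<Longrightarrow> antipode q x = scale ((- 1) ^ n * q powi (h\<^sup>2 - int n)) (reversal x)"
proof -
  assume "homog n h x"
  then have "antipode q x = (\<Sum>w\<in>Poly_Mapping.keys x. scale (Poly_Mapping.lookup x w)
      (scale ((- 1) ^ n * q powi (h\<^sup>2 - int n)) (word (rev w))))"
    unfolding antipode_def ext_def by (intro sum.cong) (auto simp: homog_def in_keys_iff antipode_coeff_def)
  also have "\<dots> = scale ((- 1) ^ n * q powi (h\<^sup>2 - int n)) (reversal x)"
    by (simp add: reversal_def ext_def free.scale_sum_right mult_ac)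
  finally show ?thesis .
qed

text \<open>The recursion for the product splits the \<open>k\<close>-th summand in two, and the sum telescopes.\<close>

lemma antipode_sum:
  fixes q :: "'f::field"
  assumes "q \<noteq> 0" "w \<noteq> []"
  shows "(\<Sum>k\<le>length w. shuffle q (antipode q (word (take k w))) (word (drop k w))) = 0"
proof -
  \<comment> \<open>The part of the k-th summand whose words start with the last letter of the
    prefix, which reversal has moved to the front. The words starting with the next letter of
    \<open>w\<close> make up -Z (k + 1).\<close>
  define Z where "Z k = (case k of 0 \<Rightarrow> 0 | Suc j \<Rightarrow>
    scale (antipode_coeff q (take k w)) (gen (w ! j) * shuffle_word q (rev (take j w)) (drop k w)))" for k
  have *: "shuffle q (antipode q (word (take k w))) (word (drop k w)) = Z k - (if k < length w then Z (Suc k) else 0)"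
    if k: "k \<le> length w" for k
  proof (cases k)
    case 0
    obtain b v where w: "w = b # v" using assms(2) by (cases w) auto
    then show ?thesis
      using antipode_coeff_snoc[OF assms(1), of "[]" b]
      by (simp add: 0 Z_def shuffle_word_word gen_word)
  next
    case (Suc j)
    then have take: "take k w = take j w @ [w ! j]" using k by (simp add: take_Suc_conv_app_nth)
    show ?thesis
    proof (cases "k < length w")
      case True
      then have drop: "drop k w = w ! k # drop (Suc k) w" by (simp add: Cons_nth_drop_Suc)
      have take': "take (Suc k) w = take k w @ [w ! k]" using True by (simp add: take_Suc_conv_app_nth)
      have rev: "rev (take k w) = w ! j # rev (take j w)" by (simp add: take)
      have sum: "(\<Sum>c\<leftarrow>rev (take k w). pairing c (w ! k)) = wt (w ! k) (take k w)"
        using wt_simps(4)[of "w ! k" "take k w"] by (simp only: wt_def)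
      have "shuffle q (antipode q (word (take k w))) (word (drop k w)) =
        scale (antipode_coeff q (take k w)) (shuffle_word q (rev (take k w)) (drop k w))"
        by (simp add: shuffle_word_word)
      also have "shuffle_word q (rev (take k w)) (drop k w) = gen (w ! j) * shuffle_word q (rev (take j w)) (drop k w)
        + scale (q powi wt (w ! k) (take k w)) (gen (w ! k) * shuffle_word q (rev (take k w)) (drop (Suc k) w))"
        unfolding sum[symmetric] unfolding drop rev by simp
      finally show ?thesis
        using True antipode_coeff_snoc[OF assms(1), of "take k w" "w ! k"]
        by (simp add: Z_def Suc take'[unfolded Suc] del: take_Suc)
    next
      case False
      then have "k = length w" using k by simp
      then have w: "take k w = w" "drop k w = []" by simp_all
      have "rev (take k w) = w ! j # rev (take j w)" by (simp add: take)
      then have "rev w = w ! j # rev (take j w)" by (simp only: w(1))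
      then have "(word (rev w) :: 'f free2) = gen (w ! j) * word (rev (take j w))"
        by (simp only: gen_word)
      moreover have "Z k = scale (antipode_coeff q w) (gen (w ! j) * shuffle_word q (rev (take j w)) [])"
        by (simp only: Z_def Suc nat.case) (simp only: Suc[symmetric] w)
      ultimately show ?thesis
        using \<open>k = length w\<close> by (simp add: w shuffle_word_Nil_right word_Nil del: take_all_iff)
    qed
  qed
  have "(\<Sum>k\<le>length w. shuffle q (antipode q (word (take k w))) (word (drop k w)))
      = (\<Sum>k\<le>length w. Z k) - (\<Sum>k\<le>length w. if k < length w then Z (Suc k) else 0)"
    unfolding sum_subtractf[symmetric] by (rule sum.cong) (simp_all only: * atMost_iff)
  also have "(\<Sum>k\<le>length w. if k < length w then Z (Suc k) else 0) = (\<Sum>k<length w. Z (Suc k))"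
    by (rule sum.mono_neutral_cong_right) auto
  also have "(\<Sum>k\<le>length w. Z k) = Z 0 + (\<Sum>k<length w. Z (Suc k))"
    by (simp add: lessThan_Suc_atMost[symmetric] sum.lessThan_Suc_shift del: sum.lessThan_Suc)
  finally show ?thesis by (simp add: Z_def)
qed

text \<open>In each degree the antipode is a scalar multiple of reversal, and \<open>psi\<close>
  respects degrees and reversal.\<close>

lemma antipode_psi: "antipode q (psi q x) = psi q (antipode q x)" if "q \<noteq> 0"
proof (rule lin_eqI[OF lin_comp[OF lin_antipode lin_ops(6)] lin_comp[OF lin_ops(6) lin_antipode]])
  fix w
  have "homog (length w) (hgt w) (word w :: 'a free2)" by simp
  then show "antipode q (psi q (word w)) = psi q (antipode q (word w))"
    by (simp only: antipode_homog[OF homog_psi_word] antipode_homog op_simps reversal_psi[OF that])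
qed

text \<open>Self-adjointness: concatenation and shuffling with a letter have the adjoints
  \<open>strip\<close> and \<open>lder\<close>, which \<open>psi\<close> intertwines.\<close>

lemma form_psi: "form (psi q x) y = form x (psi q y)"
proof -
  have "form (psi q (word u)) y = form (word u) (psi q y)" for u
  proof (induction u arbitrary: y)
    case Nil
    show ?case by (simp add: word_Nil) (simp add: form_word eps_def[symmetric] flip: word_Nil)
  next
    case (Cons a u)
    have "form (psi q (gen a * word u)) y = form (gen a * word u) (psi q y)"
      by (simp only: psi_gen form_shl Cons form_gen strip_psi)
    then show ?case by (simp only: gen_word)
  qed
  then show ?thesis
    by (induction x rule: free_induct) (simp_all del: op_word)
qed

section \<open>The kernel of the homomorphism to the shuffle algebra\<close>

definition functional :: "(('x, 'f::field) free \<Rightarrow> 'f) \<Rightarrow> bool" where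
  "functional g \<longleftrightarrow> (\<forall>x y. g (x + y) = g x + g y) \<and> (\<forall>c x. g (scale c x) = c * g x)"

lemma functional_sum:
  assumes "functional g"
  shows "g (\<Sum>i\<in>A. scale (c i) (v i)) = (\<Sum>i\<in>A. c i * g (v i))"
proof -
  have "g 0 = 0" using assms unfolding functional_def by (metis free.scale_zero_left mult_zero_left)
  then show ?thesis
    using assms by (induction A rule: infinite_finite_induct) (simp_all add: functional_def)
qed

lemma functional_comp: "functional g \<Longrightarrow> lin F \<Longrightarrow> functional (\<lambda>x. g (F x))"
  by (simp add: functional_def lin_add lin_scale)

lemma functional_lookup: "functional (\<lambda>x. Poly_Mapping.lookup x w)"
  by (simp add: functional_def lookup_add)

lemma functional_form: "functional (\<lambda>x. form x y)"
  by (simp add: functional_def)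

lemma projection_exists:
  fixes S :: "('x, 'f::field) free set"
  assumes "free.subspace S"
  shows "\<exists>P. lin P \<and> range P \<subseteq> S \<and> (\<forall>x\<in>S. P x = x)"
  using free.linear_exists_left_inverse_on[of "\<lambda>x. x" S] assms by auto

text \<open>With a projection onto the subspace, some coordinate of the complementary part
  separates.\<close>

lemma separation:
  fixes S :: "('x, 'f::field) free set"
  assumes "free.subspace S" "x \<notin> S"
  shows "\<exists>g. functional g \<and> (\<forall>y\<in>S. g y = 0) \<and> g x \<noteq> 0"
proof -
  obtain P where P: "lin P" "range P \<subseteq> S" "\<forall>x\<in>S. P x = x"
    using projection_exists[OF assms(1)] by blast
  have "x - P x \<noteq> 0" using P(2) assms(2) by auto
  then obtain w where w: "Poly_Mapping.lookup (x - P x) w \<noteq> 0"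
    by (metis poly_mapping_eqI lookup_zero)
  have "functional (\<lambda>x. Poly_Mapping.lookup (x - P x) w)"
    by (rule functional_comp[OF functional_lookup]) (rule lin_minus[OF lin_id P(1)])
  then show ?thesis
    using P(3) w by (intro exI[of _ "\<lambda>x. Poly_Mapping.lookup (x - P x) w"]) simp
qed

abbreviation words :: "nat \<Rightarrow> letter list set" where
  "words n \<equiv> {w. length w = n}"

lemma finite_words: "finite (words n)"
proof -
  have "(UNIV :: letter set) = {LA, LB}" by (auto intro: letter.exhaust)
  then have "finite (UNIV :: letter set)" by (metis finite.emptyI finite.insertI)
  from finite_lists_length_eq[OF this, of n] show ?thesis by simp
qed

lemma functional_homog:
  assumes "functional g" "homog n h x"
  shows "g x = (\<Sum>w\<in>words n. g (word w) * Poly_Mapping.lookup x w)"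
proof -
  have "g x = (\<Sum>w\<in>Poly_Mapping.keys x. Poly_Mapping.lookup x w * g (word w))"
    using functional_sum[OF assms(1), of "Poly_Mapping.lookup x" word "Poly_Mapping.keys x"]
    by (simp add: free_expand)
  also have "\<dots> = (\<Sum>w\<in>words n. Poly_Mapping.lookup x w * g (word w))"
    using assms(2) by (intro sum.mono_neutral_left finite_words) (auto simp: homog_def in_keys_iff)
  finally show ?thesis by (simp add: mult.commute)
qed

lemma lookup_reversal: "Poly_Mapping.lookup (reversal x) w = Poly_Mapping.lookup x (rev w)"
  by (simp add: form_word[symmetric] form_reversal[symmetric])

lemma range_psi_subspace: "free.subspace (range (psi q))"
proof (rule free.subspaceI)
  show "0 \<in> range (psi q)" using rangeI[of "psi q" 0] by simp
next
  fix x y assume "x \<in> range (psi q)" "y \<in> range (psi q)"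
  then obtain a b where "x = psi q a" "y = psi q b" by blast
  then show "x + y \<in> range (psi q)" using rangeI[of "psi q" "a + b"] by simp
next
  fix c x assume "x \<in> range (psi q)"
  then obtain y where "x = psi q y" by blast
  then show "scale c x \<in> range (psi q)" using rangeI[of "psi q" "scale c y"] by simp
qed

context qparam begin

definition psi_faithful :: "nat \<Rightarrow> bool" where
  "psi_faithful n \<longleftrightarrow> (\<forall>x. short n x \<longrightarrow> psi q x = 0 \<longrightarrow> x \<in> J q)"

text \<open>Duality in one degree. Otherwise a functional \<open>h\<close> kills the image of
  \<open>psi\<close> but not the vector; by self-adjointness the coefficients of \<open>h\<close>
  form an element of the kernel, hence of \<open>J\<close>, on which \<open>g\<close> would take a
  nonzero value.\<close>

lemma annihilator_in_range:
  assumes "psi_faithful n" "k < n" "functional g" "\<And>y. y \<in> J q \<Longrightarrow> g y = 0"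
  shows "(\<Sum>w\<in>words k. scale (g (word w)) (word w)) \<in> range (psi q)" (is "?t \<in> _")
proof (rule ccontr)
  assume "?t \<notin> range (psi q)"
  from separation[OF range_psi_subspace this]
  obtain h where h: "functional h" "\<And>y. h (psi q y) = 0" "h ?t \<noteq> 0" by auto
  define y where "y = (\<Sum>w\<in>words k. scale (h (word w)) (word w))"
  have lookup_y: "Poly_Mapping.lookup y w = (if length w = k then h (word w) else 0)" for w
    by (simp add: y_def lookup_sum lookup_single when_def if_distrib sum.delta finite_words cong: if_cong)
  have "psi q y = 0"
  proof (rule poly_mapping_eqI)
    fix w
    have "Poly_Mapping.lookup (psi q y) w = form y (psi q (word w))"
      using form_psi[of q "word w" y] form_commute[of "psi q (word w)" y] by (simp only: form_word)
    also have "\<dots> = (\<Sum>v\<in>words k. h (word v) * Poly_Mapping.lookup (psi q (word w)) v)"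
      unfolding y_def functional_sum[OF functional_form] form_word ..
    also have "\<dots> = 0"
    proof (cases "length w = k")
      case True
      then have "homog k (hgt w) (psi q (word w))" using homog_psi_word[of w q] by simp
      from functional_homog[OF h(1) this] h(2) show ?thesis by (simp del: op_word)
    next
      case False
      then show ?thesis
        using homog_psi_word[of w q] by (intro sum.neutral) (auto simp: homog_def simp del: op_word)
    qed
    finally show "Poly_Mapping.lookup (psi q y) w = Poly_Mapping.lookup 0 w" by simp
  qed
  moreover have "short n y"
    using assms(2) by (auto simp: short_def lookup_y split: if_splits)
  ultimately have "g y = 0" using assms(1,4) by (auto simp: psi_faithful_def)
  moreover have "g y = h ?t"
    by (simp add: y_def functional_sum[OF assms(3)] functional_sum[OF h(1)] mult.commute)
  ultimately show False using h(3) by simp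
qed

text \<open>
  The functional \<open>f\<close> is regarded as an element of the shuffle algebra, to which the antipode identity
  applies. By induction the two tensor factors of the middle terms can be taken in the
  image of \<open>psi\<close>, whose elements are orthogonal to \<open>x\<close>.
\<close>

lemma antipode_primitive:
  assumes n: "psi_faithful n" and x: "homog n 0 x" "psi q x = 0" and "n > 0"
    and f: "functional f" "\<And>y. y \<in> J q \<Longrightarrow> f y = 0"
  shows "f x + (- 1) ^ n * q powi (- int n) * f (reversal x) = 0"
proof -
  \<comment> \<open>Both tensor factors have to lie in the image of \<open>psi\<close> at once: the
    projection keeps the first one there while the sums are exchanged to treat the second.\<close>
  obtain P where P: "lin P" "range P \<subseteq> range (psi q)" "\<forall>x\<in>range (psi q). P x = x"
    using projection_exists[OF range_psi_subspace] by blast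
  define B where "B a b = form (shuffle q (antipode q a) b) x" for a b
  have Bl: "functional (\<lambda>a. B a b)" and Br: "functional (\<lambda>b. B a b)" for a b
    unfolding B_def functional_def by (simp_all add: lin_add[OF lin_antipode] lin_scale[OF lin_antipode])
  have BP: "functional (\<lambda>a. B (P a) b)" for b
    by (rule functional_comp[OF Bl P(1)])
  \<comment> \<open>The product of two images is an image, and self-adjointness moves
    \<open>psi\<close> onto \<open>x\<close>, which it kills.\<close>
  have B0: "B (psi q a) (psi q b) = 0" for a b
    unfolding B_def antipode_psi[OF q_nonzero] psi_mult[OF q_nonzero, symmetric] form_psi x(2) by simp
  define Z where "Z k = (\<Sum>w\<in>words n. f (word w) * B (word (take k w)) (word (drop k w)))" for k
  have "(\<Sum>k\<le>n. Z k) = (\<Sum>w\<in>words n. f (word w) * (\<Sum>k\<le>length w. B (word (take k w)) (word (drop k w))))"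
    unfolding Z_def by (subst sum.swap) (auto simp: sum_distrib_left intro!: sum.cong)
  also have "\<dots> = 0"
  proof (rule sum.neutral, clarify)
    fix w :: "letter list" assume w: "n = length w"
    have "(\<Sum>k\<le>length w. B (word (take k w)) (word (drop k w)))
        = form (\<Sum>k\<le>length w. scale 1 (shuffle q (antipode q (word (take k w))) (word (drop k w)))) x"
      unfolding functional_sum[OF functional_form] B_def by simp
    also have "\<dots> = 0"
      using antipode_sum[of q w] w \<open>n > 0\<close> by (simp del: antipode_word)
    finally show "f (word w) * (\<Sum>k\<le>length w. B (word (take k w)) (word (drop k w))) = 0" by simp
  qed
  finally have "(\<Sum>k\<le>n. Z k) = 0" .
  moreover have "(\<Sum>k\<le>n. Z k) = (\<Sum>k\<in>{0, n}. Z k)"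
  proof (rule sum.mono_neutral_right)
    show "\<forall>k\<in>{..n} - {0, n}. Z k = 0"
    proof
      fix k assume "k \<in> {..n} - {0, n}"
      then have k: "0 < k" "k < n" by auto
      define s where "s u' = (\<Sum>u\<in>words k. scale (f (word u * word u')) (word u))" for u'
      define t where "t u = (\<Sum>u'\<in>words (n - k). scale (f (word u * word u')) (word u'))" for u
      \<comment> \<open>\<open>J\<close> is two-sided, so \<open>f\<close> with one factor of the
        product fixed still kills \<open>J\<close>.\<close>
      have s: "s u' \<in> range (psi q)" for u'
        unfolding s_def
        by (rule annihilator_in_range[OF n k(2), where g = "\<lambda>y. f (y * word u')"])
          (auto intro!: functional_comp[OF f(1)] lin_mult_right[OF lin_id] f(2) J_rules(4))
      have t: "t u \<in> range (psi q)" for u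
        unfolding t_def
        by (rule annihilator_in_range[OF n, where g = "\<lambda>y. f (word u * y)"])
          (use k in \<open>auto intro!: functional_comp[OF f(1)] lin_mult_left[OF lin_id] f(2) J_rules(3)\<close>)
      have "Z k = (\<Sum>(u', u)\<in>words (n - k) \<times> words k. f (word u * word u') * B (word u) (word u'))"
        unfolding Z_def
        by (rule sum.reindex_bij_witness[of _ "\<lambda>(u', u). u @ u'" "\<lambda>w. (drop k w, take k w)"])
          (use k in \<open>auto simp: word_mult\<close>)
      also have "\<dots> = (\<Sum>u'\<in>words (n - k). \<Sum>u\<in>words k. f (word u * word u') * B (word u) (word u'))"
        by (rule sum.cartesian_product[symmetric])
      also have "\<dots> = (\<Sum>u'\<in>words (n - k). B (s u') (word u'))"
        unfolding s_def functional_sum[OF Bl] ..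
      also have "\<dots> = (\<Sum>u'\<in>words (n - k). B (P (s u')) (word u'))"
        by (simp only: bspec[OF P(3) s])
      also have "\<dots> = (\<Sum>u'\<in>words (n - k). \<Sum>u\<in>words k. f (word u * word u') * B (P (word u)) (word u'))"
        unfolding s_def functional_sum[OF BP] ..
      also have "\<dots> = (\<Sum>u\<in>words k. \<Sum>u'\<in>words (n - k). f (word u * word u') * B (P (word u)) (word u'))"
        by (rule sum.swap)
      also have "\<dots> = (\<Sum>u\<in>words k. B (P (word u)) (t u))"
        unfolding t_def functional_sum[OF Br] ..
      also have "\<dots> = 0"
      proof (rule sum.neutral, rule)
        fix u
        obtain a b where "P (word u) = psi q a" "t u = psi q b"
          using P(2) t[of u] by blast
        then show "B (P (word u)) (t u) = 0" by (simp add: B0)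
      qed
      finally show "Z k = 0" .
    qed
  qed auto
  moreover have "Z 0 = f x"
    unfolding Z_def functional_homog[OF f(1) x(1)]
    using antipode_word[of q "[]"] by (simp add: B_def form_word word_Nil)
  moreover have "Z n = (- 1) ^ n * q powi (- int n) * f (reversal x)"
  proof -
    have "B (word w) (word []) = (- 1) ^ n * q powi (- int n) * Poly_Mapping.lookup (reversal x) w"
      if "length w = n" for w
    proof (cases "Poly_Mapping.lookup x (rev w) = 0")
      case True
      then show ?thesis by (simp add: B_def word_Nil form_word lookup_reversal)
    next
      case False
      then have "hgt w = 0" using x(1) by (auto simp: homog_def)
      then show ?thesis using that by (simp add: B_def word_Nil form_word lookup_reversal antipode_coeff_def)
    qed
    then have "Z n = (\<Sum>w\<in>words n. f (word w) * ((- 1) ^ n * q powi (- int n) * Poly_Mapping.lookup (reversal x) w))"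
      unfolding Z_def by (intro sum.cong) auto
    also have "\<dots> = (- 1) ^ n * q powi (- int n) * f (reversal x)"
      unfolding functional_homog[OF f(1) homog_reversal[OF x(1)]] sum_distrib_left by (simp add: mult_ac)
    finally show ?thesis .
  qed
  ultimately show ?thesis using \<open>n > 0\<close> by simp
qed

lemma primitive_zero_weight:
  assumes "psi_faithful n" "homog n 0 x" "psi q x = 0" "n > 0"
  shows "x \<in> J q"
proof (rule ccontr)
  assume "x \<notin> J q"
  from separation[OF ideal_subspace[OF ideal_J] this] obtain f
    where f: "functional f" "\<And>y. y \<in> J q \<Longrightarrow> f y = 0" "f x \<noteq> 0" by blast
  define c where "c = (- 1) ^ n * q powi (- int n)"
  have 1: "f x + c * f (reversal x) = 0"
    unfolding c_def by (rule antipode_primitive[OF assms f(1,2)])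
  \<comment> \<open>The identity is applied to \<open>f\<close> and to its composite with reversal;
    eliminating the second value leaves c^2 = 1.\<close>
  have "functional (\<lambda>x. f (reversal x))" by (rule functional_comp[OF f(1) lin_ops(3)])
  from antipode_primitive[OF assms this] have 2: "f (reversal x) + c * f x = 0"
    unfolding c_def by (simp add: f(2) J_reversal)
  have "f (reversal x) = - (c * f x)" using 2 by (simp add: eq_neg_iff_add_eq_0)
  with 1 have "f x = (c * c) * f x" by (simp add: mult.assoc)
  then have "c * c = 1" using f(3) by simp
  moreover have "(c * c) * q ^ (2 * n) = (c * q ^ n) * (c * q ^ n)"
    by (simp only: mult_2_right power_add mult_ac)
  moreover have "c * q ^ n = (- 1) ^ n" by (simp add: c_def power_int_minus mult.assoc)
  ultimately have "q ^ (2 * n) = 1"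
    by (simp flip: power_mult_distrib)
  then show False using q_nonroot[of "2 * n"] assms(4) by simp
qed

lemma psi_faithful: "psi_faithful n"
proof (induction n)
  case 0
  have "x = 0" if "short 0 x" for x :: "'f free2"
    using that by (intro poly_mapping_eqI) (auto simp: short_def)
  then show ?case unfolding psi_faithful_def using J_rules(1) by blast
next
  case (Suc n)
  have hcomp: "hcomp m h x \<in> J q" if x: "short (Suc n) x" "psi q x = 0" for m h x
  proof -
    let ?y = "hcomp m h x"
    have hom: "homog m h ?y" by (rule homog_hcomp)
    have psi: "psi q ?y = 0"
      unfolding hcomp_psi[symmetric] x(2) by (rule lin_zero[OF lin_hcomp])
    have short: "short (Suc n) ?y"
      using x(1) by (auto simp: short_def lookup_hcomp split: if_splits)
    show ?thesis
    proof (cases "m < n")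
      case True
      then have "short n ?y" using hom by (auto simp: short_def homog_def)
      with Suc psi show ?thesis by (simp add: psi_faithful_def)
    next
      case False
      show ?thesis
      \<comment> \<open>\<open>short (Suc n)\<close> allows length n, which is the only new degree;
        longer components are 0.\<close>
      proof (cases "m = n")
        case m: True
        have del: "lder q a ?y \<in> J q" for a
          using Suc short_lder[OF short, of q a] strip_psi[of a q ?y, symmetric] psi
          by (simp add: psi_faithful_def)
        have "psi q (rder q a ?y) = reversal (strip a (psi q (reversal ?y)))" for a
          by (simp add: rder_def strip_psi reversal_psi)
        also have "\<dots> a = 0" for a
          by (simp add: reversal_psi[symmetric] psi)
        finally have rder: "rder q a ?y \<in> J q" for a
          using Suc short_rder[OF short, of q a] by (simp add: psi_faithful_def)
        consider "h > 0" | "h < 0" | "h = 0" by linarith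
        then show ?thesis
        proof cases
          case 1
          have "Ktwist q LA ?y = scale (q ^ nat (2 * h)) ?y"
            using 1 by (simp add: Ktwist_homog[OF hom] power_int_def)
          from primitive_positive_weight[OF del rder this] 1 show ?thesis by simp
        next
          \<comment> \<open>The twist of B inverts that of A, so negative height is positive weight
            for the letter B.\<close>
          case 2
          have "Ktwist q LB ?y = scale (q ^ nat (- 2 * h)) ?y"
            using 2 by (simp add: Ktwist_homog[OF hom] power_int_def)
          from primitive_positive_weight[OF del rder this] 2 show ?thesis by simp
        next
          case 3
          show ?thesis
          proof (cases "n = 0")
            case True
            have "?y = scale (eps ?y) 1"
              by (rule poly_mapping_eqI)
                (use hom m True in \<open>auto simp: homog_def eps_def lookup_single when_def simp flip: word_Nil\<close>)
            then have "psi q ?y = ?y" by (metis lin_scale[OF lin_ops(6)] op_one(6))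
            with psi have "?y = 0" by simp
            then show ?thesis by (simp add: J_rules)
          next
            case False
            then show ?thesis using primitive_zero_weight[OF Suc _ psi] hom m 3 by simp
          qed
        qed
      next
        case False
        with \<open>\<not> m < n\<close> have "?y = 0"
          using short hom by (intro poly_mapping_eqI) (auto simp: short_def homog_def)
        then show ?thesis by (simp add: J_rules)
      qed
    qed
  qed
  show ?case
    unfolding psi_faithful_def
  proof clarify
    fix x assume x: "short (Suc n) x" "psi q x = 0"
    show "x \<in> J q"
      by (subst hcomp_expand) (intro ideal_sum[OF ideal_J] hcomp x)
  qed
qed

lemma psi_eq_0_iff: "psi q x = 0 \<longleftrightarrow> x \<in> J q"
  using short_exists[of x] psi_faithful psi_J by (auto simp: psi_faithful_def)

lemma U_eq: "U q = range (psi q)"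
proof
  show "U q \<subseteq> range (psi q)"
  proof
    fix x assume "x \<in> U q"
    then show "x \<in> range (psi q)"
    proof induction
      case U_one
      show ?case using rangeI[of "psi q" 1] by simp
    next
      case (U_gen a)
      show ?case using rangeI[of "psi q" "gen a"] by simp
    next
      case (U_shuffle x y)
      then obtain a b where "x = psi q a" "y = psi q b" by blast
      then show ?case using rangeI[of "psi q" "a * b"] by (simp add: psi_mult)
    qed (auto intro: range_psi_subspace[THEN free.subspace_add] range_psi_subspace[THEN free.subspace_scale])
  qed
  have word: "psi q (word w) \<in> U q" for w
  proof (induction w)
    case (Cons a w)
    then show ?case by (simp add: U.intros)
  qed (simp add: U.intros)
  have "0 \<in> U q" using U_scale[OF U_one, of 0] by simp
  then have "psi q x \<in> U q" for x
    by (induction x rule: free_induct) (simp_all add: U.intros word del: op_word)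
  then show "range (psi q) \<subseteq> U q" by auto
qed

end

section \<open>Rotation of words\<close>

fun rot :: "letter list \<Rightarrow> letter list" where
  "rot [] = []"
| "rot (a # w) = w @ [other a]"

lemma length_rot [simp]: "length (rot w) = length w"
  by (cases w) simp_all

lemma rot_append: "(rot ^^ length u) (u @ v) = v @ map other u"
proof (induction u arbitrary: v)
  case (Cons a u)
  have "(rot ^^ length (a # u)) ((a # u) @ v) = (rot ^^ length u) (u @ (v @ [other a]))"
    by (simp add: funpow_Suc_right del: funpow.simps)
  then show ?case by (simp add: Cons)
qed simp

text \<open>One turn brings every letter back to its place, exchanged; the second turn undoes the
  exchange.\<close>

lemma rot_period: "(rot ^^ (2 * length w)) w = w"
proof -
  have "(rot ^^ length w) w = map other w" for w
    using rot_append[of w "[]"] by simp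
  then have "(rot ^^ length w) ((rot ^^ length w) w) = w"
    by (metis length_map map_map map_idI comp_apply other_simps(1))
  then show ?thesis by (simp add: mult_2 funpow_add)
qed

text \<open>The \<open>q\<close>-power picked up by a rotation is, up to a constant, a difference of values of \<open>ecnt\<close>.\<close>

definition cnt :: "letter \<Rightarrow> letter list \<Rightarrow> int" where
  "cnt a w = int (count_list w a)"

definition ecnt :: "letter list \<Rightarrow> int" where
  "ecnt w = 2 * (cnt LA w * cnt LB w)"

lemma wt_cnt: "wt a w = 2 * cnt a w - 2 * cnt (other a) w"
  by (induction w) (use letter_cases[of _ a] in \<open>auto simp: cnt_def\<close>)

text \<open>The untouched letters contribute the difference of \<open>ecnt\<close>, and the moved
  letter its pairing -2 with the letter it replaces.\<close>

lemma wt_rot: "w \<noteq> [] \<Longrightarrow> wt (hd w) (rot w) = ecnt (rot w) - ecnt w - 2"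
proof (cases w)
  case (Cons a v)
  then show ?thesis
    by (cases a) (simp_all add: wt_cnt ecnt_def cnt_def algebra_simps)
qed simp

context qparam begin

text \<open>A full cycle makes each word congruent to q^(-4 (n + 1)) times itself modulo
  \<open>S\<close>. The subspace is left open for two uses: vectors orthogonal to a given one, and
  the submodule generated by 1 in module II.\<close>

lemma rotation_span:
  assumes S: "free.subspace S"
    and rel: "\<And>a w. length w = n \<Longrightarrow> word (a # w) - Ktwist q a (word (w @ [other a])) \<in> S"
    and w: "length w = Suc n"
  shows "(word w :: 'f free2) \<in> S"
proof -
  have rel': "word v - scale (q powi (ecnt (rot v) - ecnt v - 2)) (word (rot v)) \<in> S"
    if "length v = Suc n" for v
  proof -
    obtain a v' where v: "v = a # v'" "length v' = n" using \<open>length v = Suc n\<close> by (cases v) auto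
    have "wt a (v' @ [other a]) = ecnt (rot v) - ecnt v - 2"
      using wt_rot[of v] by (simp add: v)
    then show ?thesis using rel[of v' a] v by simp
  qed
  have "word w - scale (q powi (ecnt ((rot ^^ j) w) - ecnt w - 2 * int j)) (word ((rot ^^ j) w)) \<in> S" for j
  proof (induction j)
    case 0
    show ?case by (simp add: free.subspace_0[OF S])
  next
    case (Suc j)
    let ?v = "(rot ^^ j) w" and ?c = "q powi (ecnt ((rot ^^ j) w) - ecnt w - 2 * int j)"
    have "length ?v = Suc n" by (induction j) (simp_all add: w)
    from free.subspace_add[OF S Suc free.subspace_scale[OF S rel'[OF this], of ?c]]
    have "word w - scale (?c * q powi (ecnt (rot ?v) - ecnt ?v - 2)) (word (rot ?v)) \<in> S" by simp
    also have "?c * q powi (ecnt (rot ?v) - ecnt ?v - 2) = q powi (ecnt (rot ?v) - ecnt w - 2 * int (Suc j))"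
      by (subst power_int_add[symmetric]) (simp_all add: algebra_simps)
    finally show ?case by simp
  qed
  from this[of "2 * length w"] have "word w - scale (q powi (- 4 * int (Suc n))) (word w) \<in> S"
    unfolding rot_period by (simp add: w algebra_simps)
  then have "scale (1 - q powi (- 4 * int (Suc n))) (word w) \<in> S"
    by (simp only: free.scale_left_diff_distrib free.scale_one)
  from free.subspace_scale[OF S this, of "inverse (1 - q powi (- 4 * int (Suc n)))"]
  moreover have "q powi (- 4 * int (Suc n)) \<noteq> 1"
  proof -
    have "q powi (- 4 * int (Suc n)) = inverse (q ^ (4 * Suc n))"
      by (subst power_int_of_nat[symmetric], subst power_int_minus[symmetric]) simp
    then show ?thesis using q_nonroot[of "4 * Suc n"] by simp
  qed
  ultimately show ?thesis by simp
qed

section \<open>Irreducibility of module I\<close>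

lemma lookup_strip: "Poly_Mapping.lookup (strip a u) w = Poly_Mapping.lookup u (a # w)"
  by (simp add: form_word[symmetric] form_gen[symmetric] gen_word)

lemma lookup_stripr: "Poly_Mapping.lookup (stripr a u) w = Poly_Mapping.lookup u (w @ [a])"
  by (simp add: form_word[symmetric] form_gen_right[symmetric] word_gen)

lemma lookup_Ktwist: "Poly_Mapping.lookup (Ktwist q a u) w = q powi wt a w * Poly_Mapping.lookup u w"
proof (induction u rule: free_induct)
  case (word c v)
  then show ?case by (simp add: lookup_single when_def)
qed (simp_all add: lookup_add algebra_simps)

text \<open>Dual use of rotation: the hypothesis says that the rotation relations are orthogonal to
  \<open>u\<close>, hence so are all nonempty words.\<close>

lemma annihilated_constant:
  assumes "\<And>a. strip a u = stripr (other a) (Ktwist q a u)"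
  shows "u = scale (eps u) 1"
proof (rule poly_mapping_eqI)
  fix w :: "letter list"
  have S: "free.subspace {v. form v u = 0}"
    by (rule free.subspaceI) simp_all
  have "Poly_Mapping.lookup u w = 0" if w: "w \<noteq> []"
  proof -
    have "word w \<in> {v. form v u = 0}"
    proof (rule rotation_span[OF S])
      show "length w = Suc (length w - 1)" using w by simp
      fix a and v :: "letter list"
      have "Poly_Mapping.lookup (strip a u) v = Poly_Mapping.lookup (stripr (other a) (Ktwist q a u)) v"
        by (simp only: assms)
      moreover have "form (x - y) z = form x z - form y z" for x y z :: "'f free2"
        by (simp add: form_commute[of _ z])
      ultimately show "word (a # v) - Ktwist q a (word (v @ [other a])) \<in> {v. form v u = 0}"
        by (simp add: form_word lookup_strip lookup_stripr lookup_Ktwist)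
    qed
    then show ?thesis by (simp add: form_word)
  qed
  then show "Poly_Mapping.lookup u w = Poly_Mapping.lookup (scale (eps u) 1) w"
    by (cases "w = []") (simp_all add: eps_def lookup_single when_def flip: word_Nil)
qed

lemma psi_rder: "psi q (rder q a x) = stripr a (psi q x)"
  by (simp add: rder_def stripr_def strip_psi[symmetric] reversal_psi[symmetric])

text \<open>Length is measured after \<open>psi\<close>, as representatives are only determined
  modulo \<open>J\<close>. There x_1 and x_3 remove a letter at one of the ends, so a nonzero vector
  of minimal length is killed by both and is constant.\<close>

lemma dI_irreducible:
  assumes P: "free.subspace P" "J q \<subseteq> P" "\<And>a x. x \<in> P \<Longrightarrow> dI q a x \<in> P" and "1 \<notin> P"
  shows "P = J q"
proof (rule ccontr)
  assume "P \<noteq> J q"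
  with P(2) obtain x0 where "x0 \<in> P" "psi q x0 \<noteq> 0" by (auto simp: psi_eq_0_iff)
  then have ex: "\<exists>n x. x \<in> P \<and> psi q x \<noteq> 0 \<and> short n (psi q x)"
    using short_exists by blast
  define n where "n = (LEAST n. \<exists>x. x \<in> P \<and> psi q x \<noteq> 0 \<and> short n (psi q x))"
  have "\<exists>x. x \<in> P \<and> psi q x \<noteq> 0 \<and> short n (psi q x)"
    unfolding n_def by (rule LeastI_ex) (rule ex)
  then obtain x where x: "x \<in> P" "psi q x \<noteq> 0" "short n (psi q x)" by blast
  have min: "psi q y = 0" if "y \<in> P" "short m (psi q y)" "m < n" for y m
    using not_less_Least[of m "\<lambda>n. \<exists>x. x \<in> P \<and> psi q x \<noteq> 0 \<and> short n (psi q x)"] that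
    by (auto simp: n_def)
  have "n \<noteq> 0"
  proof
    assume "n = 0"
    then have "psi q x = 0" using x(3) by (intro poly_mapping_eqI) (auto simp: short_def)
    with x(2) show False ..
  qed
  then obtain m where m: "n = Suc m" by (cases n) auto
  have psi_dI: "psi q (dI q a x) = scale (1 - q\<^sup>2) (strip a (psi q x) - stripr (other a) (Ktwist q a (psi q x)))" for a
    by (simp add: dI_def psi_rder Ktwist_psi strip_psi)
  have "psi q (dI q a x) = 0" for a
  proof (rule min)
    show "dI q a x \<in> P" using P(3) x(1) .
    show "short m (psi q (dI q a x))"
      unfolding psi_dI using x(3)
      by (intro short_scale short_diff) (auto simp: short_def m lookup_strip lookup_stripr lookup_Ktwist)
  qed (simp add: m)
  moreover have "1 - q\<^sup>2 \<noteq> 0" using q_nonroot[of 2] by simp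
  ultimately have "psi q x = scale (eps (psi q x)) 1"
    by (intro annihilated_constant) (simp add: psi_dI)
  then have c: "psi q x = scale (eps x) 1" by simp
  then have "eps x \<noteq> 0" using x(2) by auto
  then have "psi q (1 - scale (inverse (eps x)) x) = 0" by (simp add: c)
  then have "1 - scale (inverse (eps x)) x \<in> P" using P(2) unfolding psi_eq_0_iff by blast
  from free.subspace_add[OF P(1) this free.subspace_scale[OF P(1) x(1), of "inverse (eps x)"]]
  show False using \<open>1 \<notin> P\<close> by simp
qed

end

section \<open>Evaluation at four operators\<close>

lemma mod4_cases: "(i::4) = 0 \<or> i = 1 \<or> i = 2 \<or> i = 3"
proof (induct i)
  case (of_int z)
  then have "z = 0 \<or> z = 1 \<or> z = 2 \<or> z = 3" by simp arith
  then show ?case by auto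
qed

lemma all_mod4: "(\<forall>i::4. P i) \<longleftrightarrow> P 0 \<and> P 1 \<and> P 2 \<and> P 3"
  using mod4_cases by metis

text \<open>The counterpart of \<open>eval_ops\<close> in the free algebra, before any quotient is
  taken.\<close>

definition ev :: "(4 \<Rightarrow> 'f::field free2 \<Rightarrow> 'f free2) \<Rightarrow> (4, 'f) free \<Rightarrow> 'f free2 \<Rightarrow> 'f free2" where
  "ev T p v = ext (\<lambda>w. foldr T w v) p"

lemma lin_ev: "lin (\<lambda>p. ev T p v)"
  by (simp add: ev_def)

lemmas ev_simps [simp] = lin_ev[THEN lin_add] lin_ev[THEN lin_scale] lin_ev[THEN lin_zero] lin_ev[THEN lin_diff]

lemma ev_word [simp]: "ev T (word w) v = foldr T w v"
  by (simp add: ev_def)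

lemma ev_one [simp]: "ev T 1 v = v"
  using ev_word[of T "[]" v] by (simp add: word_Nil)

lemma ev_gen_single [simp]: "ev T (gen i) v = T i v"
  by (simp add: gen_eq_word)

lemma lin_foldr: "(\<And>i. lin (T i)) \<Longrightarrow> lin (foldr T w)"
proof (induction w)
  case (Cons i w)
  then show ?case using lin_comp[of "T i" "foldr T w"] by (simp add: comp_def)
qed (simp add: id_def)

lemma ev_mult:
  assumes "\<And>i. lin (T i)"
  shows "ev T (p * r) v = ev T p (ev T r v)"
proof -
  have "ev T (word w * r) v = foldr T w (ev T r v)" for w
    by (induction r rule: free_induct)
      (simp_all add: distrib_left word_mult lin_add[OF lin_foldr[OF assms]] lin_scale[OF lin_foldr[OF assms]]
        lin_zero[OF lin_foldr[OF assms]])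
  then show ?thesis
    by (induction p rule: free_induct) (simp_all add: distrib_right)
qed

section \<open>Modules I and II as representations modulo \<open>J\<close>\<close>

definition opI :: "'f::field \<Rightarrow> 4 \<Rightarrow> 'f free2 \<Rightarrow> 'f free2" where
  "opI q = box_ops ((*) (gen LA)) (dI q LA) ((*) (gen LB)) (dI q LB)"

definition opII :: "'f::field \<Rightarrow> 4 \<Rightarrow> 'f free2 \<Rightarrow> 'f free2" where
  "opII q = box_ops (mII q LA) (lder q LA) (mII q LB) (lder q LB)"

lemma box_ops_simps [simp]: "box_ops a b c d 0 = a" "box_ops a b c d 1 = b" "box_ops a b c d 2 = c"
  "box_ops a b c d 3 = d" "box_ops a b c d 4 = a" "box_ops a b c d 5 = b"
  by (simp_all add: box_ops_def)

lemma lin_opI: "lin (opI q i)"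
  using mod4_cases[of i] by (auto simp: opI_def lin_dI intro: lin_mult_left[OF lin_id])

lemma lin_opII: "lin (opII q i)"
  using mod4_cases[of i] by (auto simp: opII_def lin_mII lin_ops)

text \<open>The quadratic relations, solved for x_(i+1) x_i, are demanded exactly in the free
  algebra; the cubic ones only modulo \<open>J\<close>.\<close>

definition box_rep :: "'f::field \<Rightarrow> (4 \<Rightarrow> 'f free2 \<Rightarrow> 'f free2) \<Rightarrow> bool" where
  "box_rep q T \<longleftrightarrow> (\<forall>i. lin (T i)) \<and> (\<forall>i. \<forall>x\<in>J q. T i x \<in> J q) \<and>
     (\<forall>i v. T (i + 1) (T i v) = scale (1 - q\<^sup>2) v + scale (q\<^sup>2) (T i (T (i + 1) v))) \<and>
     (\<forall>i v. sop q (T i) (T (i + 2)) v \<in> J q)"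

lemma ideal_box: "ideal (box_ideal q) free_ring"
  unfolding box_ideal_def by (rule Idl_ideal)

lemmas box_rules = free_ideal[OF ideal_box]

definition qrel :: "'f::field \<Rightarrow> 4 \<Rightarrow> (4, 'f) free" where
  "qrel q i = scale (inverse (q - inverse q))
     (scale q (gen i * gen (i + 1)) - scale (inverse q) (gen (i + 1) * gen i)) - 1"

lemma box_relators_eq: "box_relators q = range (qrel q) \<union> range (\<lambda>i. serre q (gen i) (gen (i + 2)))"
  by (simp add: box_relators_def qrel_def)

lemma qrel_box: "qrel q i \<in> box_ideal q" and serre_box: "serre q (gen i) (gen (i + 2)) \<in> box_ideal q"
  unfolding box_ideal_def box_relators_eq by (rule subsetD[OF Idl_self]; blast)+

context qparam begin

lemma J_foldr: "box_rep q T \<Longrightarrow> x \<in> J q \<Longrightarrow> foldr T w x \<in> J q"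
  by (induction w) (auto simp: box_rep_def)

lemma J_ev: "box_rep q T \<Longrightarrow> x \<in> J q \<Longrightarrow> ev T p x \<in> J q"
  unfolding ev_def ext_def by (intro ideal_sum[OF ideal_J] J_rules(5) J_foldr)

text \<open>A rewriting rule that moves the higher index to the right, with the error kept as an
  explicit multiple of the relator.\<close>

lemma qrel_eq: "gen (i + 1) * gen i = scale (1 - q\<^sup>2) 1 + scale (q\<^sup>2) (gen i * gen (i + 1))
    - scale (q * (q - inverse q)) (qrel q i)"
  using q_minus_inverse
  by (intro poly_mapping_eqI)
    (simp add: qrel_def lookup_add lookup_minus right_diff_distrib power2_eq_square,
     simp add: field_simps)

lemma ev_box_ideal:
  assumes T: "box_rep q T" and "p \<in> box_ideal q"
  shows "ev T p v \<in> J q"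
proof -
  have lin: "\<And>i. lin (T i)" using T by (simp add: box_rep_def)
  have "ideal {p. \<forall>v. ev T p v \<in> J q} free_ring"
    unfolding ideal_type_algebra_iff
    by (auto simp: ev_mult[OF lin] J_rules J_ev[OF T])
  moreover have "ev T (qrel q i) v \<in> J q" for i v
  proof -
    have "ev T (gen (i + 1) * gen i) v = scale (1 - q\<^sup>2) v + scale (q\<^sup>2) (ev T (gen i * gen (i + 1)) v)"
      using T by (simp add: box_rep_def ev_mult[OF lin])
    then have "scale (q * (q - inverse q)) (ev T (qrel q i) v) = 0"
      unfolding qrel_eq by (simp del: free.scale_eq_0_iff)
    then show ?thesis using q_minus_inverse by (simp add: J_rules)
  qed
  moreover have "ev T (serre q (gen i) (gen (i + 2))) v \<in> J q" for i v
  proof -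
    have "ev T (serre q (gen i) (gen (i + 2))) v = sop q (T i) (T (i + 2)) v"
      by (simp add: serre_expand sop_def ev_mult[OF lin])
    then show ?thesis using T by (simp add: box_rep_def)
  qed
  ultimately have "box_ideal q \<subseteq> {p. \<forall>v. ev T p v \<in> J q}"
    unfolding box_ideal_def box_relators_eq by (intro Idl_minimal) auto
  with assms(2) show ?thesis by blast
qed

lemma J_dI: "x \<in> J q \<Longrightarrow> dI q a x \<in> J q"
  unfolding dI_def by (intro J_rules(5) J_rules(7) J_lder J_rder J_Ktwist)

lemma J_mII: "x \<in> J q \<Longrightarrow> mII q a x \<in> J q"
  unfolding mII_def by (intro J_rules(5) J_rules(7) J_Ktwist J_rules(3,4))

lemma box_rep_opI: "box_rep q (opI q)"
  unfolding box_rep_def all_mod4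
  using dI_gen[of LA] dI_gen[of LB] gen_dI[of LA] gen_dI[of LB] sop_dI[of LA] sop_dI[of LB]
  by (auto simp: lin_opI)
    (auto simp: opI_def J_rules J_dI serre_mult[symmetric] serre_J[of q LA, simplified] serre_J[of q LB, simplified])

lemma box_rep_opII: "box_rep q (opII q)"
  unfolding box_rep_def all_mod4
  using lder_mII[of LA] lder_mII[of LB] mII_lder[of LA] mII_lder[of LB] sop_mII[of LA] sop_mII[of LB]
    sop_lder[of LA] sop_lder[of LB]
  by (auto simp: lin_opII) (auto simp: opII_def J_rules J_mII J_lder)

end

section \<open>Cyclic modules\<close>

definition idx :: "letter \<Rightarrow> 4" where
  "idx a = (case a of LA \<Rightarrow> 0 | LB \<Rightarrow> 2)"

lemma idx_other: "idx (other a) = idx a + 1 + 1"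
  by (cases a) (simp_all add: idx_def)

definition iota :: "'f::field free2 \<Rightarrow> (4, 'f) free" where
  "iota = ext (\<lambda>w. word (map idx w))"

lemma lin_iota: "lin iota"
  by (simp add: iota_def)

lemmas iota_simps [simp] = lin_iota[THEN lin_add] lin_iota[THEN lin_scale] lin_iota[THEN lin_zero]
  lin_iota[THEN lin_diff]

lemma iota_word [simp]: "iota (word w) = word (map idx w)"
  by (simp add: iota_def)

lemma iota_mult [simp]: "iota (x * y) = iota x * iota y"
  unfolding iota_def by (rule ext_mult) (simp_all add: word_Nil word_mult)

lemma iota_gen [simp]: "iota (gen a) = gen (idx a)"
  by (simp add: gen_eq_word)

lemma iota_one [simp]: "iota 1 = 1"
  by (simp flip: word_Nil)

context qparam begin

lemma iota_J: "x \<in> J q \<Longrightarrow> iota x \<in> box_ideal q"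
proof (induction x rule: J_induct)
  case (serre b)
  have "iota (serre q (gen b) (gen (other b))) = serre q (gen (idx b)) (gen (idx b + 2))"
    by (simp add: serre_expand idx_other add.assoc)
  then show ?case by (simp only: serre_box)
qed (simp_all add: box_rules)

text \<open>In module I the generators x_0 and x_2 are left multiplications, so they rebuild any
  element from 1.\<close>

lemma ev_opI_iota: "ev (opI q) (iota v) 1 = v"
proof -
  have "foldr (opI q) (map idx w) 1 = word w" for w
  proof (induction w)
    case (Cons a w)
    then show ?case by (cases a) (simp_all add: idx_def opI_def gen_word)
  qed (simp add: word_Nil)
  then show ?thesis
    by (induction v rule: free_induct) simp_all
qed

text \<open>
  The vector space of the free algebra modulo a left ideal \<open>L\<close> is a cyclic module; moving \<open>x\<^sub>1\<close>
  and \<open>x\<^sub>3\<close> to the right shows that it is a quotient of module I, which is irreducible.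
\<close>

lemma cyclic_annihilator:
  assumes L: "free.subspace L" and left: "\<And>x r. x \<in> L \<Longrightarrow> r * x \<in> L" and box: "box_ideal q \<subseteq> L"
    and gen: "gen 1 \<in> L" "gen 3 \<in> L" and one: "1 \<notin> L"
  shows "p \<in> L \<longleftrightarrow> ev (opI q) p 1 \<in> J q"
proof -
  note L_rules = free.subspace_add[OF L] free.subspace_diff[OF L] free.subspace_scale[OF L] left
  have unscale: "x \<in> L" if "scale c x \<in> L" "c \<noteq> 0" for x c
    using free.subspace_scale[OF L that(1), of "inverse c"] that(2) by simp
  \<comment> \<open>Modulo \<open>L\<close> the odd generator next to \<open>idx a\<close> acts on
    polynomials in x_0, x_2 as \<open>dI q a\<close> does. At the empty word this is the hypothesis
    that x_1 and x_3 lie in \<open>L\<close>.\<close>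
  have lower: "gen (idx a + 1) * iota v - iota (dI q a v) \<in> L" for a v
  proof -
    let ?j = "idx a + 1"
    let ?k = "q * (q - inverse q)"
    have "gen ?j * iota (word w) - iota (dI q a (word w)) \<in> L" for w
    proof (induction w)
      case Nil
      have "gen ?j \<in> L" using gen by (cases a) (simp_all add: idx_def)
      then show ?case by (simp add: word_Nil dI_def)
    next
      case (Cons c w)
      let ?y = "iota (word w)"
      have qL: "qrel q i * ?y \<in> L" for i
        using box_rules(4)[OF qrel_box] box by blast
      have "gen ?j * iota (gen c * word w) - iota (dI q a (gen c * word w)) \<in> L"
      proof (cases "c = a")
        case True
        have "gen ?j * iota (gen c * word w) = (gen ?j * gen (idx a)) * ?y"
          by (simp only: True iota_mult iota_gen mult.assoc)
        also have "\<dots> = scale (1 - q\<^sup>2) ?y + scale (q\<^sup>2) (gen (idx a) * (gen ?j * ?y)) - scale ?k (qrel q (idx a) * ?y)"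
          unfolding qrel_eq by (simp add: distrib_right left_diff_distrib mult.assoc del: iota_word)
        finally have "gen ?j * iota (gen c * word w) - iota (dI q a (gen c * word w)) =
          scale (q\<^sup>2) (gen (idx a) * (gen ?j * ?y - iota (dI q a (word w)))) - scale ?k (qrel q (idx a) * ?y)"
          by (simp add: True dI_gen right_diff_distrib del: iota_word)
        then show ?thesis using Cons qL by (simp only: L_rules)
      next
        \<comment> \<open>The relation now carries q^2 at the product in question, so the claim is
          shown after multiplication by q^2, which \<open>unscale\<close> removes.\<close>
        case False
        then have c: "c = other a" using letter_cases by blast
        have swap: "s = g - x + k" if "g = x + s - k" for g k s x :: "(4, 'f) free"
          using that by simp
        have cancel: "(g - x + k) - (h - x) = (g - h) + k" for g h k x :: "(4, 'f) free"
          by simp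
        have "gen (?j + 1) * (gen ?j * ?y) = (gen (?j + 1) * gen ?j) * ?y"
          by (simp only: mult.assoc)
        also have "\<dots> = scale (1 - q\<^sup>2) ?y + scale (q\<^sup>2) (gen ?j * (gen (?j + 1) * ?y)) - scale ?k (qrel q ?j * ?y)"
          unfolding qrel_eq by (simp add: distrib_right left_diff_distrib mult.assoc del: iota_word)
        finally have 1: "scale (q\<^sup>2) (gen ?j * (gen (?j + 1) * ?y)) =
            gen (?j + 1) * (gen ?j * ?y) - scale (1 - q\<^sup>2) ?y + scale ?k (qrel q ?j * ?y)"
          by (rule swap)
        have 2: "scale (q\<^sup>2) (iota (dI q a (gen c * word w))) = gen (?j + 1) * iota (dI q a (word w)) - scale (1 - q\<^sup>2) ?y"
          using arg_cong[OF gen_dI[of a "word w"], of iota] by (simp add: c idx_other del: iota_word)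
        have "scale (q\<^sup>2) (gen ?j * iota (gen c * word w) - iota (dI q a (gen c * word w))) =
          gen (?j + 1) * (gen ?j * ?y - iota (dI q a (word w))) + scale ?k (qrel q ?j * ?y)"
          unfolding free.scale_right_diff_distrib 2
          by (simp only: iota_mult iota_gen c idx_other 1 right_diff_distrib cancel)
        moreover have "\<dots> \<in> L"
          by (rule L_rules(1)[OF left[OF Cons] L_rules(3)[OF qL]])
        ultimately have "scale (q\<^sup>2) (gen ?j * iota (gen c * word w) - iota (dI q a (gen c * word w))) \<in> L"
          by (simp only:)
        then show ?thesis by (rule unscale) simp
      qed
      then show ?case by (simp only: gen_word)
    qed
    then have *: "gen ?j * iota (scale 1 (word w)) - iota (dI q a (scale 1 (word w))) \<in> L" for w by simp
    show ?thesis
    proof (induction v rule: free_induct)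
      case zero
      then show ?case by (simp add: lin_zero[OF lin_dI] free.subspace_0[OF L])
    next
      case (add x y)
      from L_rules(1)[OF add] show ?case by (simp add: lin_add[OF lin_dI] distrib_left algebra_simps)
    next
      case (word c w)
      from L_rules(3)[OF *[of w], of c] show ?case by (simp add: lin_scale[OF lin_dI])
    qed
  qed
  have act: "gen i * iota v - iota (opI q i v) \<in> L" for i v
    using mod4_cases[of i] lower[of LA v] lower[of LB v] free.subspace_0[OF L]
    by (auto simp: opI_def idx_def)
  \<comment> \<open>Modulo \<open>L\<close>, every element equals the polynomial in x_0, x_2
    obtained by letting it act on 1 in module I.\<close>
  have red: "p - iota (ev (opI q) p 1) \<in> L" for p
  proof -
    have "word w - iota (ev (opI q) (word w) 1) \<in> L" for w
    proof (induction w)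
      case Nil
      then show ?case by (simp add: word_Nil free.subspace_0[OF L])
    next
      case (Cons i w)
      let ?v = "ev (opI q) (word w) 1"
      from L_rules(1)[OF left[OF Cons, of "gen i"] act[of i ?v]]
      have "gen i * word w - iota (opI q i ?v) \<in> L" by (simp add: right_diff_distrib)
      then show ?case by (simp add: gen_word)
    qed
    then have *: "scale 1 (word w) - iota (ev (opI q) (scale 1 (word w)) 1) \<in> L" for w by simp
    show ?thesis
    proof (induction p rule: free_induct)
      case zero
      then show ?case by (simp add: free.subspace_0[OF L])
    next
      case (add x y)
      from L_rules(1)[OF add] show ?case by (simp add: algebra_simps)
    next
      case (word c w)
      from L_rules(3)[OF *[of w], of c] show ?case by simp
    qed
  qed
  \<comment> \<open>The preimage of \<open>L\<close> is stable under x_1 and x_3 by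
    \<open>lower\<close> and omits 1, so irreducibility makes it exactly \<open>J\<close>.\<close>
  define P where "P = {v. iota v \<in> L}"
  have "P = J q"
  proof (rule dI_irreducible)
    show "free.subspace P"
      by (rule free.subspaceI) (simp_all add: P_def free.subspace_0[OF L] L_rules)
    show "J q \<subseteq> P" using iota_J box by (auto simp: P_def)
    show "1 \<notin> P" by (simp add: P_def one)
    fix a x assume "x \<in> P"
    then have "gen (idx a + 1) * iota x \<in> L" by (simp add: P_def left)
    from L_rules(2)[OF this lower[of a x]] show "dI q a x \<in> P" by (simp add: P_def)
  qed
  have "p \<in> L \<longleftrightarrow> iota (ev (opI q) p 1) \<in> L"
    using L_rules(2)[OF _ red[of p], of p] L_rules(1)[OF red[of p], of "iota (ev (opI q) p 1)"] by auto
  with \<open>P = J q\<close> show ?thesis by (auto simp: P_def)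
qed

text \<open>The annihilator of 1 in module II meets the conditions of
  \<open>cyclic_annihilator\<close>, so 1 generates a copy of module I there.\<close>

lemma opII_annihilator: "ev (opII q) p 1 \<in> J q \<longleftrightarrow> ev (opI q) p 1 \<in> J q"
proof -
  have "p \<in> {p. ev (opII q) p 1 \<in> J q} \<longleftrightarrow> ev (opI q) p 1 \<in> J q"
  proof (rule cyclic_annihilator)
    show "free.subspace {p. ev (opII q) p 1 \<in> J q}"
      by (rule free.subspaceI) (simp_all add: J_rules)
    show "box_ideal q \<subseteq> {p. ev (opII q) p 1 \<in> J q}"
      using ev_box_ideal[OF box_rep_opII] by blast
    show "x \<in> {p. ev (opII q) p 1 \<in> J q} \<Longrightarrow> r * x \<in> {p. ev (opII q) p 1 \<in> J q}" for x r
      by (simp add: ev_mult[OF lin_opII] J_ev[OF box_rep_opII])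
  qed (simp_all add: opII_def J_rules one_notin_J)
  then show ?thesis by simp
qed

lemma opII_cyclic: "\<exists>p. v - ev (opII q) p 1 \<in> J q"
proof -
  define S where "S = {v. \<exists>p. v - ev (opII q) p 1 \<in> J q}"
  have S: "free.subspace S"
  proof (rule free.subspaceI)
    have "0 - ev (opII q) 0 1 \<in> J q" by (simp add: J_rules)
    then show "0 \<in> S" unfolding S_def by blast
  next
    fix x y assume "x \<in> S" "y \<in> S"
    then obtain p r where "x - ev (opII q) p 1 \<in> J q" "y - ev (opII q) r 1 \<in> J q"
      by (auto simp: S_def)
    from J_rules(2)[OF this] have "(x + y) - ev (opII q) (p + r) 1 \<in> J q"
      by (simp add: algebra_simps)
    then show "x + y \<in> S" unfolding S_def by blast
  next
    fix c x assume "x \<in> S"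
    then obtain p where "x - ev (opII q) p 1 \<in> J q" by (auto simp: S_def)
    from J_rules(5)[OF this, of c] have "scale c x - ev (opII q) (scale c p) 1 \<in> J q" by simp
    then show "scale c x \<in> S" unfolding S_def by blast
  qed
  have op: "opII q i x \<in> S" if "x \<in> S" for i x
  proof -
    from that obtain p where "x - ev (opII q) p 1 \<in> J q" by (auto simp: S_def)
    then have "opII q i (x - ev (opII q) p 1) \<in> J q" using box_rep_opII by (simp add: box_rep_def)
    then have "opII q i x - ev (opII q) (gen i * p) 1 \<in> J q"
      by (simp add: lin_diff[OF lin_opII] ev_mult[OF lin_opII])
    then show ?thesis unfolding S_def by blast
  qed
  have mII: "mII q a x \<in> S" if "x \<in> S" for a x
    using op[OF that, of 0] op[OF that, of 2] by (cases a) (simp_all add: opII_def)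
  have Q: "1 - q\<^sup>2 \<noteq> 0" using q_nonroot[of 2] by simp
  have word: "(word w :: 'f free2) \<in> S" if "length w = n" for w n
    using that
  proof (induction n arbitrary: w)
    case 0
    have "1 - ev (opII q) 1 1 \<in> J q" by (simp add: J_rules)
    then have "1 \<in> S" unfolding S_def by blast
    with 0 show ?case by (simp add: word_Nil)
  next
    case (Suc n)
    show ?case
    proof (rule rotation_span[OF S _ Suc.prems])
      fix a and v :: "letter list" assume "length v = n"
      \<comment> \<open>Up to the factor 1 - q^2, applying x_0 and x_2 to words of length n produces
        the rotation relations in length n + 1.\<close>
      from free.subspace_scale[OF S mII[OF Suc.IH[OF this]], of "inverse (1 - q\<^sup>2)" a] Q
      show "word (a # v) - Ktwist q a (word (v @ [other a])) \<in> S"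
        by (simp add: mII_def gen_word word_gen mult.assoc[symmetric])
    qed
  qed
  have "v \<in> S"
    by (induction v rule: free_induct)
      (use word free.subspace_0[OF S] free.subspace_add[OF S] free.subspace_scale[OF S] in auto)
  then show ?thesis by (simp add: S_def)
qed

end

section \<open>Quotients\<close>

lemma
  fixes I :: "('x, 'f::field) free set"
  assumes I: "ideal I free_ring"
  shows coset_eq_iff: "I +>\<^bsub>free_ring\<^esub> x = I +>\<^bsub>free_ring\<^esub> y \<longleftrightarrow> x - y \<in> I"
    and quot_carrier: "carrier (quot_alg I) = range (\<lambda>x. I +>\<^bsub>free_ring\<^esub> x)"
    and quot_zero: "\<zero>\<^bsub>quot_alg I\<^esub> = I +>\<^bsub>free_ring\<^esub> 0"
    and quot_one: "\<one>\<^bsub>quot_alg I\<^esub> = I +>\<^bsub>free_ring\<^esub> 1"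
    and quot_add: "(I +>\<^bsub>free_ring\<^esub> x) \<oplus>\<^bsub>quot_alg I\<^esub> (I +>\<^bsub>free_ring\<^esub> y) = I +>\<^bsub>free_ring\<^esub> (x + y)"
    and quot_mult: "(I +>\<^bsub>free_ring\<^esub> x) \<otimes>\<^bsub>quot_alg I\<^esub> (I +>\<^bsub>free_ring\<^esub> y) = I +>\<^bsub>free_ring\<^esub> (x * y)"
    and quot_smult: "c \<odot>\<^bsub>quot_alg I\<^esub> (I +>\<^bsub>free_ring\<^esub> x) = I +>\<^bsub>free_ring\<^esub> (scale c x)"
    and map_quot_coset: "(\<And>x y. F (x + y) = F x + F y) \<Longrightarrow> (\<And>x. x \<in> I \<Longrightarrow> F x \<in> I) \<Longrightarrow>
      map_quot I F (I +>\<^bsub>free_ring\<^esub> x) = I +>\<^bsub>free_ring\<^esub> F x"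
    and image_coset: "(\<And>y. y \<in> I \<Longrightarrow> G (y + x) = G x) \<Longrightarrow> the_elem (G ` (I +>\<^bsub>free_ring\<^esub> x)) = G x"
proof -
  interpret ideal I "free_ring :: ('x, 'f) free ring" by (rule I)
  note I_rules = free_ideal[OF I]
  show eq: "I +>\<^bsub>free_ring\<^esub> x = I +>\<^bsub>free_ring\<^esub> y \<longleftrightarrow> x - y \<in> I" for x y
  proof
    assume "I +>\<^bsub>free_ring\<^esub> x = I +>\<^bsub>free_ring\<^esub> y"
    moreover have "x \<in> I +>\<^bsub>free_ring\<^esub> x" using I_rules(1) by (force simp: coset_eq)
    ultimately show "x - y \<in> I" by (auto simp: coset_eq)
  next
    have sub: "I +>\<^bsub>free_ring\<^esub> x \<subseteq> I +>\<^bsub>free_ring\<^esub> y" if "x - y \<in> I" for x y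
    proof
      fix z assume "z \<in> I +>\<^bsub>free_ring\<^esub> x"
      then obtain i where "i \<in> I" "z = i + x" by (auto simp: coset_eq)
      then have "i + (x - y) \<in> I" "z = (i + (x - y)) + y" using that I_rules(2) by simp_all
      then show "z \<in> I +>\<^bsub>free_ring\<^esub> y" unfolding coset_eq by blast
    qed
    assume "x - y \<in> I"
    then show "I +>\<^bsub>free_ring\<^esub> x = I +>\<^bsub>free_ring\<^esub> y"
      using sub[of x y] sub[of y x] I_rules(6)[of "x - y"] by auto
  qed
  show image: "the_elem (G ` (I +>\<^bsub>free_ring\<^esub> x)) = G x"
    if "\<And>y. y \<in> I \<Longrightarrow> G (y + x) = G x" for G :: "('x, 'f) free \<Rightarrow> 'z" and x
  proof -
    have "G ` (I +>\<^bsub>free_ring\<^esub> x) = {G x}"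
      using that I_rules(1) by (force simp: coset_eq)
    then show ?thesis by simp
  qed
  show map: "map_quot I F (I +>\<^bsub>free_ring\<^esub> x) = I +>\<^bsub>free_ring\<^esub> F x"
    if "\<And>x y. F (x + y) = F x + F y" "\<And>x. x \<in> I \<Longrightarrow> F x \<in> I" for F x
    unfolding map_quot_def by (rule image) (simp add: that eq)
  show "carrier (quot_alg I) = range (\<lambda>x. I +>\<^bsub>free_ring\<^esub> x)"
    by (auto simp: quot_alg_def ring.defs module.defs FactRing_def A_RCOSETS_def')
  show "\<zero>\<^bsub>quot_alg I\<^esub> = I +>\<^bsub>free_ring\<^esub> 0"
    using a_coset_add_zero[OF a_subset] by (simp add: quot_alg_def ring.defs module.defs FactRing_def)
  show "\<one>\<^bsub>quot_alg I\<^esub> = I +>\<^bsub>free_ring\<^esub> 1"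
    by (simp add: quot_alg_def ring.defs module.defs FactRing_def)
  show "(I +>\<^bsub>free_ring\<^esub> x) \<oplus>\<^bsub>quot_alg I\<^esub> (I +>\<^bsub>free_ring\<^esub> y) = I +>\<^bsub>free_ring\<^esub> (x + y)"
    using a_rcos_sum[of x y] by (simp add: quot_alg_def ring.defs module.defs FactRing_def)
  show "(I +>\<^bsub>free_ring\<^esub> x) \<otimes>\<^bsub>quot_alg I\<^esub> (I +>\<^bsub>free_ring\<^esub> y) = I +>\<^bsub>free_ring\<^esub> (x * y)"
    using rcoset_mult_add[of x y] by (simp add: quot_alg_def ring.defs module.defs FactRing_def)
  show "c \<odot>\<^bsub>quot_alg I\<^esub> (I +>\<^bsub>free_ring\<^esub> x) = I +>\<^bsub>free_ring\<^esub> (scale c x)"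
    by (simp add: quot_alg_def ring.defs module.defs map I_rules)
qed

section \<open>Presentations of modules\<close>

text \<open>
  All sixteen modules are images of the free algebra under a map with kernel \<open>J\<close> that turns
  the operators of module I or of module II into the given ones.
\<close>

definition presents :: "'f::field \<Rightarrow> ('f, 'w) module \<Rightarrow> (4 \<Rightarrow> 'w \<Rightarrow> 'w) \<Rightarrow> ('f free2 \<Rightarrow> 'w) \<Rightarrow>
    (4 \<Rightarrow> 'f free2 \<Rightarrow> 'f free2) \<Rightarrow> bool" where
  "presents q W T p Th \<longleftrightarrow> carrier W = range p \<and> \<zero>\<^bsub>W\<^esub> = p 0 \<and>
     (\<forall>x y. p x \<oplus>\<^bsub>W\<^esub> p y = p (x + y)) \<and> (\<forall>c x. c \<odot>\<^bsub>W\<^esub> p x = p (scale c x)) \<and>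
     (\<forall>i x. T i (p x) = p (Th i x)) \<and> (\<forall>x y. p x = p y \<longleftrightarrow> x - y \<in> J q)"

lemma presents_finsum:
  assumes "presents q W T p Th" "finite A"
  shows "finsum W (\<lambda>a. p (g a)) A = p (sum g A)"
proof -
  note W = assms(1)[unfolded presents_def]
  interpret abelian_monoid W
    by (rule abelian_monoidI) (use W in \<open>auto simp: add_ac\<close>)
  show ?thesis
    using assms(2)
  proof (induction A)
    case empty
    show ?case using W by simp
  next
    case (insert a A)
    have "finsum W (\<lambda>a. p (g a)) (insert a A) = p (g a) \<oplus>\<^bsub>W\<^esub> finsum W (\<lambda>a. p (g a)) A"
      using W by (intro finsum_insert insert) auto
    then show ?case using W insert by simp
  qed
qed

lemma presents_eval:
  assumes "presents q W T p Th"
  shows "eval_ops W T r (p v) = p (ev Th r v)"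
proof -
  have "foldr T w (p v) = p (foldr Th w v)" for w
    using assms by (induction w) (simp_all add: presents_def)
  moreover have "c \<odot>\<^bsub>W\<^esub> p x = p (scale c x)" for c x
    using assms by (simp add: presents_def)
  ultimately show ?thesis
    by (simp add: eval_ops_def presents_finsum[OF assms] ev_def ext_def)
qed

lemma box_mod_of_simps:
  "carrier (box_mod_of W T) = carrier W" "\<zero>\<^bsub>box_mod_of W T\<^esub> = \<zero>\<^bsub>W\<^esub>"
  "add (box_mod_of W T) = add W" "module.smult (box_mod_of W T) = module.smult W"
  "act (box_mod_of W T) a v = the_elem ((\<lambda>p. eval_ops W T p v) ` a)"
  by (simp_all add: box_mod_of_def module.defs box_mod.defs)

context qparam begin

lemma presents_act:
  assumes "presents q W T p Th" "box_rep q Th"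
  shows "act (box_mod_of W T) (box_ideal q +>\<^bsub>free_ring\<^esub> r) (p v) = p (ev Th r v)"
proof -
  have "the_elem ((\<lambda>r. p (ev Th r v)) ` (box_ideal q +>\<^bsub>free_ring\<^esub> r)) = p (ev Th r v)"
    by (rule image_coset[OF ideal_box])
      (use assms(1) ev_box_ideal[OF assms(2)] in \<open>simp add: presents_def\<close>)
  then show ?thesis
    by (simp add: box_mod_of_simps presents_eval[OF assms(1)])
qed

lemma presents_quot:
  assumes Th: "box_rep q Th" and s: "lin s" "surj s" "\<And>x. s x \<in> J q \<longleftrightarrow> x \<in> J q"
    and T: "\<And>i x. T i (s x) = s (Th i x)"
  shows "presents q (quot_alg (J q)) (\<lambda>i. map_quot (J q) (T i)) (\<lambda>x. J q +>\<^bsub>free_ring\<^esub> s x) Th"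
proof -
  \<comment> \<open>\<open>T\<close> is known only on values of \<open>s\<close>; surjectivity of
    \<open>s\<close> transfers additivity and, below, invariance of \<open>J\<close> from
    \<open>Th\<close>.\<close>
  have add: "T i (x + y) = T i x + T i y" for i x y
  proof -
    obtain a b where ab: "x = s a" "y = s b" using s(2) by (meson surjD)
    have "T i (s (a + b)) = T i (s a) + T i (s b)"
      unfolding T using Th by (simp add: box_rep_def lin_add lin_add[OF s(1)])
    then show ?thesis by (simp add: ab lin_add[OF s(1)])
  qed
  have J: "T i x \<in> J q" if "x \<in> J q" for i x
  proof -
    obtain a where "x = s a" using s(2) by (meson surjD)
    with that Th s(3) show ?thesis by (auto simp: T box_rep_def)
  qed
  have "range (\<lambda>x. J q +>\<^bsub>free_ring\<^esub> s x) = range (\<lambda>x. J q +>\<^bsub>free_ring\<^esub> x)"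
    using s(2) by (metis image_image)
  then show ?thesis
    unfolding presents_def
    by (simp add: quot_carrier[OF ideal_J] quot_zero[OF ideal_J] quot_add[OF ideal_J] quot_smult[OF ideal_J]
      map_quot_coset[OF ideal_J add J] coset_eq_iff[OF ideal_J] T s(3) flip: lin_add[OF s(1)] lin_scale[OF s(1)]
      lin_diff[OF s(1)])
      (simp add: lin_zero[OF s(1)] J_rules(1))
qed

lemma presents_U:
  assumes s: "lin s" "surj s" "\<And>x. s x \<in> J q \<longleftrightarrow> x \<in> J q"
    and T: "\<And>i x. T i (psi q (s x)) = psi q (s (Th i x))"
  shows "presents q (U_alg q) T (\<lambda>x. psi q (s x)) Th"
proof -
  have "range (\<lambda>x. psi q (s x)) = range (psi q)"
    using s(2) by (metis image_image)
  moreover have "psi q (s x) = psi q (s y) \<longleftrightarrow> x - y \<in> J q" for x y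
  proof -
    have "psi q (s x) = psi q (s y) \<longleftrightarrow> psi q (s (x - y)) = 0"
      by (simp add: lin_diff[OF s(1)])
    then show ?thesis by (simp only: psi_eq_0_iff s(3))
  qed
  ultimately show ?thesis
    unfolding presents_def by (simp add: U_alg_def U_eq T lin_add[OF s(1)] lin_scale[OF s(1)] lin_zero[OF s(1)])
qed

section \<open>Modules generated by a vector killed by the odd generators\<close>

text \<open>By \<open>cyclic_annihilator\<close> a generator killed by x_1 and x_3 has the same
  annihilator as the class of 1 in the given module; both modules are the algebra modulo this left
  ideal.\<close>

lemma box_iso_iff_generated:
  fixes V :: "('f, 'v) box_mod"
  assumes V: "box_module q V" and pres: "presents q W T p Th" and Th: "box_rep q Th"
    and ann: "\<And>r. ev Th r 1 \<in> J q \<longleftrightarrow> ev (opI q) r 1 \<in> J q"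
    and cyc: "\<And>v. \<exists>r. v - ev Th r 1 \<in> J q"
    and kill: "Th 1 1 \<in> J q" "Th 3 1 \<in> J q"
  shows "box_iso q V (box_mod_of W T) \<longleftrightarrow>
    (\<exists>\<xi>. \<xi> \<noteq> \<zero>\<^bsub>V\<^esub> \<and> generated_by q V \<xi> \<and>
      act V (box_gen q 1) \<xi> = \<zero>\<^bsub>V\<^esub> \<and> act V (box_gen q 3) \<xi> = \<zero>\<^bsub>V\<^esub>)"
proof -
  interpret box_module q V by (rule V)
  let ?M = "box_mod_of W T"
  define E where "E r v = act V (box_ideal q +>\<^bsub>free_ring\<^esub> r) v" for r v
  note box_simps = quot_carrier[OF ideal_box, folded box_alg_def] quot_zero[OF ideal_box, folded box_alg_def]
    quot_one[OF ideal_box, folded box_alg_def] quot_add[OF ideal_box, folded box_alg_def]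
    quot_mult[OF ideal_box, folded box_alg_def] quot_smult[OF ideal_box, folded box_alg_def]
  have box_carrier: "box_ideal q +>\<^bsub>free_ring\<^esub> r \<in> carrier (box_alg q)" for r
    by (simp add: box_simps)
  have E_closed: "E r v \<in> carrier V" if "v \<in> carrier V" for r v
    unfolding E_def by (rule act_closed[OF box_carrier that])
  have E_add: "E (r + t) v = E r v \<oplus>\<^bsub>V\<^esub> E t v" if "v \<in> carrier V" for r t v
    using act_add_left[OF box_carrier box_carrier that] by (simp add: E_def box_simps)
  have E_mult: "E (r * t) v = E r (E t v)" if "v \<in> carrier V" for r t v
    using act_mult[OF box_carrier box_carrier that] by (simp add: E_def box_simps)
  have E_scale: "E (scale c r) v = c \<odot>\<^bsub>V\<^esub> E r v" if "v \<in> carrier V" for c r v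
    using act_smult_left[OF box_carrier that] by (simp add: E_def box_simps)
  have E_one: "E 1 v = v" if "v \<in> carrier V" for v
    using act_one[OF that] by (simp add: E_def box_simps)
  have E_right: "E r \<zero>\<^bsub>V\<^esub> = \<zero>\<^bsub>V\<^esub>" for r
    using act_smult_right[OF box_carrier[of r] M.zero_closed, of 0] E_closed[OF M.zero_closed]
    by (simp add: E_def smult_l_null[simplified])
  have smult0: "0 \<odot>\<^bsub>V\<^esub> v = \<zero>\<^bsub>V\<^esub>" if "v \<in> carrier V" for v
    using smult_l_null[OF that] by simp
  have E_zero: "E 0 v = \<zero>\<^bsub>V\<^esub>" if "v \<in> carrier V" for v
    using E_scale[OF that, of 0 0] smult0[OF E_closed[OF that]] by simp
  have E_ideal: "E r v = \<zero>\<^bsub>V\<^esub>" if "r \<in> box_ideal q" "v \<in> carrier V" for r v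
  proof -
    have "box_ideal q +>\<^bsub>free_ring\<^esub> r = box_ideal q +>\<^bsub>free_ring\<^esub> 0"
      using that(1) by (simp add: coset_eq_iff[OF ideal_box])
    then show ?thesis using E_zero[OF that(2)] by (simp add: E_def)
  qed
  have E_eq_iff: "E r v = E t v \<longleftrightarrow> E (r - t) v = \<zero>\<^bsub>V\<^esub>" if "v \<in> carrier V" for r t v
  proof -
    have "E r v = E (r - t) v \<oplus>\<^bsub>V\<^esub> E t v"
      using E_add[OF that, of "r - t" t] by simp
    then show ?thesis using E_closed[OF that] by (metis M.add.r_cancel_one')
  qed
  have E_gen: "act V (box_gen q i) v = E (gen i) v" for i v
    by (simp add: E_def box_gen_def)
  note M = pres[unfolded presents_def]
  have M_act: "act ?M (box_ideal q +>\<^bsub>free_ring\<^esub> r) (p v) = p (ev Th r v)" for r v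
    by (rule presents_act[OF pres Th])
  show ?thesis
  proof
    assume "box_iso q V ?M"
    then obtain \<phi> where bij: "bij_betw \<phi> (carrier V) (range p)"
      and add: "\<And>v w. v \<in> carrier V \<Longrightarrow> w \<in> carrier V \<Longrightarrow> \<phi> (v \<oplus>\<^bsub>V\<^esub> w) = \<phi> v \<oplus>\<^bsub>W\<^esub> \<phi> w"
      and act: "\<And>a v. a \<in> carrier (box_alg q) \<Longrightarrow> v \<in> carrier V \<Longrightarrow> \<phi> (act V a v) = act ?M a (\<phi> v)"
      using M by (auto simp: box_iso_def box_mod_of_simps)
    \<comment> \<open>The required generator is the preimage of the class of 1.\<close>
    from bij obtain \<xi> where \<xi>: "\<xi> \<in> carrier V" "\<phi> \<xi> = p 1"
      by (metis bij_betw_imp_surj_on imageE rangeI)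
    have inj: "v = w" if "\<phi> v = \<phi> w" "v \<in> carrier V" "w \<in> carrier V" for v w
      using bij that by (meson bij_betw_imp_inj_on inj_onD)
    have \<phi>_E: "\<phi> (E r \<xi>) = p (ev Th r 1)" for r
      using act[OF box_carrier \<xi>(1), of r] by (simp add: E_def \<xi>(2) M_act)
    have \<phi>_zero: "\<phi> \<zero>\<^bsub>V\<^esub> = p 0"
      using \<phi>_E[of 0] E_zero[OF \<xi>(1)] by simp
    have "\<xi> \<noteq> \<zero>\<^bsub>V\<^esub>"
    proof
      assume "\<xi> = \<zero>\<^bsub>V\<^esub>"
      then have "p 1 = p 0" using \<xi>(2) \<phi>_zero by simp
      then show False using M one_notin_J by simp
    qed
    moreover have "E (gen i) \<xi> = \<zero>\<^bsub>V\<^esub>" if "Th i 1 \<in> J q" for i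
      using \<phi>_E[of "gen i"] M that
      by (intro inj) (simp_all add: \<phi>_zero E_closed \<xi>(1))
    moreover have "generated_by q V \<xi>"
    proof -
      have "N = carrier V" if N: "box_submodule q N V" "\<xi> \<in> N" for N
      proof
        show "N \<subseteq> carrier V"
          using N(1) subgroup.subset[of N "add_monoid V"] by (simp add: box_submodule_def submodule_def)
        show "carrier V \<subseteq> N"
        proof
          fix v assume v: "v \<in> carrier V"
          then obtain z where z: "\<phi> v = p z" using bij by (metis bij_betwE rangeE)
          obtain r where "z - ev Th r 1 \<in> J q" using cyc by blast
          then have "\<phi> v = \<phi> (E r \<xi>)" using M by (simp add: z \<phi>_E)
          then have "v = E r \<xi>" using v E_closed[OF \<xi>(1)] by (rule inj)
          then show "v \<in> N"
            using N box_carrier by (simp add: box_submodule_def E_def)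
        qed
      qed
      then show ?thesis
        using \<xi>(1) \<open>\<xi> \<noteq> \<zero>\<^bsub>V\<^esub>\<close> by (auto simp: generated_by_def)
    qed
    ultimately show "\<exists>\<xi>. \<xi> \<noteq> \<zero>\<^bsub>V\<^esub> \<and> generated_by q V \<xi> \<and>
      act V (box_gen q 1) \<xi> = \<zero>\<^bsub>V\<^esub> \<and> act V (box_gen q 3) \<xi> = \<zero>\<^bsub>V\<^esub>"
      using kill by (auto simp: E_gen)
  next
    assume "\<exists>\<xi>. \<xi> \<noteq> \<zero>\<^bsub>V\<^esub> \<and> generated_by q V \<xi> \<and>
      act V (box_gen q 1) \<xi> = \<zero>\<^bsub>V\<^esub> \<and> act V (box_gen q 3) \<xi> = \<zero>\<^bsub>V\<^esub>"
    then obtain \<xi> where \<xi>: "\<xi> \<noteq> \<zero>\<^bsub>V\<^esub>" "generated_by q V \<xi>" "E (gen 1) \<xi> = \<zero>\<^bsub>V\<^esub>" "E (gen 3) \<xi> = \<zero>\<^bsub>V\<^esub>"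
      by (auto simp: E_gen)
    then have c: "\<xi> \<in> carrier V" by (simp add: generated_by_def)
    have ann_\<xi>: "E r \<xi> = \<zero>\<^bsub>V\<^esub> \<longleftrightarrow> ev Th r 1 \<in> J q" for r
    proof -
      have "r \<in> {r. E r \<xi> = \<zero>\<^bsub>V\<^esub>} \<longleftrightarrow> ev (opI q) r 1 \<in> J q"
      proof (rule cyclic_annihilator)
        show "free.subspace {r. E r \<xi> = \<zero>\<^bsub>V\<^esub>}"
          by (rule free.subspaceI) (simp_all add: E_zero E_add E_scale c smult_r_null[simplified])
        show "x \<in> {r. E r \<xi> = \<zero>\<^bsub>V\<^esub>} \<Longrightarrow> r * x \<in> {r. E r \<xi> = \<zero>\<^bsub>V\<^esub>}" for x r
          by (simp add: E_mult c E_right)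
      qed (use \<xi> E_ideal in \<open>auto simp: E_one c\<close>)
      then show ?thesis by (simp add: ann)
    qed
    have E_eq: "E r \<xi> = E t \<xi> \<longleftrightarrow> p (ev Th r 1) = p (ev Th t 1)" for r t
      using M by (simp add: E_eq_iff[OF c] ann_\<xi>)
    have gen: "carrier V = range (\<lambda>r. E r \<xi>)"
    proof -
      have "box_submodule q (range (\<lambda>r. E r \<xi>)) V"
        unfolding box_submodule_def
      proof (intro conjI ballI)
        show "submodule (range (\<lambda>r. E r \<xi>)) ring_of_type_algebra V"
        proof (rule submoduleI)
          show "\<zero>\<^bsub>V\<^esub> \<in> range (\<lambda>r. E r \<xi>)" using E_zero[OF c] by (metis rangeI)
          show "\<ominus>\<^bsub>V\<^esub> a \<in> range (\<lambda>r. E r \<xi>)" if a: "a \<in> range (\<lambda>r. E r \<xi>)" for a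
          proof -
            obtain r where r: "a = E r \<xi>" using a by blast
            have "E (- r) \<xi> \<oplus>\<^bsub>V\<^esub> a = \<zero>\<^bsub>V\<^esub>"
              using E_add[OF c, of "- r" r] E_zero[OF c] by (simp add: r)
            then have "\<ominus>\<^bsub>V\<^esub> a = E (- r) \<xi>"
              by (intro minus_equality) (simp_all add: r E_closed c)
            then show ?thesis by blast
          qed
        qed (auto simp: E_closed c simp flip: E_add E_scale)
        fix a w assume "a \<in> carrier (box_alg q)" "w \<in> range (\<lambda>r. E r \<xi>)"
        then obtain r t where "a = box_ideal q +>\<^bsub>free_ring\<^esub> r" "w = E t \<xi>" by (auto simp: box_simps)
        then have "act V a w = E (r * t) \<xi>" by (simp add: E_mult[OF c]) (simp add: E_def)
        then show "act V a w \<in> range (\<lambda>r. E r \<xi>)" by blast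
      qed
      moreover have "\<xi> \<in> range (\<lambda>r. E r \<xi>)" using E_one[OF c] by (metis rangeI)
      ultimately show ?thesis using \<xi>(2) by (auto simp: generated_by_def)
    qed
    \<comment> \<open>The choice of \<open>r\<close> is immaterial: by \<open>E_eq\<close> all
      candidates have the same image.\<close>
    define \<phi> where "\<phi> v = p (ev Th (SOME r. v = E r \<xi>) 1)" for v
    have \<phi>: "\<phi> (E r \<xi>) = p (ev Th r 1)" for r
    proof -
      have "E r \<xi> = E (SOME t. E r \<xi> = E t \<xi>) \<xi>" by (rule someI[of _ r]) (rule refl)
      then show ?thesis unfolding \<phi>_def E_eq[symmetric] by simp
    qed
    have "bij_betw \<phi> (carrier V) (carrier ?M)"
    proof (rule bij_betwI')
      show "\<phi> x = \<phi> y \<longleftrightarrow> x = y" if "x \<in> carrier V" "y \<in> carrier V" for x y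
        using that by (auto simp: gen \<phi> E_eq)
      show "\<phi> x \<in> carrier ?M" if "x \<in> carrier V" for x
        using that M by (auto simp: gen \<phi> box_mod_of_simps)
      show "\<exists>x\<in>carrier V. y = \<phi> x" if y: "y \<in> carrier ?M" for y
      proof -
        obtain z where "y = p z" using y M by (auto simp: box_mod_of_simps)
        moreover obtain r where "z - ev Th r 1 \<in> J q" using cyc by blast
        ultimately have "y = \<phi> (E r \<xi>)" using M by (simp add: \<phi>)
        then show ?thesis using E_closed[OF c] by blast
      qed
    qed
    moreover have "\<phi> (E r \<xi> \<oplus>\<^bsub>V\<^esub> E t \<xi>) = \<phi> (E r \<xi>) \<oplus>\<^bsub>W\<^esub> \<phi> (E t \<xi>)" for r t
      unfolding E_add[OF c, symmetric] \<phi> using M by simp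
    moreover have "\<phi> (d \<odot>\<^bsub>V\<^esub> E r \<xi>) = d \<odot>\<^bsub>W\<^esub> \<phi> (E r \<xi>)" for d r
      unfolding E_scale[OF c, symmetric] \<phi> using M by simp
    moreover have "\<phi> (act V (box_ideal q +>\<^bsub>free_ring\<^esub> r) (E t \<xi>)) = act ?M (box_ideal q +>\<^bsub>free_ring\<^esub> r) (\<phi> (E t \<xi>))" for r t
    proof -
      have "\<phi> (E (r * t) \<xi>) = p (ev Th r (ev Th t 1))"
        using Th by (simp add: \<phi> box_rep_def ev_mult)
      then show ?thesis by (simp add: E_mult[OF c] \<phi> M_act) (simp add: E_def)
    qed
    ultimately show "box_iso q V ?M"
      unfolding box_iso_def
      by (intro exI[of _ \<phi>]) (auto simp: gen box_simps box_mod_of_simps)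
  qed
qed

section \<open>The sixteen modules as images of modules I and II\<close>

lemma psi_mult_gen: "shuffle q (psi q x) (gen a) = psi q (x * gen a)"
  by (simp add: psi_mult)

lemma symmetries:
  fixes s :: "'f free2 \<Rightarrow> 'f free2"
  assumes "s \<in> {\<lambda>x. x, reversal, letter_swap, \<lambda>x. reversal (letter_swap x)}"
  shows "lin s" "surj s" "\<And>x. s x \<in> J q \<longleftrightarrow> x \<in> J q"
proof -
  \<comment> \<open>Reversal and the exchange of letters are commuting involutions, so their
    composite is one too.\<close>
  have inv: "s (s x) = x" for x
    using assms by (auto simp: letter_swap_reversal)
  have J: "s x \<in> J q" if "x \<in> J q" for x
    using assms that by (auto simp: J_reversal J_letter_swap)
  show "lin s" using assms by (auto intro: lin_ops lin_comp)
  show "surj s" by (metis inv surjI)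
  show "s x \<in> J q \<longleftrightarrow> x \<in> J q" for x using J[of x] J[of "s x"] by (auto simp: inv)
qed

text \<open>Hides the presentation, whose carrier consists of cosets for the quotient modules and of
  vectors for those on \<open>U\<close>, so that one criterion serves both.\<close>

definition standard :: "('f, 'w) box_mod \<Rightarrow> bool" where
  "standard M \<longleftrightarrow> (\<exists>W T p Th. M = box_mod_of W T \<and> presents q W T p Th \<and> Th \<in> {opI q, opII q})"

lemma standard_iff_generated:
  fixes V :: "('f, 'v) box_mod" and M :: "('f, 'w) box_mod"
  assumes "box_module q V" "standard M"
  shows "box_iso q V M \<longleftrightarrow>
    (\<exists>\<xi>. \<xi> \<noteq> \<zero>\<^bsub>V\<^esub> \<and> generated_by q V \<xi> \<and>
      act V (box_gen q 1) \<xi> = \<zero>\<^bsub>V\<^esub> \<and> act V (box_gen q 3) \<xi> = \<zero>\<^bsub>V\<^esub>)"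
proof -
  from assms(2) obtain W T p and Th :: "4 \<Rightarrow> 'f free2 \<Rightarrow> 'f free2"
    where M: "M = box_mod_of W T" "presents q W T p Th" "Th \<in> {opI q, opII q}"
    unfolding standard_def by blast
  have "v - ev (opI q) (iota v) 1 \<in> J q" for v by (simp add: ev_opI_iota J_rules)
  then have cyc: "\<exists>r. v - ev Th r 1 \<in> J q" for v
    using M(3) opII_cyclic by blast
  have "box_rep q Th" "\<And>r. ev Th r 1 \<in> J q \<longleftrightarrow> ev (opI q) r 1 \<in> J q"
    using M(3) box_rep_opI box_rep_opII opII_annihilator by auto
  moreover have "Th 1 1 \<in> J q" "Th 3 1 \<in> J q"
    using M(3) by (auto simp: opI_def opII_def dI_def J_rules)
  ultimately show ?thesis
    unfolding M(1) by (intro box_iso_iff_generated[OF assms(1) M(2) _ _ cyc])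
qed

lemma standard_quot:
  assumes Th: "Th \<in> {opI q, opII q}" and s: "s \<in> {\<lambda>x. x, reversal, letter_swap, \<lambda>x. reversal (letter_swap x)}"
    and T: "\<And>x. T 0 (s x) = s (Th 0 x)" "\<And>x. T 1 (s x) = s (Th 1 x)"
      "\<And>x. T 2 (s x) = s (Th 2 x)" "\<And>x. T 3 (s x) = s (Th 3 x)"
  shows "standard (VJ_mod q T)"
proof -
  have "T i (s x) = s (Th i x)" for i x using mod4_cases[of i] T by auto
  moreover have "box_rep q Th" using Th box_rep_opI box_rep_opII by auto
  ultimately show ?thesis
    unfolding standard_def VJ_mod_def using presents_quot[OF _ symmetries[OF s]] Th by metis
qed

lemma standard_U:
  assumes Th: "Th \<in> {opI q, opII q}" and s: "s \<in> {\<lambda>x. x, reversal, letter_swap, \<lambda>x. reversal (letter_swap x)}"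
    and T: "\<And>x. T 0 (psi q (s x)) = psi q (s (Th 0 x))" "\<And>x. T 1 (psi q (s x)) = psi q (s (Th 1 x))"
      "\<And>x. T 2 (psi q (s x)) = psi q (s (Th 2 x))" "\<And>x. T 3 (psi q (s x)) = psi q (s (Th 3 x))"
  shows "standard (U_mod q T)"
proof -
  have "T i (psi q (s x)) = psi q (s (Th i x))" for i x using mod4_cases[of i] T by auto
  then show ?thesis
    unfolding standard_def U_mod_def using presents_U[OF symmetries[OF s]] Th by metis
qed

lemmas operator_defs = opI_def opII_def dI_def mII_def Qdiff_def adj_simps Kaut_eq Kinv_eq
  A_L_def B_L_def A_R_def B_R_def A_l_def B_l_def A_r_def B_r_def

lemma standard_I: "standard (VJ_I q)"
  unfolding VJ_I_def
  by (rule standard_quot[of "opI q" "\<lambda>x. x"]; simp add: operator_defs)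

lemma standard_II: "standard (VJ_II q)"
  unfolding VJ_II_def
  by (rule standard_quot[of "opII q" "\<lambda>x. x"]; simp add: operator_defs)

lemma standard_IS: "standard (VJ_IS q)"
  unfolding VJ_IS_def
  by (rule standard_quot[of "opI q" reversal]; simp add: operator_defs reversal_lder)

lemma standard_IIS: "standard (VJ_IIS q)"
  unfolding VJ_IIS_def
  by (rule standard_quot[of "opII q" reversal]; simp add: operator_defs reversal_lder)

lemma standard_IT: "standard (VJ_IT q)"
  unfolding VJ_IT_def
  by (rule standard_quot[of "opI q" letter_swap]; simp add: operator_defs)

lemma standard_IIT: "standard (VJ_IIT q)"
  unfolding VJ_IIT_def
  by (rule standard_quot[of "opII q" letter_swap]; simp add: operator_defs)

lemma standard_IST: "standard (VJ_IST q)"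
  unfolding VJ_IST_def
  by (rule standard_quot[of "opI q" "\<lambda>x. reversal (letter_swap x)"]; simp add: operator_defs reversal_lder)

lemma standard_IIST: "standard (VJ_IIST q)"
  unfolding VJ_IIST_def
  by (rule standard_quot[of "opII q" "\<lambda>x. reversal (letter_swap x)"]; simp add: operator_defs reversal_lder)

lemmas psi_simps = psi_mult_gen strip_psi psi_rder[symmetric] Ktwist_psi psi_gen[symmetric]

lemma standard_III: "standard (U_III q)"
  unfolding U_III_def
  by (rule standard_U[of "opI q" "\<lambda>x. x"]; simp add: operator_defs psi_simps del: psi_gen)

lemma standard_IV: "standard (U_IV q)"
  unfolding U_IV_def
  by (rule standard_U[of "opII q" "\<lambda>x. x"]; simp add: operator_defs psi_simps del: psi_gen)

lemma standard_IIIS: "standard (U_IIIS q)"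
  unfolding U_IIIS_def
  by (rule standard_U[of "opI q" reversal]; simp add: operator_defs psi_simps reversal_lder del: psi_gen)

lemma standard_IVS: "standard (U_IVS q)"
  unfolding U_IVS_def
  by (rule standard_U[of "opII q" reversal]; simp add: operator_defs psi_simps reversal_lder del: psi_gen)

lemma standard_IIIT: "standard (U_IIIT q)"
  unfolding U_IIIT_def
  by (rule standard_U[of "opI q" letter_swap]; simp add: operator_defs psi_simps del: psi_gen)

lemma standard_IVT: "standard (U_IVT q)"
  unfolding U_IVT_def
  by (rule standard_U[of "opII q" letter_swap]; simp add: operator_defs psi_simps del: psi_gen)

lemma standard_IIIST: "standard (U_IIIST q)"
  unfolding U_IIIST_def
  by (rule standard_U[of "opI q" "\<lambda>x. reversal (letter_swap x)"]; simp add: operator_defs psi_simps reversal_lder del: psi_gen)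

lemma standard_IVST: "standard (U_IVST q)"
  unfolding U_IVST_def
  by (rule standard_U[of "opII q" "\<lambda>x. reversal (letter_swap x)"]; simp add: operator_defs psi_simps reversal_lder del: psi_gen)

end

theorem theorem15p7:
  fixes q :: "'f::field" and V :: "('f, 'v) box_mod"
  assumes "q \<noteq> 0"
    and "\<And>n::nat. n > 0 \<Longrightarrow> q ^ n \<noteq> 1"
    and "box_module q V"
  shows
    "(\<forall>M \<in> {VJ_I q, VJ_IS q, VJ_IT q, VJ_IST q, VJ_II q, VJ_IIS q, VJ_IIT q, VJ_IIST q}.
        box_iso q V M \<longleftrightarrow>
        (\<exists>\<xi>. \<xi> \<noteq> \<zero>\<^bsub>V\<^esub> \<and> generated_by q V \<xi> \<and>
             act V (box_gen q 1) \<xi> = \<zero>\<^bsub>V\<^esub> \<and> act V (box_gen q 3) \<xi> = \<zero>\<^bsub>V\<^esub>))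
     \<and> (\<forall>M \<in> {U_III q, U_IIIS q, U_IIIT q, U_IIIST q, U_IV q, U_IVS q, U_IVT q, U_IVST q}.
        box_iso q V M \<longleftrightarrow>
        (\<exists>\<xi>. \<xi> \<noteq> \<zero>\<^bsub>V\<^esub> \<and> generated_by q V \<xi> \<and>
             act V (box_gen q 1) \<xi> = \<zero>\<^bsub>V\<^esub> \<and> act V (box_gen q 3) \<xi> = \<zero>\<^bsub>V\<^esub>))"
proof -
  interpret qparam q by standard (use assms(1,2) in auto)
  show ?thesis
    by (intro conjI ballI standard_iff_generated[OF assms(3)])
      (auto simp: standard_I standard_IS standard_IT standard_IST standard_II standard_IIS standard_IIT
        standard_IIST standard_III standard_IIIS standard_IIIT standard_IIIST standard_IV standard_IVS
        standard_IVT standard_IVST)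
qed

end
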